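(* Let $K$ be a separable infinite-dimensional Hilbert space and suppose that $\mathcal B(K)$ acts on $H=\mathcal{HS}(K)$ by left multiplications, with a fixed separating and cyclic unit vector $x_0\in H$. Let $k\ge 1$ be an integer. For a normal positive functional $\varrho$ on $\mathcal B(H)$, the following are equivalent: (i) $\varrho$ has Schmidt number not bigger than $k$ (that is, $\varrho\in\mathcal S_k$); (ii) $\langle \mathrm C_\phi,\varrho\rangle\ge 0$ for every $\phi\in\mathbb P^\sigma_k$.
   Context: $\mathcal{HS}(K)$ is the Hilbert space of Hilbert–Schmidt operators on $K$ with $(x|y)=\operatorname{Tr}(xy^* )$ (inner products are linear in the first variable). $\mathcal B(K)$ acts on $H$ by $L_x(y)=xy$; the commutant is $\{R_x:x\in\mathcal B(K)\}$ with $R_x(y)=yx$. $\mathcal B(H)$ and $\mathcal T(H)=\mathcal B(H)_*$ (trace class operators, identified with normal functionals) are paired by $\langle A,B\rangle=\operatorname{Tr}(AB)$. For vectors $x,y\in H$, $x\boxtimes y$ is the operator on $H$ given by $z\mapsto (z|y)x$; as an element of $\mathcal T(H)$ it is identified with the functional $\omega_{x,y}:A\mapsto(Ax|y)$. The rank of $x\in H$ is its rank as an operator on $K$. $\mathcal S_k$ is the norm closed convex cone of $\mathcal T(H)$ generated by the $\omega_{x,x}$ with $x\in H$, $\operatorname{rank}x\le k$; a normal positive functional $\varrho$ has Schmidt number $k$ if $\varrho\in\mathcal S_k\setminus\mathcal S_{k-1}$. A map is normal if it is continuous for the $\sigma$-weak topologies. $\mathbb{CB}^\sigma(\mathcal B(K))$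 is the space of normal completely bounded linear maps $\phi:\mathcal B(K)\to\mathcal B(K)$, and $\mathbb P^\sigma_k$ is the convex cone of those $\phi\in\mathbb{CB}^\sigma(\mathcal B(K))$ which are $k$-positive. For $\phi\in\mathbb{CB}^\sigma(\mathcal B(K))$, the map $R_yL_x\mapsto R_yL_{\phi(x)}$ ($x,y\in\mathcal B(K)$) extends uniquely to a normal linear map $\tilde\phi:\mathcal B(H)\to\mathcal B(H)$; with $E_0=x_0\boxtimes x_0$, put $\mathrm C_\phi=\tilde\phi(E_0)\in\mathcal B(H)$. *)

theory Defs
  imports "HOL-Analysis.Analysis" "HOL-Library.Complex_Order" "HOL-Library.Extended_Nat"
begin

section \<open>Complex Hilbert spaces\<close>

class complex_vector = real_vector +
  fixes scaleC :: "complex \<Rightarrow> 'a \<Rightarrow> 'a"  (infixr \<open>*\<^sub>C\<close> 75)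
  assumes scaleC_add_right: "a *\<^sub>C (x + y) = a *\<^sub>C x + a *\<^sub>C y"
    and scaleC_add_left: "(a + b) *\<^sub>C x = a *\<^sub>C x + b *\<^sub>C x"
    and scaleC_scaleC: "a *\<^sub>C (b *\<^sub>C x) = (a * b) *\<^sub>C x"
    and scaleR_scaleC: "r *\<^sub>R x = complex_of_real r *\<^sub>C x"

global_interpretation cvec: vector_space "scaleC :: complex \<Rightarrow> 'a \<Rightarrow> 'a::complex_vector"
proof
  show "1 *\<^sub>C x = x" for x :: 'a
    using scaleR_scaleC[of 1 x] by simp
qed (simp_all add: scaleC_add_right scaleC_add_left scaleC_scaleC)

abbreviation clinear :: "('a::complex_vector \<Rightarrow> 'b::complex_vector) \<Rightarrow> bool" where
  "clinear \<equiv> Vector_Spaces.linear scaleC scaleC"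

lemma clinear_iff:
  "clinear f \<longleftrightarrow> (\<forall>x y. f (x + y) = f x + f y) \<and> (\<forall>c x. f (c *\<^sub>C x) = c *\<^sub>C f x)"
  unfolding Vector_Spaces.linear_def module_hom_def module_hom_axioms_def
  by (simp add: cvec.vector_space_axioms cvec.module_axioms)

instantiation complex :: complex_vector
begin
definition scaleC_complex :: "complex \<Rightarrow> complex \<Rightarrow> complex"
  where "scaleC_complex = (*)"
instance
  by standard (simp_all add: scaleC_complex_def algebra_simps scaleR_conv_of_real)
end

text \<open>
  The sesquilinear form \<open>cinner\<close> is linear in its first argument; the real inner product (hence the
  norm and the topology) is the one it induces.
\<close>

class complex_hilbert = complex_vector + real_inner + complete_space +
  fixes cinner :: "'a \<Rightarrow> 'a \<Rightarrow> complex"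
  assumes cinner_add_left: "cinner (x + y) z = cinner x z + cinner y z"
    and cinner_scaleC_left: "cinner (c *\<^sub>C x) y = c * cinner x y"
    and cinner_commute: "cinner x y = cnj (cinner y x)"
    and Re_cinner: "Re (cinner x y) = inner x y"

subclass (in complex_hilbert) banach ..

lemma cinner_add_right: "cinner x (y + z) = cinner x y + cinner x z"
  for x y z :: "'a::complex_hilbert"
  by (metis cinner_add_left cinner_commute complex_cnj_add)

lemma cinner_scaleC_right: "cinner x (c *\<^sub>C y) = cnj c * cinner x y"
  for x y :: "'a::complex_hilbert"
  by (metis cinner_scaleC_left cinner_commute complex_cnj_mult)

lemma cinner_scaleR_left: "cinner (r *\<^sub>R x) y = r *\<^sub>R cinner x y"
  and cinner_scaleR_right: "cinner x (r *\<^sub>R y) = r *\<^sub>R cinner x y"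
  for x y :: "'a::complex_hilbert"
  by (simp_all add: scaleR_scaleC cinner_scaleC_left cinner_scaleC_right scaleC_complex_def)

lemma cinner_self: "cinner x x = complex_of_real ((norm x)\<^sup>2)"
  for x :: "'a::complex_hilbert"
proof (rule complex_eqI)
  have "Im (cinner x x) = - Im (cinner x x)"
    by (metis cinner_commute cnj.simps(2))
  then show "Im (cinner x x) = Im (complex_of_real ((norm x)\<^sup>2))" by simp
qed (simp add: Re_cinner dot_square_norm)

lemma norm_scaleC: "norm (c *\<^sub>C x) = cmod c * norm x"
  for x :: "'a::complex_hilbert"
proof -
  have "complex_of_real ((norm (c *\<^sub>C x))\<^sup>2) = (c * cnj c) * complex_of_real ((norm x)\<^sup>2)"
    unfolding cinner_self[symmetric] by (simp add: cinner_scaleC_left cinner_scaleC_right)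
  also have "\<dots> = complex_of_real ((cmod c * norm x)\<^sup>2)"
    by (simp add: complex_norm_square[symmetric] power_mult_distrib)
  finally show ?thesis
    using of_real_eq_iff by (metis mult_nonneg_nonneg norm_ge_zero power2_eq_iff_nonneg)
qed

lemma cmod_cinner_le: "cmod (cinner x y) \<le> norm x * norm y"
  for x y :: "'a::complex_hilbert"
proof (cases "cinner x y = 0")
  case False
  define c where "c = cnj (sgn (cinner x y))"
  have c1: "cmod c = 1" using False by (simp add: c_def norm_sgn)
  have "c * cinner x y = complex_of_real (cmod (cinner x y))"
    using False unfolding c_def sgn_eq
    by (simp add: field_simps complex_norm_square[symmetric] power2_eq_square)
  then have "cmod (cinner x y) = Re (cinner (c *\<^sub>C x) y)"
    by (simp add: cinner_scaleC_left)
  also have "\<dots> \<le> norm (c *\<^sub>C x) * norm y"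
    unfolding Re_cinner by (rule norm_cauchy_schwarz)
  finally show ?thesis by (simp add: norm_scaleC c1)
qed simp

lemma bounded_bilinear_cinner: "bounded_bilinear (cinner :: 'a \<Rightarrow> 'a::complex_hilbert \<Rightarrow> complex)"
proof
  show "\<exists>K. \<forall>a b::'a. norm (cinner a b) \<le> norm a * norm b * K"
    using cmod_cinner_le by (intro exI[of _ 1]) auto
qed (simp_all add: cinner_add_left cinner_add_right cinner_scaleR_left cinner_scaleR_right)

lemmas bounded_linear_cinner_left = bounded_bilinear.bounded_linear_left[OF bounded_bilinear_cinner]
lemmas bounded_linear_cinner_right = bounded_bilinear.bounded_linear_right[OF bounded_bilinear_cinner]

lemma cinner_diff_left: "cinner (x - y) z = cinner x z - cinner y z"
  and cinner_diff_right: "cinner z (x - y) = cinner z x - cinner z y"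
  and cinner_zero_left [simp]: "cinner 0 z = 0"
  and cinner_zero_right [simp]: "cinner z 0 = 0"
  for x y z :: "'a::complex_hilbert"
  using bounded_linear.linear[OF bounded_linear_cinner_left[of z]]
    bounded_linear.linear[OF bounded_linear_cinner_right[of z]]
  by (simp_all add: linear_diff linear_0 linear_diff[of "\<lambda>a. cinner a z"] linear_0[of "\<lambda>a. cinner a z"])

lemma cinner_sum_left: "cinner (sum f F) z = (\<Sum>i\<in>F. cinner (f i) z)"
  and cinner_sum_right: "cinner z (sum f F) = (\<Sum>i\<in>F. cinner z (f i))"
  for z :: "'a::complex_hilbert"
  using linear_sum[OF bounded_linear.linear[OF bounded_linear_cinner_left[of z]]]
    linear_sum[OF bounded_linear.linear[OF bounded_linear_cinner_right[of z]]]
  by simp_all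

lemma cinner_ext: "(\<And>z. cinner x z = cinner y z) \<Longrightarrow> x = y"
  for x y :: "'a::complex_hilbert"
proof -
  assume "\<And>z. cinner x z = cinner y z"
  then have "cinner (x - y) (x - y) = 0" by (simp add: cinner_diff_left)
  then show ?thesis by (simp add: cinner_self)
qed


subsection \<open>Orthonormal bases\<close>

definition is_ortho :: "'a::complex_hilbert set \<Rightarrow> bool" where
  "is_ortho B \<longleftrightarrow> (\<forall>e\<in>B. \<forall>f\<in>B. cinner e f = (if e = f then 1 else 0))"

definition is_onb :: "'a::complex_hilbert set \<Rightarrow> bool" where
  "is_onb B \<longleftrightarrow> is_ortho B \<and> (\<forall>x. (\<forall>e\<in>B. cinner x e = 0) \<longrightarrow> x = 0)"

lemma exists_onb: "\<exists>B :: 'a::complex_hilbert set. is_onb B"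
proof -
  have "\<exists>M\<in>Collect is_ortho. \<forall>X\<in>Collect is_ortho. M \<subseteq> X \<longrightarrow> X = (M :: 'a set)"
  proof (rule subset_Zorn')
    fix C :: "'a set set" assume C: "subset.chain (Collect is_ortho) C"
    show "\<Union>C \<in> Collect is_ortho"
      unfolding is_ortho_def mem_Collect_eq
    proof (intro ballI)
      fix e f assume "e \<in> \<Union>C" "f \<in> \<Union>C"
      then obtain X Y where "X \<in> C" "e \<in> X" "Y \<in> C" "f \<in> Y" by blast
      with C obtain Z where "Z \<in> C" "e \<in> Z" "f \<in> Z"
        unfolding subset.chain_def by blast
      with C show "cinner e f = (if e = f then 1 else 0)"
        unfolding subset.chain_def is_ortho_def by blast
    qed
  qed
  then obtain M :: "'a set" where M: "is_ortho M"
    and max: "\<And>X. is_ortho X \<Longrightarrow> M \<subseteq> X \<Longrightarrow> X = M" by blast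
  have "x = 0" if x: "\<forall>e\<in>M. cinner x e = 0" for x
  proof (rule ccontr)
    assume "x \<noteq> 0"
    define u where "u = complex_of_real (1 / norm x) *\<^sub>C x"
    have "norm u = 1" using \<open>x \<noteq> 0\<close> by (simp add: u_def norm_scaleC norm_divide)
    then have uu: "cinner u u = 1" by (simp add: cinner_self)
    have ue: "cinner u e = 0" if "e \<in> M" for e
      using x that by (simp add: u_def cinner_scaleC_left)
    have eu: "cinner e u = 0" if "e \<in> M" for e
      using ue[OF that] cinner_commute[of e u] by simp
    have "is_ortho (insert u M)"
      using M uu ue eu unfolding is_ortho_def by auto
    then have "insert u M = M" by (rule max) auto
    then have "u \<in> M" by auto
    with ue uu show False by auto
  qed
  with M show ?thesis unfolding is_onb_def by blast
qed

definition onb :: "'a::complex_hilbert set" where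
  "onb = (SOME B. is_onb B)"

lemma is_onb_onb: "is_onb onb"
  unfolding onb_def by (rule someI_ex[OF exists_onb])

lemma norm_sum_ortho:
  assumes "is_ortho B" "finite F" "F \<subseteq> B"
  shows "(norm (\<Sum>e\<in>F. c e *\<^sub>C e))\<^sup>2 = (\<Sum>e\<in>F. (cmod (c e))\<^sup>2)"
proof -
  have "cinner (\<Sum>e\<in>F. c e *\<^sub>C e) (\<Sum>f\<in>F. c f *\<^sub>C f)
      = (\<Sum>e\<in>F. \<Sum>f\<in>F. c e * (cnj (c f) * cinner e f))"
    by (simp add: cinner_sum_left cinner_sum_right cinner_scaleC_left cinner_scaleC_right)
      (subst sum.swap, simp add: sum_distrib_left mult_ac)
  also have "\<dots> = (\<Sum>e\<in>F. \<Sum>f\<in>F. if e = f then c e * cnj (c e) else 0)"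
    by (intro sum.cong refl) (use assms in \<open>auto simp: is_ortho_def subset_iff\<close>)
  also have "\<dots> = complex_of_real (\<Sum>e\<in>F. (cmod (c e))\<^sup>2)"
    using assms(2) by (simp add: complex_norm_square[symmetric])
  finally show ?thesis unfolding cinner_self of_real_eq_iff .
qed

lemma summable_on_ortho:
  assumes B: "is_ortho B" and s: "(\<lambda>e. (cmod (c e))\<^sup>2) summable_on B"
  shows "(\<lambda>e. c e *\<^sub>C e) summable_on B"
proof -
  let ?g = "\<lambda>e. (cmod (c e))\<^sup>2" and ?f = "\<lambda>e. c e *\<^sub>C e"
  from s obtain L where L: "(?g has_sum L) B" by (auto simp: summable_on_def)
  have "\<exists>P. eventually P (finite_subsets_at_top B) \<and>
              (\<forall>F F'. P F \<and> P F' \<longrightarrow> dist (sum ?f F) (sum ?f F') < \<epsilon>)" if "\<epsilon> > 0" for \<epsilon>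
  proof -
    define \<delta> where "\<delta> = (\<epsilon>/2)\<^sup>2"
    have "\<delta> > 0" using that by (simp add: \<delta>_def)
    then have "eventually (\<lambda>F. dist (sum ?g F) L < \<delta>) (finite_subsets_at_top B)"
      using L unfolding has_sum_def tendsto_iff by blast
    then obtain F0 where F0: "finite F0" "F0 \<subseteq> B" "dist (sum ?g F0) L < \<delta>"
      unfolding eventually_finite_subsets_at_top by blast
    define P where "P F \<longleftrightarrow> finite F \<and> F0 \<subseteq> F \<and> F \<subseteq> B" for F
    have ev: "eventually P (finite_subsets_at_top B)"
      unfolding eventually_finite_subsets_at_top P_def using F0 by blast
    have near: "dist (sum ?f F) (sum ?f F0) < \<epsilon>/2" if "P F" for F
    proof -
      have F: "finite F" "F0 \<subseteq> F" "F \<subseteq> B" using that by (auto simp: P_def)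
      have "(dist (sum ?f F) (sum ?f F0))\<^sup>2 = (norm (sum ?f (F - F0)))\<^sup>2"
        using F by (simp add: dist_norm sum_diff)
      also have "\<dots> = sum ?g (F - F0)"
        by (rule norm_sum_ortho[OF B]) (use F in auto)
      also have "\<dots> = sum ?g F - sum ?g F0" using F by (simp add: sum_diff)
      also have "\<dots> \<le> L - sum ?g F0"
        using finite_sum_le_has_sum[OF L F(1)] F by auto
      also have "\<dots> < \<delta>" using F0(3) by (simp add: dist_real_def)
      finally have "(dist (sum ?f F) (sum ?f F0))\<^sup>2 < (\<epsilon>/2)\<^sup>2" by (simp add: \<delta>_def)
      then show ?thesis by (rule power_less_imp_less_base) (use \<open>\<epsilon> > 0\<close> in simp)
    qed
    have "dist (sum ?f F) (sum ?f F') < \<epsilon>" if "P F" "P F'" for F F'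
      using near[OF that(1)] near[OF that(2)] by (metis dist_triangle_half_l)
    with ev show ?thesis by blast
  qed
  then have "cauchy_filter (filtermap (sum ?f) (finite_subsets_at_top B))"
    by (simp add: cauchy_filter_metric_filtermap)
  moreover have "complete (UNIV::'a set)"
    by (meson Cauchy_convergent UNIV_I complete_def convergent_def)
  ultimately obtain L' where "(sum ?f \<longlongrightarrow> L') (finite_subsets_at_top B)"
    using complete_uniform[where S=UNIV] by (force simp add: filterlim_def)
  then show ?thesis using summable_on_def has_sum_def by blast
qed

lemma bessel:
  assumes B: "is_ortho B" and F: "finite F" "F \<subseteq> B"
  shows "(\<Sum>e\<in>F. (cmod (cinner x e))\<^sup>2) \<le> (norm x)\<^sup>2"
proof -
  define s where "s = (\<Sum>e\<in>F. cinner x e *\<^sub>C e)"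
  define S where "S = (\<Sum>e\<in>F. (cmod (cinner x e))\<^sup>2)"
  have ss: "(norm s)\<^sup>2 = S" unfolding s_def S_def by (rule norm_sum_ortho[OF B F])
  have xs: "cinner x s = complex_of_real S"
    unfolding s_def S_def
    by (simp add: cinner_sum_right cinner_scaleC_right complex_norm_square mult.commute del: of_real_power)
  have "S = Re (cinner x s)" by (simp add: xs)
  also have "\<dots> \<le> norm x * norm s" unfolding Re_cinner by (rule norm_cauchy_schwarz)
  finally have "(norm s)\<^sup>2 \<le> norm x * norm s" by (simp add: ss)
  then have "norm s \<le> norm x"
    by (cases "norm s = 0") (auto simp: power2_eq_square)
  then show ?thesis using ss unfolding S_def by (metis norm_ge_zero power_mono)
qed

lemma summable_on_bessel:
  assumes "is_ortho B"
  shows "(\<lambda>e. (cmod (cinner x e))\<^sup>2) summable_on B"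
  by (rule nonneg_bdd_above_summable_on)
    (use bessel[OF assms] in \<open>auto intro!: bdd_aboveI[of _ "(norm x)\<^sup>2"]\<close>)

lemma has_sum_cinner_left:
  "(f has_sum s) B \<Longrightarrow> ((\<lambda>i. cinner (f i) z) has_sum cinner s z) B"
  by (rule has_sum_bounded_linear[OF bounded_linear_cinner_left])

lemma has_sum_cinner_right:
  "(f has_sum s) B \<Longrightarrow> ((\<lambda>i. cinner z (f i)) has_sum cinner z s) B"
  by (rule has_sum_bounded_linear[OF bounded_linear_cinner_right])

lemma cinner_has_sum_ortho:
  assumes B: "is_ortho B" and s: "((\<lambda>e. c e *\<^sub>C e) has_sum s) B" and f: "f \<in> B"
  shows "cinner s f = c f"
proof -
  have "((\<lambda>e. cinner (c e *\<^sub>C e) f) has_sum cinner s f) B"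
    by (rule has_sum_cinner_left[OF s])
  moreover have "((\<lambda>e. cinner (c e *\<^sub>C e) f) has_sum c f) B"
    by (rule has_sum_finite_neutralI[of "{f}"])
      (use B f in \<open>auto simp: is_ortho_def cinner_scaleC_left\<close>)
  ultimately show ?thesis by (rule has_sum_unique)
qed

lemma onb_expansion:
  assumes B: "is_onb B"
  shows "((\<lambda>e. cinner x e *\<^sub>C e) has_sum x) B"
proof -
  have o: "is_ortho B" using B by (simp add: is_onb_def)
  from summable_on_ortho[OF o summable_on_bessel[OF o, of x]]
  obtain s where s: "((\<lambda>e. cinner x e *\<^sub>C e) has_sum s) B" by (auto simp: summable_on_def)
  have "\<forall>e\<in>B. cinner (x - s) e = 0"
    using cinner_has_sum_ortho[OF o s] by (simp add: cinner_diff_left)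
  then have "x - s = 0" using B unfolding is_onb_def by blast
  then show ?thesis using s by simp
qed

lemma parseval:
  assumes B: "is_onb B"
  shows "((\<lambda>e. (cmod (cinner x e))\<^sup>2) has_sum (norm x)\<^sup>2) B"
proof -
  have "((\<lambda>e. cinner (cinner x e *\<^sub>C e) x) has_sum cinner x x) B"
    by (rule has_sum_cinner_left[OF onb_expansion[OF B]])
  moreover have "cinner (cinner x e *\<^sub>C e) x = complex_of_real ((cmod (cinner x e))\<^sup>2)" for e
    unfolding cinner_scaleC_left complex_norm_square using cinner_commute[of e x] by simp
  ultimately show ?thesis unfolding cinner_self by (simp only: has_sum_of_real_iff)
qed


section \<open>Bounded operators\<close>

typedef (overloaded) 'a bop = "{f :: 'a::complex_hilbert \<Rightarrow> 'a. clinear f \<and> bounded_linear f}"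
  morphisms bop_apply Bop
proof
  show "(\<lambda>x. 0) \<in> {f :: 'a \<Rightarrow> 'a. clinear f \<and> bounded_linear f}"
    by (simp add: clinear_iff)
qed

setup_lifting type_definition_bop

declare [[coercion "bop_apply :: 'a::complex_hilbert bop \<Rightarrow> 'a \<Rightarrow> 'a"]]

lemma bop_eqI: "(\<And>v. bop_apply x v = bop_apply y v) \<Longrightarrow> x = y"
  by (simp add: bop_apply_inject[symmetric] fun_eq_iff)

lemma bounded_linear_bop: "bounded_linear (bop_apply x)"
  using bop_apply[of x] by simp

lemma bop_add_right: "bop_apply x (u + v) = bop_apply x u + bop_apply x v"
  and bop_scaleC_right: "bop_apply x (c *\<^sub>C u) = c *\<^sub>C bop_apply x u"
  using bop_apply[of x] by (simp_all add: clinear_iff)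

instantiation bop :: (complex_hilbert) "{real_normed_vector, complex_vector}"
begin

lift_definition zero_bop :: "'a bop" is "\<lambda>v. 0" by (simp add: clinear_iff)
lift_definition plus_bop :: "'a bop \<Rightarrow> 'a bop \<Rightarrow> 'a bop" is "\<lambda>f g v. f v + g v"
  by (auto simp: clinear_iff scaleC_add_right algebra_simps intro: bounded_linear_add)
lift_definition minus_bop :: "'a bop \<Rightarrow> 'a bop \<Rightarrow> 'a bop" is "\<lambda>f g v. f v - g v"
  by (auto simp: clinear_iff cvec.scale_right_diff_distrib algebra_simps intro: bounded_linear_sub)
lift_definition uminus_bop :: "'a bop \<Rightarrow> 'a bop" is "\<lambda>f v. - f v"
  by (auto simp: clinear_iff intro: bounded_linear_minus)
lift_definition scaleC_bop :: "complex \<Rightarrow> 'a bop \<Rightarrow> 'a bop" is "\<lambda>c f v. c *\<^sub>C f v"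
proof -
  fix c and f :: "'a \<Rightarrow> 'a" assume f: "clinear f \<and> bounded_linear f"
  then obtain K where K: "\<And>x. norm (f x) \<le> norm x * K"
    using bounded_linear.bounded by blast
  have "bounded_linear (\<lambda>v. c *\<^sub>C f v)"
  proof (rule bounded_linear_intro)
    show "norm (c *\<^sub>C f x) \<le> norm x * (cmod c * K)" for x
      using mult_left_mono[OF K[of x], of "cmod c"] by (simp add: norm_scaleC mult_ac)
  qed (use f in \<open>simp_all add: clinear_iff scaleC_add_right scaleR_scaleC scaleC_scaleC mult_ac\<close>)
  with f show "clinear (\<lambda>v. c *\<^sub>C f v) \<and> bounded_linear (\<lambda>v. c *\<^sub>C f v)"
    by (simp add: clinear_iff scaleC_add_right scaleC_scaleC mult_ac)
qed
definition scaleR_bop :: "real \<Rightarrow> 'a bop \<Rightarrow> 'a bop"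
  where "scaleR_bop r x = complex_of_real r *\<^sub>C x"
lift_definition norm_bop :: "'a bop \<Rightarrow> real" is onorm .
definition dist_bop :: "'a bop \<Rightarrow> 'a bop \<Rightarrow> real" where "dist_bop x y = norm (x - y)"
definition uniformity_bop :: "('a bop \<times> 'a bop) filter"
  where "uniformity_bop = (INF e\<in>{0 <..}. principal {(x, y). dist x y < e})"
definition open_bop :: "'a bop set \<Rightarrow> bool"
  where "open_bop U = (\<forall>x\<in>U. \<forall>\<^sub>F (x', y) in uniformity. x' = x \<longrightarrow> y \<in> U)"
definition sgn_bop :: "'a bop \<Rightarrow> 'a bop" where "sgn_bop x = scaleR (inverse (norm x)) x"

instance
proof
  fix a b x y z :: "'a bop" and r s :: real and c d :: complex
  show "x + y + z = x + (y + z)" "x + y = y + x" "0 + x = x" "- x + x = 0" "x - y = x + - y"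
    by (transfer, simp add: fun_eq_iff)+
  show "c *\<^sub>C (x + y) = c *\<^sub>C x + c *\<^sub>C y" "(c + d) *\<^sub>C x = c *\<^sub>C x + d *\<^sub>C x"
    "c *\<^sub>C (d *\<^sub>C x) = (c * d) *\<^sub>C x"
    by (transfer, simp add: scaleC_add_right scaleC_add_left scaleC_scaleC)+
  show "r *\<^sub>R x = complex_of_real r *\<^sub>C x" by (rule scaleR_bop_def)
  show "r *\<^sub>R (x + y) = r *\<^sub>R x + r *\<^sub>R y" "(r + s) *\<^sub>R x = r *\<^sub>R x + s *\<^sub>R x"
    "r *\<^sub>R s *\<^sub>R x = (r * s) *\<^sub>R x" "1 *\<^sub>R x = x"
    unfolding scaleR_bop_def
    by (transfer, simp add: scaleC_add_right scaleC_add_left scaleC_scaleC)+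
  show "norm x = 0 \<longleftrightarrow> x = 0"
    by transfer (auto simp: onorm_eq_0 fun_eq_iff)
  show "norm (x + y) \<le> norm x + norm y"
    by transfer (auto intro: onorm_triangle)
  show "norm (r *\<^sub>R x) = \<bar>r\<bar> * norm x"
    unfolding scaleR_bop_def by transfer (simp add: scaleR_scaleC[symmetric] onorm_scaleR)
qed (simp_all add: dist_bop_def sgn_bop_def uniformity_bop_def open_bop_def)

end

lemma bop_apply_simps [simp]:
  "bop_apply 0 v = 0" "bop_apply (x + y) v = bop_apply x v + bop_apply y v"
  "bop_apply (x - y) v = bop_apply x v - bop_apply y v"
  "bop_apply (- x) v = - bop_apply x v" "bop_apply (c *\<^sub>C x) v = c *\<^sub>C bop_apply x v"
  "bop_apply (r *\<^sub>R x) v = r *\<^sub>R bop_apply x v"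
  unfolding scaleR_scaleC by (transfer, simp)+

lemma norm_bop_apply: "norm (bop_apply x v) \<le> norm x * norm v"
  by transfer (simp add: onorm)

lemma norm_bop_bound: "0 \<le> b \<Longrightarrow> (\<And>v. norm (bop_apply x v) \<le> b * norm v) \<Longrightarrow> norm x \<le> b"
  by transfer (simp add: onorm_bound)

instance bop :: (complex_hilbert) banach
proof
  fix X :: "nat \<Rightarrow> 'a bop" assume X: "Cauchy X"
  have diff: "norm (bop_apply (X m) v - bop_apply (X n) v) \<le> norm (X m - X n) * norm v" for m n v
    using norm_bop_apply[of "X m - X n" v] by simp
  have "Cauchy (\<lambda>n. bop_apply (X n) v)" for v
  proof (rule CauchyI)
    fix e :: real assume "e > 0"
    then have "e / (norm v + 1) > 0" by (intro divide_pos_pos add_nonneg_pos) auto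
    with X obtain M where M: "\<And>m n. m \<ge> M \<Longrightarrow> n \<ge> M \<Longrightarrow> norm (X m - X n) < e / (norm v + 1)"
      using CauchyD by blast
    have "norm (bop_apply (X m) v - bop_apply (X n) v) < e" if "m \<ge> M" "n \<ge> M" for m n
    proof -
      have "norm (bop_apply (X m) v - bop_apply (X n) v) \<le> norm (X m - X n) * (norm v + 1)"
        using diff[of m v n] by (smt (verit) mult_left_mono norm_ge_zero)
      also have "\<dots> < e"
        using M[OF that] by (simp add: pos_less_divide_eq add_nonneg_pos)
      finally show ?thesis .
    qed
    then show "\<exists>M. \<forall>m\<ge>M. \<forall>n\<ge>M. norm (bop_apply (X m) v - bop_apply (X n) v) < e" by blast
  qed
  then have "convergent (\<lambda>n. bop_apply (X n) v)" for v by (rule Cauchy_convergent)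
  then obtain f where f: "\<And>v. (\<lambda>n. bop_apply (X n) v) \<longlonglongrightarrow> f v"
    unfolding convergent_def by metis
  obtain K where K: "\<And>n. norm (X n) \<le> K"
    using Cauchy_Bseq[OF X] unfolding Bseq_def by blast
  have add: "f (u + v) = f u + f v" for u v
    using tendsto_add[OF f[of u] f[of v]] LIMSEQ_unique[OF f[of "u + v"]]
    by (simp add: bop_add_right)
  have bl: "bounded_linear (\<lambda>x::'a. c *\<^sub>C x)" for c
    by (rule bounded_linear_intro[of _ "cmod c"])
      (simp_all add: scaleC_add_right scaleR_scaleC scaleC_scaleC norm_scaleC mult_ac)
  have scl: "f (c *\<^sub>C v) = c *\<^sub>C f v" for c v
    using bounded_linear.tendsto[OF bl f[of v], of c] LIMSEQ_unique[OF f[of "c *\<^sub>C v"]]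
    by (simp add: bop_scaleC_right)
  have "norm (f v) \<le> norm v * K" for v
  proof (rule LIMSEQ_le_const2[OF tendsto_norm[OF f[of v]]])
    have "norm (bop_apply (X n) v) \<le> norm v * K" for n
      using norm_bop_apply[of "X n" v] mult_right_mono[OF K[of n], of "norm v"]
      by (simp add: mult.commute)
    then show "\<exists>N. \<forall>n\<ge>N. norm (bop_apply (X n) v) \<le> norm v * K" by blast
  qed
  then have "bounded_linear f"
    by (intro bounded_linear_intro[of f K]) (simp_all add: add scl scaleR_scaleC)
  then have Bf: "bop_apply (Bop f) = f"
    by (intro Bop_inverse) (simp add: clinear_iff add scl)
  have "X \<longlonglongrightarrow> Bop f"
  proof (rule LIMSEQ_I)
    fix r :: real assume "r > 0"
    then obtain M where M: "\<And>m n. m \<ge> M \<Longrightarrow> n \<ge> M \<Longrightarrow> norm (X m - X n) < r/2"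
      using CauchyD[OF X, of "r/2"] by auto
    have "norm (X n - Bop f) < r" if n: "n \<ge> M" for n
    proof -
      have "norm (bop_apply (X n - Bop f) v) \<le> r/2 * norm v" for v
        unfolding bop_apply_simps Bf
      proof (rule LIMSEQ_le_const2)
        show "(\<lambda>m. norm (bop_apply (X n) v - bop_apply (X m) v)) \<longlonglongrightarrow> norm (bop_apply (X n) v - f v)"
          by (intro tendsto_intros f)
        have "norm (bop_apply (X n) v - bop_apply (X m) v) \<le> r/2 * norm v" if "m \<ge> M" for m
          using diff[of n v m] M[OF n that] by (smt (verit) mult_right_mono norm_ge_zero)
        then show "\<exists>N. \<forall>m\<ge>N. norm (bop_apply (X n) v - bop_apply (X m) v) \<le> r/2 * norm v" by blast
      qed
      then have "norm (X n - Bop f) \<le> r/2" using \<open>r > 0\<close> by (intro norm_bop_bound) auto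
      then show ?thesis using \<open>r > 0\<close> by simp
    qed
    then show "\<exists>no. \<forall>n\<ge>no. norm (X n - Bop f) < r" by blast
  qed
  then show "convergent X" by (auto simp: convergent_def)
qed

lift_definition bop_comp :: "'a::complex_hilbert bop \<Rightarrow> 'a bop \<Rightarrow> 'a bop"  (infixl \<open>\<odot>\<close> 70)
  is "\<lambda>f g v. f (g v)"
  by (auto simp: clinear_iff intro: bounded_linear_compose)

lemma bop_comp_apply [simp]: "bop_apply (x \<odot> y) v = bop_apply x (bop_apply y v)"
  by transfer simp

definition adj :: "'a::complex_hilbert bop \<Rightarrow> 'a bop" where
  "adj x = (THE y. \<forall>u v. cinner (bop_apply x u) v = cinner u (bop_apply y v))"

lemma adj_exists: "\<exists>y. \<forall>u v. cinner (bop_apply x u) v = cinner u (bop_apply y v)"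
  for x :: "'a::complex_hilbert bop"
proof -
  let ?B = "onb :: 'a set"
  have o: "is_ortho ?B" using is_onb_onb[where 'a = 'a] by (simp add: is_onb_def)
  have bd: "(\<Sum>e\<in>F. (cmod (cinner v (bop_apply x e)))\<^sup>2) \<le> (norm x * norm v)\<^sup>2"
    if F: "finite F" "F \<subseteq> ?B" for F v
  proof -
    define z where "z = (\<Sum>e\<in>F. cinner v (bop_apply x e) *\<^sub>C e)"
    define S where "S = (\<Sum>e\<in>F. (cmod (cinner v (bop_apply x e)))\<^sup>2)"
    have zz: "(norm z)\<^sup>2 = S" unfolding z_def S_def by (rule norm_sum_ortho[OF o F])
    have xz: "bop_apply x z = (\<Sum>e\<in>F. cinner v (bop_apply x e) *\<^sub>C bop_apply x e)"
      unfolding z_def using bounded_linear_bop[of x]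
      by (simp add: linear_sum bounded_linear.linear bop_scaleC_right)
    have "cinner v (bop_apply x z) = complex_of_real S"
      unfolding xz S_def
      by (simp add: cinner_sum_right cinner_scaleC_right complex_norm_square mult.commute del: of_real_power)
    then have "S = Re (cinner v (bop_apply x z))" by simp
    also have "\<dots> \<le> norm v * norm (bop_apply x z)" unfolding Re_cinner by (rule norm_cauchy_schwarz)
    also have "\<dots> \<le> norm v * (norm x * norm z)" by (intro mult_left_mono norm_bop_apply) auto
    finally have "norm z * norm z \<le> (norm x * norm v) * norm z"
      using zz by (simp add: power2_eq_square mult_ac)
    then have "norm z \<le> norm x * norm v"
      by (cases "norm z = 0") (auto simp: mult_le_cancel_right)
    then show ?thesis using zz unfolding S_def by (metis norm_ge_zero power_mono)
  qed
  have "\<exists>w. \<forall>u. cinner (bop_apply x u) v = cinner u w" for v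
  proof -
    have "(\<lambda>e. (cmod (cinner v (bop_apply x e)))\<^sup>2) summable_on ?B"
      by (rule nonneg_bdd_above_summable_on)
        (use bd[of _ v] in \<open>auto intro!: bdd_aboveI[of _ "(norm x * norm v)\<^sup>2"]\<close>)
    from summable_on_ortho[OF o this] obtain w
      where w: "((\<lambda>e. cinner v (bop_apply x e) *\<^sub>C e) has_sum w) ?B" by (auto simp: summable_on_def)
    have we: "cinner w e = cinner v (bop_apply x e)" if "e \<in> ?B" for e
      by (rule cinner_has_sum_ortho[OF o w that])
    have "cinner (bop_apply x u) v = cinner u w" for u
    proof -
      have e: "((\<lambda>e. cinner u e *\<^sub>C e) has_sum u) ?B" by (rule onb_expansion[OF is_onb_onb])
      have "((\<lambda>e. cinner (bop_apply x (cinner u e *\<^sub>C e)) v) has_sum cinner (bop_apply x u) v) ?B"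
        using has_sum_bounded_linear[OF bounded_linear_bop[of x] e] 
        by (intro has_sum_cinner_left) (simp add: o_def)
      moreover have "((\<lambda>e. cinner (cinner u e *\<^sub>C e) w) has_sum cinner u w) ?B"
        by (rule has_sum_cinner_left[OF e])
      moreover have "cinner (bop_apply x (cinner u e *\<^sub>C e)) v = cinner (cinner u e *\<^sub>C e) w"
        if "e \<in> ?B" for e
        using we[OF that] cinner_commute[of e w] cinner_commute[of "bop_apply x e" v]
        by (simp add: bop_scaleC_right cinner_scaleC_left)
      ultimately show ?thesis
        using has_sum_unique has_sum_cong by (metis (no_types, lifting))
    qed
    then show ?thesis by blast
  qed
  then obtain g where g: "\<And>u v. cinner (bop_apply x u) v = cinner u (g v)" by metis
  have g': "cinner (g v) u = cinner v (bop_apply x u)" for u v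
    by (metis g cinner_commute)
  have add: "g (v + w) = g v + g w" for v w
    by (rule cinner_ext) (simp add: g' cinner_add_left)
  have scl: "g (c *\<^sub>C v) = c *\<^sub>C g v" for c v
    by (rule cinner_ext) (simp add: g' cinner_scaleC_left)
  have "norm (g v) \<le> norm v * norm x" for v
  proof (cases "norm (g v) = 0")
    case False
    have "(norm (g v))\<^sup>2 = Re (cinner v (bop_apply x (g v)))"
      using g'[of v "g v"] by (metis Re_complex_of_real cinner_self)
    also have "\<dots> \<le> norm v * norm (bop_apply x (g v))" unfolding Re_cinner by (rule norm_cauchy_schwarz)
    also have "\<dots> \<le> norm v * (norm x * norm (g v))" by (intro mult_left_mono norm_bop_apply) auto
    finally show ?thesis using False by (simp add: power2_eq_square flip: mult.assoc)
  qed simp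
  then have "bounded_linear g"
    by (intro bounded_linear_intro[of g "norm x"]) (simp_all add: add scl scaleR_scaleC)
  then have "bop_apply (Bop g) = g"
    by (intro Bop_inverse) (simp add: clinear_iff add scl)
  then show ?thesis using g by (intro exI[of _ "Bop g"]) simp
qed

lemma cinner_adj: "cinner (bop_apply x u) v = cinner u (bop_apply (adj x) v)"
proof -
  have "\<exists>!y. \<forall>u v. cinner (bop_apply x u) v = cinner u (bop_apply y v)"
  proof (rule ex_ex1I[OF adj_exists])
    fix y z assume y: "\<forall>u v. cinner (bop_apply x u) v = cinner u (bop_apply y v)"
      and z: "\<forall>u v. cinner (bop_apply x u) v = cinner u (bop_apply z v)"
    have "bop_apply y v = bop_apply z v" for v
      by (rule cinner_ext) (metis y z cinner_commute)
    then show "y = z" by (rule bop_eqI)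
  qed
  from theI'[OF this] show ?thesis unfolding adj_def by blast
qed

lemma cinner_adj': "cinner (bop_apply (adj x) u) v = cinner u (bop_apply x v)"
  by (metis cinner_adj cinner_commute)

lemma adj_eqI:
  assumes "\<And>u v. cinner (bop_apply x u) v = cinner u (bop_apply y v)"
  shows "adj x = y"
proof (rule bop_eqI)
  fix v
  have "cinner (bop_apply (adj x) v) u = cinner (bop_apply y v) u" for u
    using assms[of u v] cinner_adj[of x u v] by (metis cinner_commute)
  then show "bop_apply (adj x) v = bop_apply y v" by (rule cinner_ext)
qed

lemma adj_adj [simp]: "adj (adj x) = x"
  by (rule adj_eqI) (simp add: cinner_adj')
lemma adj_comp: "adj (x \<odot> y) = adj y \<odot> adj x"
  by (rule adj_eqI) (simp add: cinner_adj)
lemma adj_add: "adj (x + y) = adj x + adj y"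
  by (rule adj_eqI) (simp add: cinner_adj cinner_add_left cinner_add_right)
lemma adj_scaleC: "adj (c *\<^sub>C x) = cnj c *\<^sub>C adj x"
  by (rule adj_eqI) (simp add: cinner_adj cinner_scaleC_left cinner_scaleC_right)


section \<open>Hilbert--Schmidt operators\<close>

definition trace :: "'a::complex_hilbert bop \<Rightarrow> complex" where
  "trace x = (\<Sum>\<^sub>\<infinity>e\<in>onb. cinner (bop_apply x e) e)"

definition hilbert_schmidt :: "'a::complex_hilbert bop \<Rightarrow> bool" where
  "hilbert_schmidt x \<longleftrightarrow> (\<lambda>e. (norm (bop_apply x e))\<^sup>2) summable_on onb"

text \<open>
  Applied twice (with \<open>adj_adj\<close>), the next lemma shows that \<open>(\<Sum>\<^sub>\<infinity>e\<in>B. (norm (x e))\<^sup>2)\<close>, and hence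
  \<open>hilbert_schmidt\<close>, does not depend on the choice of the orthonormal basis.
\<close>

lemma hs_sum_adj:
  assumes B: "is_onb B" and B': "is_onb B'"
    and S: "((\<lambda>e. (norm (bop_apply x e))\<^sup>2) has_sum S) B"
  shows "((\<lambda>f. (norm (bop_apply (adj x) f))\<^sup>2) has_sum S) B'"
proof -
  let ?g = "\<lambda>(e, f). (cmod (cinner (bop_apply x e) f))\<^sup>2"
  have row: "((\<lambda>f. ?g (e, f)) has_sum (norm (bop_apply x e))\<^sup>2) B'" for e
    using parseval[OF B'] by simp
  have "?g summable_on (B \<times> B')"
  proof (rule nonneg_bdd_above_summable_on)
    show "bdd_above (sum ?g ` {F. F \<subseteq> B \<times> B' \<and> finite F})"
    proof (rule bdd_aboveI, clarsimp)
      fix F assume F: "F \<subseteq> B \<times> B'" "finite F"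
      have sub: "F \<subseteq> fst ` F \<times> snd ` F" by force
      have "sum ?g F \<le> sum ?g (fst ` F \<times> snd ` F)"
        by (rule sum_mono2) (use F sub in auto)
      also have "\<dots> = (\<Sum>e\<in>fst ` F. \<Sum>f\<in>snd ` F. ?g (e, f))"
        by (simp add: sum.cartesian_product)
      also have "\<dots> \<le> (\<Sum>e\<in>fst ` F. (norm (bop_apply x e))\<^sup>2)"
        by (intro sum_mono finite_sum_le_has_sum[OF row]) (use F in auto)
      also have "\<dots> \<le> S"
        by (rule finite_sum_le_has_sum[OF S]) (use F in auto)
      finally show "sum ?g F \<le> S" .
    qed
  qed auto
  then have "(?g has_sum S) (B \<times> B')" by (intro has_sum_SigmaI[OF row S])
  then have "((\<lambda>(f, e). ?g (e, f)) has_sum S) (B' \<times> B)" by (subst (asm) has_sum_swap)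
  moreover have "((\<lambda>e. (\<lambda>(f, e). ?g (e, f)) (f, e)) has_sum (norm (bop_apply (adj x) f))\<^sup>2) B" for f
  proof -
    have "cmod (cinner (bop_apply x e) f) = cmod (cinner (bop_apply (adj x) f) e)" for e
      by (metis cinner_adj' cinner_commute complex_mod_cnj)
    then show ?thesis using parseval[OF B, of "bop_apply (adj x) f"] by simp
  qed
  ultimately show ?thesis by (rule has_sum_SigmaD)
qed

lemma hilbert_schmidt_adj: "hilbert_schmidt (adj x) \<longleftrightarrow> hilbert_schmidt x"
  unfolding hilbert_schmidt_def summable_on_def
  using hs_sum_adj[OF is_onb_onb is_onb_onb] adj_adj by metis

lemma norm_add_sq_le: "(norm (u + v))\<^sup>2 \<le> 2 * (norm u)\<^sup>2 + 2 * (norm v)\<^sup>2"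
  for u v :: "'a::real_normed_vector"
proof -
  have "(norm (u + v))\<^sup>2 \<le> (norm u + norm v)\<^sup>2" by (intro power_mono norm_triangle_ineq) auto
  also have "\<dots> \<le> 2 * (norm u)\<^sup>2 + 2 * (norm v)\<^sup>2"
    using sum_squares_bound[of "norm u" "norm v"] by (simp add: power2_sum)
  finally show ?thesis .
qed

lemma hilbert_schmidt_add: "hilbert_schmidt x \<Longrightarrow> hilbert_schmidt y \<Longrightarrow> hilbert_schmidt (x + y)"
  unfolding hilbert_schmidt_def
  by (rule summable_on_comparison_test[where f = "\<lambda>e. 2 * (norm (bop_apply x e))\<^sup>2 + 2 * (norm (bop_apply y e))\<^sup>2"])
    (auto intro!: summable_on_add summable_on_cmult_right norm_add_sq_le)

lemma hilbert_schmidt_comp_left: "hilbert_schmidt x \<Longrightarrow> hilbert_schmidt (a \<odot> x)"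
  unfolding hilbert_schmidt_def
proof (rule summable_on_comparison_test[where f = "\<lambda>e. (norm a)\<^sup>2 * (norm (bop_apply x e))\<^sup>2"])
  show "(norm (bop_apply (a \<odot> x) e))\<^sup>2 \<le> (norm a)\<^sup>2 * (norm (bop_apply x e))\<^sup>2" for e
    using power_mono[OF norm_bop_apply[of a "bop_apply x e"], of 2] by (simp add: power_mult_distrib)
qed (auto intro!: summable_on_cmult_right)

lemma hilbert_schmidt_comp_right: "hilbert_schmidt x \<Longrightarrow> hilbert_schmidt (x \<odot> a)"
  by (metis hilbert_schmidt_adj adj_comp hilbert_schmidt_comp_left)

lemma hilbert_schmidt_scaleC: "hilbert_schmidt x \<Longrightarrow> hilbert_schmidt (c *\<^sub>C x)"
  by (simp add: hilbert_schmidt_def norm_scaleC power_mult_distrib summable_on_cmult_right)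

lemma hilbert_schmidt_0: "hilbert_schmidt 0"
  by (simp add: hilbert_schmidt_def)

typedef (overloaded) 'a hs = "{x :: 'a::complex_hilbert bop. hilbert_schmidt x}"
  morphisms hs_op Abs_hs
  using hilbert_schmidt_0 by blast

setup_lifting type_definition_hs

lemma hilbert_schmidt_hs_op: "hilbert_schmidt (hs_op x)"
  using hs_op[of x] by simp

lemma hs_cinner_summable:
  assumes "hilbert_schmidt x" "hilbert_schmidt y"
  shows "(\<lambda>e. cinner (bop_apply (x \<odot> adj y) e) e) summable_on onb"
proof (rule abs_summable_summable, rule summable_on_comparison_test)
  show "(\<lambda>e. (norm (bop_apply (adj y) e))\<^sup>2 + (norm (bop_apply (adj x) e))\<^sup>2) summable_on onb"
    using assms by (intro summable_on_add) (simp_all flip: hilbert_schmidt_def add: hilbert_schmidt_adj)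
  show "norm (cinner (bop_apply (x \<odot> adj y) e) e)
      \<le> (norm (bop_apply (adj y) e))\<^sup>2 + (norm (bop_apply (adj x) e))\<^sup>2" for e
  proof -
    have "cmod (cinner (bop_apply (adj y) e) (bop_apply (adj x) e))
        \<le> norm (bop_apply (adj y) e) * norm (bop_apply (adj x) e)"
      by (rule cmod_cinner_le)
    also have "\<dots> \<le> (norm (bop_apply (adj y) e))\<^sup>2 + (norm (bop_apply (adj x) e))\<^sup>2"
      using sum_squares_bound[of "norm (bop_apply (adj y) e)" "norm (bop_apply (adj x) e)"]
        mult_nonneg_nonneg[OF norm_ge_zero[of "bop_apply (adj y) e"] norm_ge_zero[of "bop_apply (adj x) e"]]
      by linarith
    finally show ?thesis by (simp add: cinner_adj)
  qed
qed auto

lemma trace_self_has_sum: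
  assumes "hilbert_schmidt x"
  shows "((\<lambda>e. (norm (bop_apply (adj x) e))\<^sup>2) has_sum Re (trace (x \<odot> adj x))) onb"
    and "((\<lambda>e. (norm (bop_apply x e))\<^sup>2) has_sum Re (trace (x \<odot> adj x))) onb"
proof -
  have "((\<lambda>e. Re (cinner (bop_apply (x \<odot> adj x) e) e)) has_sum Re (trace (x \<odot> adj x))) onb"
    unfolding trace_def
    by (intro has_sum_Re has_sum_infsum hs_cinner_summable assms)
  then show *: "((\<lambda>e. (norm (bop_apply (adj x) e))\<^sup>2) has_sum Re (trace (x \<odot> adj x))) onb"
    by (simp add: cinner_adj cinner_self del: of_real_power)
  show "((\<lambda>e. (norm (bop_apply x e))\<^sup>2) has_sum Re (trace (x \<odot> adj x))) onb"
    using hs_sum_adj[OF is_onb_onb is_onb_onb *] by simp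
qed

lemma bop_eq_0_if_adj_onb: "(\<And>e. e \<in> onb \<Longrightarrow> bop_apply (adj x) e = 0) \<Longrightarrow> x = 0"
  for x :: "'a::complex_hilbert bop"
proof (rule bop_eqI)
  fix v assume "\<And>e. e \<in> onb \<Longrightarrow> bop_apply (adj x) e = 0"
  then have "\<forall>e\<in>onb. cinner (bop_apply x v) e = 0" by (simp add: cinner_adj)
  then have "bop_apply x v = 0" using is_onb_onb[where 'a = 'a] unfolding is_onb_def by blast
  then show "bop_apply x v = bop_apply 0 v" by simp
qed

lemma trace_add:
  assumes "hilbert_schmidt x" "hilbert_schmidt y" "hilbert_schmidt z"
  shows "trace ((x + y) \<odot> adj z) = trace (x \<odot> adj z) + trace (y \<odot> adj z)"
  unfolding trace_def
  using infsum_add[OF hs_cinner_summable[OF assms(1,3)] hs_cinner_summable[OF assms(2,3)]]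
  by (simp add: cinner_add_left)

lemma trace_scaleC: "trace ((c *\<^sub>C x) \<odot> z) = c * trace (x \<odot> z)"
  unfolding trace_def by (simp add: cinner_scaleC_left infsum_cmult_right')

lemma trace_commute: "trace (x \<odot> adj y) = cnj (trace (y \<odot> adj x))"
proof -
  have "cinner (bop_apply (x \<odot> adj y) e) e = cnj (cinner (bop_apply (y \<odot> adj x) e) e)" for e
    unfolding bop_comp_apply by (metis cinner_adj cinner_adj' cinner_commute)
  then show ?thesis unfolding trace_def infsum_cnj[symmetric] by simp
qed

instantiation hs :: (complex_hilbert) "{complex_vector, real_inner}"
begin

lift_definition zero_hs :: "'a hs" is 0 by (rule hilbert_schmidt_0)
lift_definition plus_hs :: "'a hs \<Rightarrow> 'a hs \<Rightarrow> 'a hs" is "(+)" by (rule hilbert_schmidt_add)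
lift_definition scaleC_hs :: "complex \<Rightarrow> 'a hs \<Rightarrow> 'a hs" is "(*\<^sub>C)" by (rule hilbert_schmidt_scaleC)
definition uminus_hs :: "'a hs \<Rightarrow> 'a hs" where "uminus_hs x = (- 1) *\<^sub>C x"
definition minus_hs :: "'a hs \<Rightarrow> 'a hs \<Rightarrow> 'a hs" where "minus_hs x y = x + - y"
definition scaleR_hs :: "real \<Rightarrow> 'a hs \<Rightarrow> 'a hs" where "scaleR_hs r x = complex_of_real r *\<^sub>C x"
definition inner_hs :: "'a hs \<Rightarrow> 'a hs \<Rightarrow> real"
  where "inner_hs x y = Re (trace (hs_op x \<odot> adj (hs_op y)))"
definition norm_hs :: "'a hs \<Rightarrow> real" where "norm_hs x = sqrt (inner x x)"
definition dist_hs :: "'a hs \<Rightarrow> 'a hs \<Rightarrow> real" where "dist_hs x y = norm (x - y)"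
definition uniformity_hs :: "('a hs \<times> 'a hs) filter"
  where "uniformity_hs = (INF e\<in>{0 <..}. principal {(x, y). dist x y < e})"
definition open_hs :: "'a hs set \<Rightarrow> bool"
  where "open_hs U = (\<forall>x\<in>U. \<forall>\<^sub>F (x', y) in uniformity. x' = x \<longrightarrow> y \<in> U)"
definition sgn_hs :: "'a hs \<Rightarrow> 'a hs" where "sgn_hs x = scaleR (inverse (norm x)) x"

instance
proof
  fix x y z :: "'a hs" and r s :: real and c d :: complex
  show "x + y + z = x + (y + z)" "x + y = y + x" "0 + x = x"
    by (transfer, simp add: add_ac)+
  show "- x + x = 0" unfolding uminus_hs_def by transfer (simp add: cvec.scale_minus_left)
  show "c *\<^sub>C (x + y) = c *\<^sub>C x + c *\<^sub>C y" "(c + d) *\<^sub>C x = c *\<^sub>C x + d *\<^sub>C x"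
    "c *\<^sub>C (d *\<^sub>C x) = (c * d) *\<^sub>C x"
    by (transfer, simp add: scaleC_add_right scaleC_add_left scaleC_scaleC)+
  show "r *\<^sub>R (x + y) = r *\<^sub>R x + r *\<^sub>R y" "(r + s) *\<^sub>R x = r *\<^sub>R x + s *\<^sub>R x"
    "r *\<^sub>R s *\<^sub>R x = (r * s) *\<^sub>R x" "1 *\<^sub>R x = x"
    unfolding scaleR_hs_def
    by (transfer, simp add: scaleC_add_right scaleC_add_left scaleC_scaleC)+
  show "inner x y = inner y x"
    unfolding inner_hs_def by (subst trace_commute) simp
  show "inner (x + y) z = inner x z + inner y z"
    unfolding inner_hs_def by transfer (simp add: trace_add)
  show "inner (r *\<^sub>R x) y = r * inner x y"
    unfolding inner_hs_def scaleR_hs_def by transfer (simp add: trace_scaleC)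
  show "0 \<le> inner x x"
    unfolding inner_hs_def
    by (rule has_sum_nonneg[OF trace_self_has_sum(1)[OF hilbert_schmidt_hs_op]]) auto
  show "inner x x = 0 \<longleftrightarrow> x = 0"
  proof
    assume "inner x x = 0"
    then have "((\<lambda>e. (norm (bop_apply (adj (hs_op x)) e))\<^sup>2) has_sum 0) onb"
      using trace_self_has_sum(1)[OF hilbert_schmidt_hs_op[of x]] by (simp add: inner_hs_def)
    then have "(norm (bop_apply (adj (hs_op x)) e))\<^sup>2 = 0" if "e \<in> onb" for e
      by (rule nonneg_has_sum_le_0D) (use that in auto)
    then have "hs_op x = 0" by (intro bop_eq_0_if_adj_onb) simp
    then show "x = 0" by transfer
  next
    assume "x = 0"
    then show "inner x x = 0" unfolding inner_hs_def by transfer (simp add: trace_def)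
  qed
qed (simp_all add: minus_hs_def scaleR_hs_def norm_hs_def dist_hs_def sgn_hs_def uniformity_hs_def open_hs_def)

end

lemma hs_op_simps [simp]:
  "hs_op 0 = 0" "hs_op (x + y) = hs_op x + hs_op y" "hs_op (c *\<^sub>C x) = c *\<^sub>C hs_op x"
  "hs_op (r *\<^sub>R x) = r *\<^sub>R hs_op x" "hs_op (x - y) = hs_op x - hs_op y"
proof -
  show *: "hs_op 0 = 0" "hs_op (x + y) = hs_op x + hs_op y" "hs_op (c *\<^sub>C x) = c *\<^sub>C hs_op x"
    for x y :: "'b::complex_hilbert hs" and c
    by (rule zero_hs.rep_eq plus_hs.rep_eq scaleC_hs.rep_eq)+
  show "hs_op (r *\<^sub>R x) = r *\<^sub>R hs_op x"
    unfolding scaleR_scaleC by (rule *)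
  show "hs_op (x - y) = hs_op x - hs_op y"
    unfolding minus_hs_def uminus_hs_def * by (simp add: cvec.scale_minus_left)
qed

lemma norm_hs_has_sum:
  "((\<lambda>e. (norm (bop_apply (hs_op x) e))\<^sup>2) has_sum (norm x)\<^sup>2) onb"
  "((\<lambda>e. (norm (bop_apply (adj (hs_op x)) e))\<^sup>2) has_sum (norm x)\<^sup>2) onb"
  using trace_self_has_sum[OF hilbert_schmidt_hs_op[of x]]
  by (simp_all add: power2_norm_eq_inner inner_hs_def)

lemma norm_hs_op_le: "norm (hs_op x) \<le> norm x"
proof (rule norm_bop_bound)
  fix v
  have "(norm (bop_apply (hs_op x) v))\<^sup>2 \<le> (norm v)\<^sup>2 * (norm x)\<^sup>2"
  proof (rule has_sum_mono)
    show "((\<lambda>e. (cmod (cinner (bop_apply (hs_op x) v) e))\<^sup>2) has_sum (norm (bop_apply (hs_op x) v))\<^sup>2) onb"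
      by (rule parseval[OF is_onb_onb])
    show "((\<lambda>e. (norm v)\<^sup>2 * (norm (bop_apply (adj (hs_op x)) e))\<^sup>2) has_sum (norm v)\<^sup>2 * (norm x)\<^sup>2) onb"
      by (intro has_sum_cmult_right norm_hs_has_sum)
    show "(cmod (cinner (bop_apply (hs_op x) v) e))\<^sup>2 \<le> (norm v)\<^sup>2 * (norm (bop_apply (adj (hs_op x)) e))\<^sup>2" for e
      unfolding cinner_adj power_mult_distrib[symmetric] by (intro power_mono cmod_cinner_le) auto
  qed
  then have "(norm (bop_apply (hs_op x) v))\<^sup>2 \<le> (norm x * norm v)\<^sup>2"
    by (simp add: power_mult_distrib mult.commute)
  then show "norm (bop_apply (hs_op x) v) \<le> norm x * norm v"
    by (rule power2_le_imp_le) simp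
qed simp

instantiation hs :: (complex_hilbert) complex_hilbert
begin

definition cinner_hs :: "'a hs \<Rightarrow> 'a hs \<Rightarrow> complex"
  where "cinner_hs x y = trace (hs_op x \<odot> adj (hs_op y))"

instance
proof
  fix x y z :: "'a hs" and c :: complex
  show "cinner (x + y) z = cinner x z + cinner y z"
    unfolding cinner_hs_def hs_op_simps by (intro trace_add hilbert_schmidt_hs_op)
  show "cinner (c *\<^sub>C x) y = c * cinner x y"
    unfolding cinner_hs_def hs_op_simps by (rule trace_scaleC)
  show "cinner x y = cnj (cinner y x)" unfolding cinner_hs_def by (rule trace_commute)
  show "Re (cinner x y) = inner x y" unfolding cinner_hs_def inner_hs_def ..
next
  fix X :: "nat \<Rightarrow> 'a hs" assume X: "Cauchy X"
  have "Cauchy (\<lambda>n. hs_op (X n))"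
  proof (rule CauchyI)
    fix e :: real assume "e > 0"
    then obtain M where M: "\<And>m n. m \<ge> M \<Longrightarrow> n \<ge> M \<Longrightarrow> norm (X m - X n) < e"
      using CauchyD[OF X] by blast
    have "norm (hs_op (X m) - hs_op (X n)) < e" if "m \<ge> M" "n \<ge> M" for m n
      using M[OF that] norm_hs_op_le[of "X m - X n"] by simp
    then show "\<exists>M. \<forall>m\<ge>M. \<forall>n\<ge>M. norm (hs_op (X m) - hs_op (X n)) < e" by blast
  qed
  then obtain A where A: "(\<lambda>n. hs_op (X n)) \<longlonglongrightarrow> A"
    using Cauchy_convergent convergent_def by blast
  have Av: "(\<lambda>n. bop_apply (hs_op (X n)) v) \<longlonglongrightarrow> bop_apply A v" for v
  proof (rule bounded_linear.tendsto[OF _ A])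
    show "bounded_linear (\<lambda>x. bop_apply x v)"
      by (rule bounded_linear_intro[of _ "norm v"]) (simp_all add: norm_bop_apply)
  qed
  have fin: "(\<Sum>e\<in>F. (norm (bop_apply (A - hs_op (X n)) e))\<^sup>2) \<le> r\<^sup>2"
    if F: "finite F" "F \<subseteq> onb" and r: "\<And>m. m \<ge> M \<Longrightarrow> norm (X m - X n) \<le> r" for F n M r
  proof (rule LIMSEQ_le_const2)
    show "(\<lambda>m. \<Sum>e\<in>F. (norm (bop_apply (hs_op (X m) - hs_op (X n)) e))\<^sup>2)
        \<longlonglongrightarrow> (\<Sum>e\<in>F. (norm (bop_apply (A - hs_op (X n)) e))\<^sup>2)"
      unfolding bop_apply_simps by (intro tendsto_intros Av)
    have "(\<Sum>e\<in>F. (norm (bop_apply (hs_op (X m) - hs_op (X n)) e))\<^sup>2) \<le> r\<^sup>2" if "m \<ge> M" for m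
    proof -
      have "(\<Sum>e\<in>F. (norm (bop_apply (hs_op (X m - X n)) e))\<^sup>2) \<le> (norm (X m - X n))\<^sup>2"
        by (rule finite_sum_le_has_sum[OF norm_hs_has_sum(1)]) (use F in auto)
      also have "\<dots> \<le> r\<^sup>2" using r[OF that] by (intro power_mono) auto
      finally show ?thesis by simp
    qed
    then show "\<exists>N. \<forall>m\<ge>N. (\<Sum>e\<in>F. (norm (bop_apply (hs_op (X m) - hs_op (X n)) e))\<^sup>2) \<le> r\<^sup>2" by blast
  qed
  have hsd: "hilbert_schmidt (A - hs_op (X n))" if "\<And>m. m \<ge> M \<Longrightarrow> norm (X m - X n) \<le> r" for n M r
    unfolding hilbert_schmidt_def
  proof (rule nonneg_bdd_above_summable_on)
    show "bdd_above (sum (\<lambda>e. (norm (bop_apply (A - hs_op (X n)) e))\<^sup>2) ` {F. F \<subseteq> onb \<and> finite F})"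
    proof (rule bdd_aboveI2)
      fix F :: "'a set" assume "F \<in> {F. F \<subseteq> onb \<and> finite F}"
      then show "(\<Sum>e\<in>F. (norm (bop_apply (A - hs_op (X n)) e))\<^sup>2) \<le> r\<^sup>2"
        by (intro fin[OF _ _ that]) simp_all
    qed
  qed simp
  obtain N where N: "\<And>m n. m \<ge> N \<Longrightarrow> n \<ge> N \<Longrightarrow> norm (X m - X n) < 1"
    using CauchyD[OF X, of 1] by auto
  have "hilbert_schmidt (A - hs_op (X N))"
    by (rule hsd[OF less_imp_le[OF N[OF _ order_refl]]])
  then have "hilbert_schmidt (A - hs_op (X N) + hs_op (X N))"
    by (intro hilbert_schmidt_add hilbert_schmidt_hs_op)
  then have "hilbert_schmidt A" by simp
  then have AA: "hs_op (Abs_hs A) = A" by (simp add: Abs_hs_inverse)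
  have "X \<longlonglongrightarrow> Abs_hs A"
  proof (rule LIMSEQ_I)
    fix r :: real assume "r > 0"
    then obtain M where M: "\<And>m n. m \<ge> M \<Longrightarrow> n \<ge> M \<Longrightarrow> norm (X m - X n) < r/2"
      using CauchyD[OF X, of "r/2"] by auto
    have "norm (X n - Abs_hs A) < r" if n: "n \<ge> M" for n
    proof -
      have le: "norm (X m - X n) \<le> r/2" if "m \<ge> M" for m
        using M[OF that n] by simp
      have "(norm (Abs_hs A - X n))\<^sup>2 \<le> (r/2)\<^sup>2"
      proof (rule has_sum_le_finite_sums[OF norm_hs_has_sum(1)])
        fix F :: "'a set" assume "finite F" "F \<subseteq> onb"
        then show "(\<Sum>e\<in>F. (norm (bop_apply (hs_op (Abs_hs A - X n)) e))\<^sup>2) \<le> (r/2)\<^sup>2"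
          unfolding hs_op_simps AA by (rule fin[OF _ _ le])
      qed
      then have "norm (Abs_hs A - X n) \<le> r/2" 
        by (rule power2_le_imp_le) (use \<open>r > 0\<close> in simp)
      then show ?thesis using \<open>r > 0\<close> by (simp add: norm_minus_commute)
    qed
    then show "\<exists>no. \<forall>n\<ge>no. norm (X n - Abs_hs A) < r" by blast
  qed
  then show "convergent X" by (auto simp: convergent_def)
qed

end

lift_definition lmult_hs :: "'a::complex_hilbert bop \<Rightarrow> 'a hs \<Rightarrow> 'a hs" is "\<lambda>x y. x \<odot> y"
  by (rule hilbert_schmidt_comp_left)
lift_definition rmult_hs :: "'a::complex_hilbert bop \<Rightarrow> 'a hs \<Rightarrow> 'a hs" is "\<lambda>x y. y \<odot> x"
  by (rule hilbert_schmidt_comp_right)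

lemma norm_lmult_hs: "norm (lmult_hs x y) \<le> norm y * norm x"
proof (rule power2_le_imp_le)
  show "(norm (lmult_hs x y))\<^sup>2 \<le> (norm y * norm x)\<^sup>2"
  proof (rule has_sum_mono[OF norm_hs_has_sum(1)])
    show "((\<lambda>e. (norm x)\<^sup>2 * (norm (bop_apply (hs_op y) e))\<^sup>2) has_sum (norm y * norm x)\<^sup>2) onb"
      unfolding mult.commute[of "norm y"] power_mult_distrib by (rule has_sum_cmult_right[OF norm_hs_has_sum(1)])
    show "(norm (bop_apply (hs_op (lmult_hs x y)) e))\<^sup>2 \<le> (norm x)\<^sup>2 * (norm (bop_apply (hs_op y) e))\<^sup>2" for e
      unfolding lmult_hs.rep_eq bop_comp_apply power_mult_distrib[symmetric]
      by (intro power_mono norm_bop_apply) auto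
  qed
qed simp

lemma norm_rmult_hs: "norm (rmult_hs x y) \<le> norm y * norm (adj x)"
proof (rule power2_le_imp_le)
  show "(norm (rmult_hs x y))\<^sup>2 \<le> (norm y * norm (adj x))\<^sup>2"
  proof (rule has_sum_mono[OF norm_hs_has_sum(2)])
    show "((\<lambda>e. (norm (adj x))\<^sup>2 * (norm (bop_apply (adj (hs_op y)) e))\<^sup>2) has_sum (norm y * norm (adj x))\<^sup>2) onb"
      unfolding mult.commute[of "norm y"] power_mult_distrib by (rule has_sum_cmult_right[OF norm_hs_has_sum(2)])
    show "(norm (bop_apply (adj (hs_op (rmult_hs x y))) e))\<^sup>2
        \<le> (norm (adj x))\<^sup>2 * (norm (bop_apply (adj (hs_op y)) e))\<^sup>2" for e
      unfolding rmult_hs.rep_eq adj_comp bop_comp_apply power_mult_distrib[symmetric]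
      by (intro power_mono norm_bop_apply) auto
  qed
qed simp

lift_definition lmult :: "'a::complex_hilbert bop \<Rightarrow> 'a hs bop" is lmult_hs
proof
  fix x :: "'a bop"
  have add: "lmult_hs x (y + z) = lmult_hs x y + lmult_hs x z" for y z
    by transfer (simp add: bop_eqI bop_add_right)
  have scl: "lmult_hs x (c *\<^sub>C y) = c *\<^sub>C lmult_hs x y" for c y
    by transfer (simp add: bop_eqI bop_scaleC_right)
  show "clinear (lmult_hs x)" by (simp add: clinear_iff add scl)
  show "bounded_linear (lmult_hs x)"
    by (rule bounded_linear_intro[OF _ _ norm_lmult_hs]) (simp_all add: add scl scaleR_scaleC)
qed

lift_definition rmult :: "'a::complex_hilbert bop \<Rightarrow> 'a hs bop" is rmult_hs
proof
  fix x :: "'a bop"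
  have add: "rmult_hs x (y + z) = rmult_hs x y + rmult_hs x z" for y z
    by transfer (simp add: bop_eqI)
  have scl: "rmult_hs x (c *\<^sub>C y) = c *\<^sub>C rmult_hs x y" for c y
    by transfer (simp add: bop_eqI)
  show "clinear (rmult_hs x)" by (simp add: clinear_iff add scl)
  show "bounded_linear (rmult_hs x)"
    by (rule bounded_linear_intro[OF _ _ norm_rmult_hs]) (simp_all add: add scl scaleR_scaleC)
qed

lift_definition rank_one :: "'a::complex_hilbert \<Rightarrow> 'a \<Rightarrow> 'a bop"  (infix \<open>\<boxtimes>\<close> 75)
  is "\<lambda>x y z. cinner z y *\<^sub>C x"
proof
  fix x y :: 'a
  show "clinear (\<lambda>z. cinner z y *\<^sub>C x)"
    by (simp add: clinear_iff cinner_add_left cinner_scaleC_left scaleC_add_left scaleC_scaleC)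
  show "bounded_linear (\<lambda>z. cinner z y *\<^sub>C x)"
  proof (rule bounded_linear_intro)
    show "norm (cinner z y *\<^sub>C x) \<le> norm z * (norm y * norm x)" for z
      using mult_right_mono[OF cmod_cinner_le[of z y], of "norm x"] by (simp add: norm_scaleC mult_ac)
  qed (simp_all add: cinner_add_left cinner_scaleC_left scaleC_add_left scaleR_scaleC scaleC_scaleC)
qed

definition op_rank :: "'a::complex_hilbert bop \<Rightarrow> enat" where
  "op_rank x = (if \<exists>S. finite S \<and> range (bop_apply x) \<subseteq> cvec.span S
                then enat (cvec.dim (range (bop_apply x))) else \<infinity>)"


section \<open>Normality, the predual and positivity\<close>

text \<open>
  The \<open>\<sigma>\<close>-weak topology of \<open>\<B>(H)\<close> is generated by the functionals
  \<open>A \<mapsto> (\<Sum>n. (A x\<^sub>n | y\<^sub>n))\<close> with \<open>(x\<^sub>n)\<close>, \<open>(y\<^sub>n)\<close> square summable, that is, by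
  \<open>A \<mapsto> Tr(AT)\<close> with \<open>T = (\<Sum>n. x\<^sub>n \<boxtimes> y\<^sub>n)\<close> trace class.
\<close>

definition sigma_weak :: "'a::complex_hilbert bop topology" where
  "sigma_weak = topology_generated_by
     {{A. (\<Sum>n. cinner (bop_apply A (x n)) (y n)) \<in> U} |(x :: nat \<Rightarrow> 'a) (y :: nat \<Rightarrow> 'a) U.
        summable (\<lambda>n. (norm (x n))\<^sup>2) \<and> summable (\<lambda>n. (norm (y n))\<^sup>2) \<and> open U}"

lemma topspace_sigma_weak [simp]: "topspace sigma_weak = UNIV"
  unfolding sigma_weak_def topology_generated_by_topspace
  by (rule UNIV_eq_I[symmetric], rule UnionI, rule CollectI,
      rule exI[of _ "\<lambda>_. 0"], rule exI[of _ "\<lambda>_. 0"], rule exI[of _ UNIV]) auto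

definition normal_map :: "('a::complex_hilbert bop \<Rightarrow> 'b::complex_hilbert bop) \<Rightarrow> bool" where
  "normal_map \<Phi> \<longleftrightarrow> continuous_map sigma_weak sigma_weak \<Phi>"

text \<open>Here and below, \<open>0 \<le> z\<close> for complex \<open>z\<close> says that \<open>z\<close> is real and nonnegative.\<close>

definition positive_op :: "'a::complex_hilbert bop \<Rightarrow> bool" where
  "positive_op A \<longleftrightarrow> (\<forall>v. 0 \<le> cinner (bop_apply A v) v)"

text \<open>
  \<open>\<T>(H) = \<B>(H)\<^sub>*\<close> is realised as the norm closed subspace of normal functionals in the dual of
  \<open>\<B>(H)\<close>; the pairing of \<open>A\<close> and \<open>\<rho>\<close> is evaluation, the trace norm is the dual norm.  As
  \<open>\<sigma>\<close>-weakly continuous linear functionals are bounded, working in the dual is no restriction.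
\<close>

definition predual :: "('a::complex_hilbert bop \<Rightarrow>\<^sub>L complex) set" where
  "predual = {\<rho>. clinear (blinfun_apply \<rho>) \<and> continuous_map sigma_weak euclidean (blinfun_apply \<rho>)}"

definition positive_functional :: "('a::complex_hilbert bop \<Rightarrow>\<^sub>L complex) \<Rightarrow> bool" where
  "positive_functional \<rho> \<longleftrightarrow> (\<forall>A. positive_op A \<longrightarrow> 0 \<le> blinfun_apply \<rho> A)"

lift_definition vec_functional :: "'a::complex_hilbert \<Rightarrow> 'a \<Rightarrow> 'a bop \<Rightarrow>\<^sub>L complex"
  is "\<lambda>x y A. cinner (bop_apply A x) y"
proof (rule bounded_linear_intro)
  fix x y :: 'a and A :: "'a bop"
  have "cmod (cinner (bop_apply A x) y) \<le> norm (bop_apply A x) * norm y" by (rule cmod_cinner_le)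
  also have "\<dots> \<le> norm A * norm x * norm y" by (intro mult_right_mono norm_bop_apply) auto
  finally show "cmod (cinner (bop_apply A x) y) \<le> norm A * (norm x * norm y)" by (simp add: mult.assoc)
qed (simp_all add: cinner_add_left cinner_scaleR_left)

definition schmidt_cone :: "nat \<Rightarrow> ('a::complex_hilbert hs bop \<Rightarrow>\<^sub>L complex) set" where
  "schmidt_cone k =
     closure (convex_cone hull {vec_functional x x |x. op_rank (hs_op x) \<le> enat k})"


section \<open>Completely bounded and \<open>k\<close>-positive maps\<close>

text \<open>
  An \<open>n \<times> n\<close> matrix over \<open>\<B>(K)\<close> is a function \<open>X\<close> of which only the entries \<open>X i j\<close> with
  \<open>i, j < n\<close> matter; it acts on \<open>K\<^sup>n\<close>, whose elements are sequences cut off at \<open>n\<close>.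
\<close>

definition mat_norm :: "nat \<Rightarrow> (nat \<Rightarrow> nat \<Rightarrow> 'a::complex_hilbert bop) \<Rightarrow> real" where
  "mat_norm n X =
     (SUP v \<in> {v. (\<Sum>j<n. (norm (v j))\<^sup>2) \<le> 1}.
        sqrt (\<Sum>i<n. (norm (\<Sum>j<n. bop_apply (X i j) (v j)))\<^sup>2))"

definition mat_positive :: "nat \<Rightarrow> (nat \<Rightarrow> nat \<Rightarrow> 'a::complex_hilbert bop) \<Rightarrow> bool" where
  "mat_positive n X \<longleftrightarrow>
     (\<forall>v :: nat \<Rightarrow> 'a. 0 \<le> (\<Sum>i<n. cinner (\<Sum>j<n. bop_apply (X i j) (v j)) (v i)))"

definition completely_bounded :: "('a::complex_hilbert bop \<Rightarrow> 'b::complex_hilbert bop) \<Rightarrow> bool" where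
  "completely_bounded \<phi> \<longleftrightarrow>
     (\<exists>C. \<forall>n X. mat_norm n (\<lambda>i j. \<phi> (X i j)) \<le> C * mat_norm n X)"

definition k_positive :: "nat \<Rightarrow> ('a::complex_hilbert bop \<Rightarrow> 'b::complex_hilbert bop) \<Rightarrow> bool" where
  "k_positive k \<phi> \<longleftrightarrow> (\<forall>X. mat_positive k X \<longrightarrow> mat_positive k (\<lambda>i j. \<phi> (X i j)))"

definition normal_cb :: "('a::complex_hilbert bop \<Rightarrow> 'a bop) set" where
  "normal_cb = {\<phi>. clinear \<phi> \<and> normal_map \<phi> \<and> completely_bounded \<phi>}"

definition normal_cb_pos :: "nat \<Rightarrow> ('a::complex_hilbert bop \<Rightarrow> 'a bop) set" where
  "normal_cb_pos k = {\<phi> \<in> normal_cb. k_positive k \<phi>}"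

text \<open>
  The unique normal linear extension of \<open>R\<^sub>y L\<^sub>x \<mapsto> R\<^sub>y L\<^bsub>\<phi>(x)\<^esub>\<close>; uniqueness rests on the
  \<open>\<sigma>\<close>-weak density in \<open>\<B>(H)\<close> of the span of the operators \<open>R\<^sub>y L\<^sub>x\<close>.
\<close>

definition commutant_ext ::
    "('a::complex_hilbert bop \<Rightarrow> 'a bop) \<Rightarrow> 'a hs bop \<Rightarrow> 'a hs bop" where
  "commutant_ext \<phi> = (THE \<Phi>. clinear \<Phi> \<and> normal_map \<Phi> \<and>
     (\<forall>x y. \<Phi> (rmult y \<odot> lmult x) = rmult y \<odot> lmult (\<phi> x)))"

definition choi :: "'a::complex_hilbert hs \<Rightarrow> ('a bop \<Rightarrow> 'a bop) \<Rightarrow> 'a hs bop" where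
  "choi x0 \<phi> = commutant_ext \<phi> (x0 \<boxtimes> x0)"

definition cyclic_vec :: "'a::complex_hilbert hs \<Rightarrow> bool" where
  "cyclic_vec x0 \<longleftrightarrow> closure (range (\<lambda>x. bop_apply (lmult x) x0)) = UNIV"

definition separating_vec :: "'a::complex_hilbert hs \<Rightarrow> bool" where
  "separating_vec x0 \<longleftrightarrow> (\<forall>x. bop_apply (lmult x) x0 = 0 \<longrightarrow> x = 0)"

end

theory Submission
  imports Defs
begin

text \<open>
  A vector of \<open>H\<close> of rank at most \<open>k\<close> is a sum of \<open>k\<close> elementary tensors \<open>u\<^sub>l \<boxtimes> v\<^sub>l\<close>, and the slice of
  \<open>C\<^sub>\<phi>\<close> by \<open>v\<^sub>l\<close> and \<open>v\<^sub>m\<close> is \<open>\<phi> (x\<^sub>0 v\<^sub>l \<boxtimes> x\<^sub>0 v\<^sub>m)\<close>; hence \<open>k\<close>-positivity of \<open>\<phi>\<close> makes \<open>C\<^sub>\<phi>\<close> nonnegative at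
  all vectors of rank at most \<open>k\<close>.  Conversely, compressing \<open>\<rho> \<notin> \<S>\<^sub>k\<close> to a finite-dimensional corner and
  separating in the Hilbert space \<open>\<H>\<S>(H)\<close> gives a finite rank operator \<open>A\<close>, nonnegative at the vectors of
  rank at most \<open>k\<close>, with \<open>Re (\<rho> A) < 0\<close>.  Since \<open>x\<^sub>0\<close> is cyclic, \<open>x\<^sub>0\<^sup>*\<close> has dense range, and \<open>A\<close> is a norm
  limit of operators \<open>C\<^sub>\<phi>\<close> with \<open>\<phi>\<close> of the form \<open>a \<mapsto> \<Sum>\<^sub>r W\<^sub>r a V\<^sub>r\<close> and \<open>k\<close>-positive.  The extension of \<open>\<phi>\<close>
  to \<open>\<B>(H)\<close> is a limit of functionals in norm, which is normal because the predual is norm closed; the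
  latter also follows by separation in \<open>\<H>\<S>(H)\<close>.
\<close>

section \<open>Separation in Hilbert spaces\<close>

text \<open>The approximation in the converse is forced by \<open>x0\<close> being Hilbert-Schmidt:
  in infinite dimension the range of its adjoint is dense at best, and a basis vector need not lie
  in it. Positivity must therefore be exact for every approximating map, not only in the limit. It
  is, because \<phi>(a) = \<Sum> c (a f_j | f_i) p \<boxtimes> q sees \<open>a\<close> only through
  the numbers (a f_j | f_i), and these form a positive semidefinite matrix for positive
  \<open>a\<close>, whatever the vectors f_i are. The coefficients c alone, which are those of
  \<open>A\<close> with respect to elementary tensors of basis vectors, make the map k-positive.

  The corner has to be cut out by P \<otimes> P for a projection P of K. Such a compression does not
  raise the rank of a vector, whereas projecting onto the span of an arbitrary finite set of
  elementary tensors may do so. On a corner, functionals correspond to vectors of a Hilbert space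
  (\<open>hs_density\<close> and \<open>hs_functional\<close>), so that every separating element
  comes from a nearest point and is itself an operator on H.\<close>

lemma closest_point_complete:
  fixes S :: "'a::{real_inner,complete_space} set"
  assumes cl: "closed S" and cv: "convex S" and ne: "S \<noteq> {}"
  shows "\<exists>p\<in>S. \<forall>s\<in>S. norm (z - p) \<le> norm (z - s)"
proof -
  define d where "d = (INF s\<in>S. (norm (z - s))\<^sup>2)"
  have bd: "bdd_below ((\<lambda>s. (norm (z - s))\<^sup>2) ` S)" by (rule bdd_belowI2[of _ 0]) simp
  have lower: "d \<le> (norm (z - s))\<^sup>2" if "s \<in> S" for s
    unfolding d_def by (rule cINF_lower[OF bd that])
  have "\<exists>s\<in>S. (norm (z - s))\<^sup>2 < d + 1 / real (Suc n)" for n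
    using cINF_less_iff[OF ne bd, of "d + 1 / real (Suc n)"] by (simp add: d_def)
  then obtain s where s: "\<And>n. s n \<in> S" and lt: "\<And>n. (norm (z - s n))\<^sup>2 < d + 1 / real (Suc n)" by metis
  \<comment> \<open>Parallelogram law: the midpoint of two almost nearest points lies in
    \<open>S\<close> and is therefore not nearer than the infimum, which forces the two points
    together.\<close>
  have par: "(norm (s m - s n))\<^sup>2 \<le> 2 * (1 / real (Suc m)) + 2 * (1 / real (Suc n))" for m n
  proof -
    have "(1/2) *\<^sub>R s m + (1/2) *\<^sub>R s n \<in> S" using cv s by (intro convexD) auto
    from lower[OF this] have "4 * d \<le> (norm (2 *\<^sub>R (z - ((1/2) *\<^sub>R s m + (1/2) *\<^sub>R s n))))\<^sup>2"
      by (simp add: power_mult_distrib)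
    also have "2 *\<^sub>R (z - ((1/2) *\<^sub>R s m + (1/2) *\<^sub>R s n)) = (z - s m) + (z - s n)"
      by (simp add: algebra_simps scaleR_2)
    finally have 1: "4 * d \<le> (norm ((z - s m) + (z - s n)))\<^sup>2" .
    have "(norm (s m - s n))\<^sup>2 = (norm ((z - s n) - (z - s m)))\<^sup>2" by simp
    also have "\<dots> = 2 * (norm (z - s m))\<^sup>2 + 2 * (norm (z - s n))\<^sup>2 - (norm ((z - s m) + (z - s n)))\<^sup>2"
      by (simp only: power2_norm_eq_inner) (simp add: inner_simps inner_commute)
    finally show ?thesis using 1 lt[of m] lt[of n] by argo
  qed
  have "Cauchy s"
  proof (rule metric_CauchyI)
    fix e :: real assume "e > 0"
    then obtain M where M: "1 / real (Suc M) < e\<^sup>2 / 4"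
      using nat_approx_posE[of "e\<^sup>2 / 4"] by auto
    have "dist (s m) (s n) < e" if "m \<ge> M" "n \<ge> M" for m n
    proof -
      have "1 / real (Suc m) \<le> 1 / real (Suc M)" "1 / real (Suc n) \<le> 1 / real (Suc M)"
        using that by (auto intro!: divide_left_mono)
      then have "(dist (s m) (s n))\<^sup>2 < e\<^sup>2"
        using par[of m n] M unfolding dist_norm by argo
      then show ?thesis by (rule power_less_imp_less_base) (use \<open>e > 0\<close> in simp)
    qed
    then show "\<exists>M. \<forall>m\<ge>M. \<forall>n\<ge>M. dist (s m) (s n) < e" by blast
  qed
  then obtain p where p: "s \<longlonglongrightarrow> p" using Cauchy_convergent convergent_def by blast
  have "p \<in> S" using cl s p by (meson closed_sequentially)
  moreover have "norm (z - p) \<le> norm (z - x)" if x: "x \<in> S" for x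
  proof (rule power2_le_imp_le)
    have "(\<lambda>n. (norm (z - s n))\<^sup>2) \<longlonglongrightarrow> (norm (z - p))\<^sup>2" by (intro tendsto_intros p)
    moreover have "(\<lambda>n. d + 1 / real (Suc n)) \<longlonglongrightarrow> d + 0"
      by (intro tendsto_add tendsto_const LIMSEQ_Suc lim_1_over_n)
    ultimately have "(norm (z - p))\<^sup>2 \<le> d + 0"
      by (rule LIMSEQ_le) (use lt less_imp_le in blast)
    then show "(norm (z - p))\<^sup>2 \<le> (norm (z - x))\<^sup>2" using lower[OF x] by linarith
  qed simp
  ultimately show ?thesis by blast
qed

text \<open>The separating vector is the normal \<open>z - p\<close> at the nearest point
  \<open>p\<close>: moving from \<open>p\<close> towards \<open>s\<close> by a fraction
  \<open>t\<close> cannot decrease the distance to \<open>z\<close>, and in the expanded square the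
  quadratic term disappears as \<open>t\<close> tends to 0.\<close>

lemma separation_closed_convex:
  fixes S :: "'a::{real_inner,complete_space} set"
  assumes "closed S" "convex S" "S \<noteq> {}" "z \<notin> S"
  shows "\<exists>b c. (\<forall>s\<in>S. inner b s \<le> c) \<and> c < inner b z"
proof -
  obtain p where p: "p \<in> S" and min: "\<And>s. s \<in> S \<Longrightarrow> norm (z - p) \<le> norm (z - s)"
    using closest_point_complete[OF assms(1-3)] by blast
  define b where "b = z - p"
  have "inner b s \<le> inner b p" if s: "s \<in> S" for s
  proof -
    define w where "w = s - p"
    have "2 * inner b w \<le> t * (norm w)\<^sup>2" if t: "0 < t" "t < 1" for t
    proof -
      have "p + t *\<^sub>R w = (1 - t) *\<^sub>R p + t *\<^sub>R s" by (simp add: w_def algebra_simps)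
      also have "\<dots> \<in> S" using assms(2) p s t by (intro convexD) auto
      finally have "norm b \<le> norm (b - t *\<^sub>R w)" using min by (simp add: b_def algebra_simps)
      then have "(norm b)\<^sup>2 \<le> (norm (b - t *\<^sub>R w))\<^sup>2" by (intro power_mono) auto
      then have "t * (2 * inner b w) \<le> t * (t * (norm w)\<^sup>2)"
        by (simp only: power2_norm_eq_inner) (simp add: inner_simps inner_commute)
      then show ?thesis using t by simp
    qed
    moreover have "((\<lambda>t. t * (norm w)\<^sup>2) \<longlongrightarrow> 0 * (norm w)\<^sup>2) (at_right 0)" by (intro tendsto_intros)
    moreover have "eventually (\<lambda>t::real. 0 < t \<and> t < 1) (at_right 0)"
      unfolding eventually_at_right_field by (intro exI[of _ 1]) auto
    ultimately have "2 * inner b w \<le> 0 * (norm w)\<^sup>2"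
      by (intro tendsto_lowerbound[of "\<lambda>t. t * (norm w)\<^sup>2" _ "at_right 0"]) (auto elim: eventually_mono)
    then show ?thesis by (simp add: w_def inner_diff_right)
  qed
  moreover have "inner b p < inner b z"
  proof -
    have "b \<noteq> 0" using p assms(4) by (auto simp: b_def)
    then have "0 < inner b b" by simp
    then show ?thesis by (simp add: b_def inner_diff_right)
  qed
  ultimately show ?thesis by blast
qed

text \<open>A linear functional that is bounded above on a cone is nonpositive there, since a
  positive value could be scaled past any bound.\<close>

lemma separation_closed_cone:
  fixes S :: "'a::{real_inner,complete_space} set"
  assumes cl: "closed S" and cv: "convex_cone S" and z: "z \<notin> S"
  shows "\<exists>b. (\<forall>s\<in>S. inner b s \<le> 0) \<and> 0 < inner b z"
proof -
  have S: "convex S" "S \<noteq> {}" and mul: "\<And>s c. s \<in> S \<Longrightarrow> 0 \<le> c \<Longrightarrow> c *\<^sub>R s \<in> S"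
    using cv by (auto simp: convex_cone_def conic_def)
  obtain b c where b: "\<And>s. s \<in> S \<Longrightarrow> inner b s \<le> c" "c < inner b z"
    using separation_closed_convex[OF cl S z] by blast
  obtain s0 where "s0 \<in> S" using S by blast
  from b(1)[OF mul[OF this, of 0]] have c: "0 \<le> c" by simp
  have "inner b s \<le> 0" if s: "s \<in> S" for s
  proof (rule ccontr)
    assume "\<not> inner b s \<le> 0"
    then have "((c + 1) / inner b s) * inner b s = c + 1" "0 \<le> (c + 1) / inner b s" using c by auto
    with b(1)[OF mul[OF s, of "(c + 1) / inner b s"]] show False by simp
  qed
  then show ?thesis using b(2) c by (intro exI[of _ b]) auto
qed

section \<open>Bounded operators and elementary tensors\<close>

lemma bop_zero_right [simp]: "bop_apply x 0 = 0"
  using bounded_linear.linear[OF bounded_linear_bop[of x]] by (rule linear_0)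

lemma bop_sum_right: "bop_apply x (sum f F) = (\<Sum>i\<in>F. bop_apply x (f i))"
  using bounded_linear.linear[OF bounded_linear_bop[of x]] by (rule linear_sum)

lemma bop_sum_left: "bop_apply (sum f F) v = (\<Sum>i\<in>F. bop_apply (f i) v)"
  by (induction F rule: infinite_finite_induct) auto

lemma hs_op_sum: "hs_op (sum f F) = (\<Sum>i\<in>F. hs_op (f i))"
  by (induction F rule: infinite_finite_induct) auto

lemma rank_one_apply: "bop_apply (x \<boxtimes> y) z = cinner z y *\<^sub>C x"
  by (simp add: rank_one.rep_eq)

lemma comp_rank_one: "a \<odot> (x \<boxtimes> y) = bop_apply a x \<boxtimes> y"
  by (rule bop_eqI) (simp add: rank_one_apply bop_scaleC_right)

lemma rank_one_comp: "(x \<boxtimes> y) \<odot> a = x \<boxtimes> bop_apply (adj a) y"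
  by (rule bop_eqI) (simp add: rank_one_apply cinner_adj)

lemma adj_rank_one: "adj (x \<boxtimes> y) = y \<boxtimes> x"
proof (rule adj_eqI)
  show "cinner (bop_apply (x \<boxtimes> y) u) v = cinner u (bop_apply (y \<boxtimes> x) v)" for u v
    by (simp add: rank_one_apply cinner_scaleC_left cinner_scaleC_right) (metis cinner_commute mult.commute)
qed

lemma cinner_onb_has_sum:
  assumes "is_onb B"
  shows "((\<lambda>e. cinner x e * cinner e y) has_sum cinner x y) B"
  using has_sum_cinner_left[OF onb_expansion[OF assms, of x], of y] by (simp add: cinner_scaleC_left)

lemma hilbert_schmidt_rank_one: "hilbert_schmidt (x \<boxtimes> y)"
proof -
  have "is_ortho (onb :: 'a set)" using is_onb_onb by (auto simp: is_onb_def)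
  then have "(\<lambda>e. (cmod (cinner y e))\<^sup>2 * (norm x)\<^sup>2) summable_on onb"
    by (intro summable_on_cmult_left summable_on_bessel)
  moreover have "cmod (cinner y e) = cmod (cinner e y)" for e by (metis cinner_commute complex_mod_cnj)
  ultimately show ?thesis
    by (simp add: hilbert_schmidt_def rank_one_apply norm_scaleC power_mult_distrib)
qed

section \<open>Elementary tensors as vectors of the Hilbert-Schmidt space\<close>

lift_definition tens :: "'a::complex_hilbert \<Rightarrow> 'a \<Rightarrow> 'a hs" is rank_one
  by (rule hilbert_schmidt_rank_one)

lemma hs_op_inject: "hs_op x = hs_op y \<longleftrightarrow> x = y" by transfer simp

lemma hs_eqI: "(\<And>v. bop_apply (hs_op x) v = bop_apply (hs_op y) v) \<Longrightarrow> x = y"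
  by (simp add: hs_op_inject[symmetric] bop_eqI)

lemma tens_apply [simp]: "bop_apply (hs_op (tens u v)) z = cinner z v *\<^sub>C u"
  by (simp add: tens.rep_eq rank_one_apply)

lemma trace_rank_one: "trace (x \<boxtimes> y) = cinner x y"
proof -
  have "((\<lambda>e. cinner (bop_apply (x \<boxtimes> y) e) e) has_sum cinner x y) onb"
    using cinner_onb_has_sum[OF is_onb_onb, of x y]
    by (simp add: rank_one_apply cinner_scaleC_left mult.commute)
  then show ?thesis unfolding trace_def by (rule infsumI)
qed

lemma cinner_tens_right: "cinner x (tens u v) = cinner (bop_apply (hs_op x) v) u"
  unfolding cinner_hs_def tens.rep_eq adj_rank_one comp_rank_one trace_rank_one ..

lemma cinner_tens_left: "cinner (tens u v) x = cinner u (bop_apply (hs_op x) v)"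
  using cinner_tens_right[of x u v] by (metis cinner_commute)

lemma tens_add_left: "tens (u + u') v = tens u v + tens u' v"
  by (rule hs_eqI) (simp add: scaleC_add_right)
lemma tens_add_right: "tens u (v + v') = tens u v + tens u v'"
  by (rule hs_eqI) (simp add: cinner_add_right scaleC_add_left)
lemma tens_scaleC_left: "tens (c *\<^sub>C u) v = c *\<^sub>C tens u v"
  by (rule hs_eqI) (simp add: scaleC_scaleC mult.commute)
lemma tens_scaleC_right: "tens u (c *\<^sub>C v) = cnj c *\<^sub>C tens u v"
  by (rule hs_eqI) (simp add: scaleC_scaleC cinner_scaleC_right)
lemma tens_sum_left: "tens (sum f F) v = (\<Sum>i\<in>F. tens (f i) v)"
  by (rule hs_eqI) (simp add: hs_op_sum bop_sum_left cvec.scale_sum_right)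
lemma tens_sum_right: "tens u (sum f F) = (\<Sum>i\<in>F. tens u (f i))"
  by (rule hs_eqI) (simp add: hs_op_sum bop_sum_left cinner_sum_right cvec.scale_sum_left)

lemma norm_tens: "norm (tens u v) = norm u * norm v"
proof -
  have "complex_of_real ((norm (tens u v))\<^sup>2) = complex_of_real ((norm u * norm v)\<^sup>2)"
    by (simp only: cinner_self[symmetric] cinner_tens_right)
      (simp add: cinner_scaleC_left cinner_self power_mult_distrib)
  then show ?thesis by (metis mult_nonneg_nonneg norm_ge_zero of_real_eq_iff power2_eq_iff_nonneg)
qed

lemma lmult_apply [simp]: "bop_apply (lmult a) x = lmult_hs a x" by (simp add: lmult.rep_eq)
lemma rmult_apply [simp]: "bop_apply (rmult a) x = rmult_hs a x" by (simp add: rmult.rep_eq)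

lemma rank_one_tens: "tens a b \<boxtimes> tens c d = rmult (d \<boxtimes> b) \<odot> lmult (a \<boxtimes> c)"
  by (intro bop_eqI hs_eqI)
    (simp add: rank_one_apply lmult_hs.rep_eq rmult_hs.rep_eq cinner_tens_right bop_scaleC_right
      cinner_scaleC_left scaleC_scaleC mult.commute)

lemma onb_tens:
  assumes B: "is_onb (B :: 'a::complex_hilbert set)"
  shows "is_onb {tens e f |e f. e \<in> B \<and> f \<in> B}"
proof -
  have o: "cinner e f = (if e = f then 1 else 0)" if "e \<in> B" "f \<in> B" for e f
    using B that by (auto simp: is_onb_def is_ortho_def)
  have inj: "e = e' \<and> f = f'" if "tens e f = tens e' f'" "e \<in> B" "f \<in> B" "e' \<in> B" "f' \<in> B" for e f e' f'
  proof -
    have "cinner (tens e f) (tens e' f') = 1"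
      using that by (simp add: cinner_tens_right o cinner_scaleC_left)
    then show ?thesis using that(2-) by (auto simp: cinner_tens_right o cinner_scaleC_left split: if_splits)
  qed
  have "is_ortho {tens e f |e f. e \<in> B \<and> f \<in> B}"
    unfolding is_ortho_def
  proof clarify
    fix e f e' f' assume *: "e \<in> B" "f \<in> B" "e' \<in> B" "f' \<in> B"
    show "cinner (tens e f) (tens e' f') = (if tens e f = tens e' f' then 1 else 0)"
      using inj[OF _ *] * by (auto simp: cinner_tens_right o cinner_scaleC_left)
  qed
  moreover have "x = 0" if x: "\<forall>t\<in>{tens e f |e f. e \<in> B \<and> f \<in> B}. cinner x t = 0" for x
  proof -
    have "bop_apply (hs_op x) f = 0" if f: "f \<in> B" for f
    proof -
      have "\<forall>e\<in>B. cinner (bop_apply (hs_op x) f) e = 0" using x f by (auto simp flip: cinner_tens_right)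
      then show ?thesis using B by (auto simp: is_onb_def)
    qed
    note z = this
    have "bop_apply (hs_op x) v = 0" for v
    proof -
      have "((\<lambda>e. bop_apply (hs_op x) (cinner v e *\<^sub>C e)) has_sum bop_apply (hs_op x) v) B"
        by (rule has_sum_bounded_linear[OF bounded_linear_bop onb_expansion[OF B]])
      moreover have "((\<lambda>e. bop_apply (hs_op x) (cinner v e *\<^sub>C e)) has_sum 0) B"
        by (rule has_sum_0) (simp add: z bop_scaleC_right)
      ultimately show ?thesis by (rule has_sum_unique)
    qed
    then show "x = 0" by (intro hs_eqI) simp
  qed
  ultimately show ?thesis unfolding is_onb_def by blast
qed

lemma bop_eqI_onb:
  assumes B: "is_onb B" and eq: "\<And>p q. p \<in> B \<Longrightarrow> q \<in> B \<Longrightarrow> cinner (bop_apply X q) p = cinner (bop_apply Y q) p"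
  shows "X = Y"
proof (rule bop_eqI)
  fix v
  have q: "bop_apply X q = bop_apply Y q" if "q \<in> B" for q
  proof -
    have "\<forall>p\<in>B. cinner (bop_apply X q - bop_apply Y q) p = 0" using eq that by (simp add: cinner_diff_left)
    then have "bop_apply X q - bop_apply Y q = 0" using B unfolding is_onb_def by blast
    then show ?thesis by simp
  qed
  have "((\<lambda>e. bop_apply X (cinner v e *\<^sub>C e)) has_sum bop_apply X v) B" for X
    by (rule has_sum_bounded_linear[OF bounded_linear_bop onb_expansion[OF B]])
  from this[of X] this[of Y] show "bop_apply X v = bop_apply Y v"
    by (metis (no_types, lifting) has_sum_cong has_sum_unique bop_scaleC_right q)
qed

section \<open>Operators from bounded sesquilinear forms\<close>

lemma riesz_representation:
  fixes f :: "'a::complex_hilbert \<Rightarrow> complex"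
  assumes add: "\<And>x y. f (x + y) = f x + f y" and scl: "\<And>c x. f (c *\<^sub>C x) = c * f x"
    and bd: "\<And>x. cmod (f x) \<le> M * norm x"
  shows "\<exists>w. \<forall>x. f x = cinner x w"
proof -
  let ?B = "onb :: 'a set"
  have o: "is_ortho ?B" using is_onb_onb[where 'a = 'a] by (simp add: is_onb_def)
  have bl: "bounded_linear f"
    by (rule bounded_linear_intro[of f M])
      (use add scl bd in \<open>auto simp: scaleR_scaleC scaleC_complex_def mult.commute\<close>)
  then have fsum: "f (sum g F) = (\<Sum>i\<in>F. f (g i))" for g and F :: "'a set"
    by (rule linear_sum[OF bounded_linear.linear])
  have fin: "(\<Sum>e\<in>F. (cmod (f e))\<^sup>2) \<le> M\<^sup>2" if F: "finite F" "F \<subseteq> ?B" for F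
  proof -
    \<comment> \<open>On the span of \<open>F\<close> the functional attains its norm in the
      direction of \<open>z\<close>: its value there is the square of the norm of \<open>z\<close>.
      The bound on \<open>f\<close> thus bounds the coefficients uniformly in
      \<open>F\<close>.\<close>
    define z where "z = (\<Sum>e\<in>F. cnj (f e) *\<^sub>C e)"
    define S where "S = (\<Sum>e\<in>F. (cmod (f e))\<^sup>2)"
    have zz: "(norm z)\<^sup>2 = S" unfolding z_def S_def using norm_sum_ortho[OF o F] by simp
    have "f z = complex_of_real S"
      unfolding z_def S_def fsum by (simp add: scl complex_norm_square mult.commute del: of_real_power)
    moreover have "0 \<le> S" unfolding S_def by (intro sum_nonneg) simp
    ultimately have "norm z * norm z \<le> M * norm z" using bd[of z] zz by (simp add: power2_eq_square)
    then have "norm z = 0 \<or> norm z \<le> M" by (cases "norm z = 0") (simp_all add: mult_le_cancel_right)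
    then have "(norm z)\<^sup>2 \<le> M\<^sup>2" by (auto intro: power_mono)
    then show ?thesis using zz S_def by simp
  qed
  have "(\<lambda>e. (cmod (cnj (f e)))\<^sup>2) summable_on ?B"
    by (rule nonneg_bdd_above_summable_on) (use fin in \<open>auto intro!: bdd_aboveI[of _ "M\<^sup>2"]\<close>)
  from summable_on_ortho[OF o this] obtain w
    where w: "((\<lambda>e. cnj (f e) *\<^sub>C e) has_sum w) ?B" by (auto simp: summable_on_def)
  have we: "cinner e w = f e" if "e \<in> ?B" for e
    using cinner_has_sum_ortho[OF o w that] cinner_commute[of e w] by simp
  have "f x = cinner x w" for x
  proof -
    have "((\<lambda>e. f (cinner x e *\<^sub>C e)) has_sum f x) ?B"
      by (rule has_sum_bounded_linear[OF bl onb_expansion[OF is_onb_onb]])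
    moreover have "((\<lambda>e. cinner (cinner x e *\<^sub>C e) w) has_sum cinner x w) ?B"
      by (rule has_sum_cinner_left[OF onb_expansion[OF is_onb_onb]])
    ultimately show ?thesis
      by (metis (no_types, lifting) cinner_scaleC_left has_sum_cong has_sum_unique scl we)
  qed
  then show ?thesis by blast
qed

text \<open>The conjugate of \<beta> x is linear in its argument, so the Riesz representation yields
  the image of \<open>x\<close>. The normal extension of \<phi> is obtained from its matrix
  coefficients in this way.\<close>

lemma sesquilinear_operator:
  fixes \<beta> :: "'a::complex_hilbert \<Rightarrow> 'a \<Rightarrow> complex"
  assumes add1: "\<And>x x' y. \<beta> (x + x') y = \<beta> x y + \<beta> x' y" and add2: "\<And>x y y'. \<beta> x (y + y') = \<beta> x y + \<beta> x y'"
    and scl1: "\<And>c x y. \<beta> (c *\<^sub>C x) y = c * \<beta> x y" and scl2: "\<And>c x y. \<beta> x (c *\<^sub>C y) = cnj c * \<beta> x y"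
    and bd: "\<And>x y. cmod (\<beta> x y) \<le> M * norm x * norm y" and M: "0 \<le> M"
  shows "\<exists>T. \<forall>x y. cinner (bop_apply T x) y = \<beta> x y"
proof -
  have "\<exists>w. \<forall>y. cnj (\<beta> x y) = cinner y w" for x
    by (rule riesz_representation[of _ "M * norm x"]) (use bd in \<open>simp_all add: add2 scl2\<close>)
  then obtain g where "\<And>x y. cnj (\<beta> x y) = cinner y (g x)" by metis
  then have g: "cinner (g x) y = \<beta> x y" for x y by (metis cinner_commute complex_cnj_cnj)
  have a: "g (x + y) = g x + g y" for x y by (rule cinner_ext) (simp add: g cinner_add_left add1)
  have s: "g (c *\<^sub>C x) = c *\<^sub>C g x" for c x by (rule cinner_ext) (simp add: g cinner_scaleC_left scl1)
  have "norm (g x) \<le> norm x * M" for x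
  proof (cases "norm (g x) = 0")
    case False
    have "cmod (cinner (g x) (g x)) \<le> M * norm x * norm (g x)" unfolding g by (rule bd)
    then have "norm (g x) * norm (g x) \<le> (norm x * M) * norm (g x)"
      unfolding cinner_self by (simp add: power2_eq_square mult_ac norm_mult)
    then show ?thesis using False by simp
  qed (use M in simp)
  then have "bounded_linear g"
    by (intro bounded_linear_intro[of g M]) (simp_all add: a s scaleR_scaleC)
  then have "bop_apply (Bop g) = g" by (intro Bop_inverse) (simp add: clinear_iff a s)
  then show ?thesis using g by (intro exI[of _ "Bop g"]) simp
qed

section \<open>Normal functionals as sums of vector functionals\<close>

text \<open>A common bound \<open>r\<close> for both square sums is carried along so that countably
  many representations with summable bounds can be merged into a single one.\<close>

definition l2_rep :: "real \<Rightarrow> ('a::complex_hilbert bop \<Rightarrow> complex) \<Rightarrow> bool" where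
  "l2_rep r f \<longleftrightarrow> (\<exists>x y :: nat \<Rightarrow> 'a. summable (\<lambda>n. (norm (x n))\<^sup>2) \<and> summable (\<lambda>n. (norm (y n))\<^sup>2) \<and>
     (\<Sum>n. (norm (x n))\<^sup>2) \<le> r \<and> (\<Sum>n. (norm (y n))\<^sup>2) \<le> r \<and>
     (\<forall>A. f A = (\<Sum>n. cinner (bop_apply A (x n)) (y n))))"

lemma l2_repI:
  assumes "summable (\<lambda>n. (norm (x n))\<^sup>2)" "summable (\<lambda>n. (norm (y n))\<^sup>2)"
    and "\<And>A. f A = (\<Sum>n. cinner (bop_apply A (x n)) (y n))"
  shows "\<exists>r. l2_rep r f"
  unfolding l2_rep_def
  by (rule exI[of _ "max (\<Sum>n. (norm (x n))\<^sup>2) (\<Sum>n. (norm (y n))\<^sup>2)"], rule exI[of _ x], rule exI[of _ y])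
    (intro conjI assms allI max.cobounded1 max.cobounded2)

lemma clinear_functional_iff:
  fixes f :: "'a::complex_vector \<Rightarrow> complex"
  shows "clinear f \<longleftrightarrow> (\<forall>x y. f (x + y) = f x + f y) \<and> (\<forall>c x. f (c *\<^sub>C x) = c * f x)"
  by (simp only: clinear_iff) (simp add: scaleC_complex_def)

lemma vec_functional_apply [simp]: "blinfun_apply (vec_functional x y) A = cinner (bop_apply A x) y"
  by (simp add: vec_functional.rep_eq)

lemma norm_vec_functional: "norm (vec_functional x y) \<le> norm x * norm y"
proof (rule norm_blinfun_bound)
  fix A :: "'a bop"
  have "cmod (cinner (bop_apply A x) y) \<le> norm (bop_apply A x) * norm y" by (rule cmod_cinner_le)
  also have "\<dots> \<le> norm A * norm x * norm y" by (intro mult_right_mono norm_bop_apply) auto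
  finally show "norm (blinfun_apply (vec_functional x y) A) \<le> norm x * norm y * norm A" by (simp add: mult_ac)
qed simp

lemma bounded_bilinear_vec_functional:
  "bounded_bilinear (vec_functional :: 'a::complex_hilbert \<Rightarrow> 'a \<Rightarrow> _)"
proof
  show "\<exists>K. \<forall>a b::'a. norm (vec_functional a b) \<le> norm a * norm b * K"
    using norm_vec_functional by (intro exI[of _ 1]) auto
qed (simp_all add: blinfun_eqI bop_add_right cinner_add_left cinner_add_right
      cinner_scaleR_left cinner_scaleR_right plus_blinfun.rep_eq scaleR_blinfun.rep_eq
      linear_scale[OF bounded_linear.linear[OF bounded_linear_bop]])

lemma vec_functional_add_left: "vec_functional (x + x') y = vec_functional x y + vec_functional x' y"
  by (rule bounded_bilinear.add_left[OF bounded_bilinear_vec_functional])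

lemma clinear_vec_functional: "clinear (blinfun_apply (vec_functional x y))"
  by (simp add: clinear_functional_iff cinner_add_left cinner_scaleC_left)

lemma mult_norm_le_squares: "norm u * norm v \<le> (norm u)\<^sup>2 + (norm v)\<^sup>2"
proof -
  have "0 \<le> norm u * norm v" by simp
  then show ?thesis using sum_squares_bound[of "norm u" "norm v"] by linarith
qed

lemma summable_norm_vec_functional:
  assumes "summable (\<lambda>n. (norm (x n))\<^sup>2)" "summable (\<lambda>n. (norm (y n))\<^sup>2)"
  shows "summable (\<lambda>n. norm (vec_functional (x n) (y n)))"
proof (rule summable_comparison_test')
  show "summable (\<lambda>n. (norm (x n))\<^sup>2 + (norm (y n))\<^sup>2)" by (intro summable_add assms)
  show "norm (norm (vec_functional (x n) (y n))) \<le> (norm (x n))\<^sup>2 + (norm (y n))\<^sup>2" for n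
    by (simp add: order_trans[OF norm_vec_functional mult_norm_le_squares])
qed

lemma suminf_vec_functional:
  assumes "summable (\<lambda>n. (norm (x n))\<^sup>2)" "summable (\<lambda>n. (norm (y n))\<^sup>2)"
  shows "(\<lambda>n. cinner (bop_apply A (x n)) (y n)) sums blinfun_apply (\<Sum>n. vec_functional (x n) (y n)) A"
proof -
  have "(\<lambda>n. vec_functional (x n) (y n)) sums (\<Sum>n. vec_functional (x n) (y n))"
    by (rule summable_sums[OF summable_norm_cancel[OF summable_norm_vec_functional[OF assms]]])
  from bounded_linear.sums[OF blinfun.bounded_linear_left this, of A] show ?thesis by simp
qed

lemma l2_rep_blinfun:
  assumes "l2_rep r f"
  shows "\<exists>x y. summable (\<lambda>n. (norm (x n))\<^sup>2) \<and> summable (\<lambda>n. (norm (y n))\<^sup>2) \<and>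
     f = blinfun_apply (\<Sum>n. vec_functional (x n) (y n))"
proof -
  from assms obtain x y where *: "summable (\<lambda>n. (norm (x n))\<^sup>2)" "summable (\<lambda>n. (norm (y n))\<^sup>2)"
    "\<And>A. f A = (\<Sum>n. cinner (bop_apply A (x n)) (y n))" unfolding l2_rep_def by blast
  have "f = blinfun_apply (\<Sum>n. vec_functional (x n) (y n))"
    unfolding fun_eq_iff *(3) using suminf_vec_functional[OF *(1,2), THEN sums_unique] by simp
  with * show ?thesis by blast
qed

lemma l2_rep_clinear: "l2_rep r f \<Longrightarrow> clinear f"
proof -
  assume "l2_rep r f"
  then obtain x y where s: "summable (\<lambda>n. (norm (x n))\<^sup>2)" "summable (\<lambda>n. (norm (y n))\<^sup>2)"
    and f: "f = blinfun_apply (\<Sum>n. vec_functional (x n) (y n))" using l2_rep_blinfun by blast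
  have "(\<lambda>n. c * cinner (bop_apply A (x n)) (y n)) sums (c * f A)" for c A
    unfolding f by (intro sums_mult suminf_vec_functional s)
  moreover have "(\<lambda>n. c * cinner (bop_apply A (x n)) (y n)) sums f (c *\<^sub>C A)" for c A
    unfolding f using suminf_vec_functional[OF s, of "c *\<^sub>C A"] by (simp add: cinner_scaleC_left)
  ultimately have "f (c *\<^sub>C A) = c * f A" for c A by (metis sums_unique2)
  moreover have "f (A + B) = f A + f B" for A B unfolding f by (rule blinfun.add_right)
  ultimately show ?thesis by (simp add: clinear_functional_iff)
qed

lemma l2_rep_vec_functional: "l2_rep (max ((norm x)\<^sup>2) ((norm y)\<^sup>2)) (\<lambda>A. cinner (bop_apply A x) y)"
proof -
  define x' y' where "x' n = (if n = 0 then x else 0)" and "y' n = (if n = 0 then y else 0)" for n :: nat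
  have "(\<lambda>n. (norm (x' n))\<^sup>2) sums (\<Sum>n\<in>{0}. (norm (x' n))\<^sup>2)"
    "(\<lambda>n. (norm (y' n))\<^sup>2) sums (\<Sum>n\<in>{0}. (norm (y' n))\<^sup>2)"
    "(\<lambda>n. cinner (bop_apply A (x' n)) (y' n)) sums (\<Sum>n\<in>{0}. cinner (bop_apply A (x' n)) (y' n))" for A
    by (rule sums_finite; simp add: x'_def y'_def)+
  then have "(\<lambda>n. (norm (x' n))\<^sup>2) sums (norm x)\<^sup>2" "(\<lambda>n. (norm (y' n))\<^sup>2) sums (norm y)\<^sup>2"
    "(\<lambda>n. cinner (bop_apply A (x' n)) (y' n)) sums cinner (bop_apply A x) y" for A
    by (simp_all add: x'_def y'_def)
  then show ?thesis unfolding l2_rep_def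
    by (intro exI[of _ x'] exI[of _ y']) (auto simp: sums_iff)
qed

lemma l2_rep_mono: "l2_rep r f \<Longrightarrow> r \<le> s \<Longrightarrow> l2_rep s f"
  unfolding l2_rep_def by (meson order_trans)

lemma l2_rep_scale:
  assumes "l2_rep r f" "0 \<le> s"
  shows "l2_rep (s * r) (\<lambda>A. of_real s * f A)"
proof -
  from assms(1) obtain x y where *: "summable (\<lambda>n. (norm (x n))\<^sup>2)" "summable (\<lambda>n. (norm (y n))\<^sup>2)"
    "(\<Sum>n. (norm (x n))\<^sup>2) \<le> r" "(\<Sum>n. (norm (y n))\<^sup>2) \<le> r"
    "\<And>A. f A = (\<Sum>n. cinner (bop_apply A (x n)) (y n))" unfolding l2_rep_def by blast
  \<comment> \<open>The factor is divided evenly between the two sequences. Each square sum then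
    scales by \<open>s\<close>, and this linear behaviour is what convex combinations and geometric
    series of representations require.\<close>
  let ?x = "\<lambda>n. sqrt s *\<^sub>R x n" and ?y = "\<lambda>n. sqrt s *\<^sub>R y n"
  have sq: "(norm (sqrt s *\<^sub>R v))\<^sup>2 = s * (norm v)\<^sup>2" for v :: 'a
    using assms(2) by (simp add: power_mult_distrib)
  have ci: "cinner (bop_apply A (sqrt s *\<^sub>R u)) (sqrt s *\<^sub>R v) = of_real s * cinner (bop_apply A u) v" for A u v
  proof -
    have "cinner (bop_apply A (sqrt s *\<^sub>R u)) (sqrt s *\<^sub>R v)
        = (complex_of_real (sqrt s) * complex_of_real (sqrt s)) * cinner (bop_apply A u) v"
      by (simp add: scaleR_scaleC bop_scaleC_right cinner_scaleC_left cinner_scaleC_right mult_ac)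
    then show ?thesis using assms(2) by (simp flip: of_real_mult)
  qed
  have "(\<lambda>n. cinner (bop_apply A (x n)) (y n)) sums f A" for A
    using suminf_vec_functional[OF *(1,2), of A] *(5) by (simp add: sums_iff)
  then have "of_real s * f A = (\<Sum>n. cinner (bop_apply A (?x n)) (?y n))" for A
    unfolding ci by (rule sums_unique[OF sums_mult])
  note fA = this
  have su: "summable (\<lambda>n. (norm (sqrt s *\<^sub>R z n))\<^sup>2)" "(\<Sum>n. (norm (sqrt s *\<^sub>R z n))\<^sup>2) \<le> s * r"
    if "summable (\<lambda>n. (norm (z n))\<^sup>2)" "(\<Sum>n. (norm (z n))\<^sup>2) \<le> r" for z :: "nat \<Rightarrow> 'a"
    unfolding sq suminf_mult[OF that(1)]
    by (rule summable_mult[OF that(1)], rule mult_left_mono[OF that(2) assms(2)])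
  show ?thesis
    unfolding l2_rep_def
    by (rule exI[of _ ?x], rule exI[of _ ?y]) (intro conjI allI su[OF *(1,3)] su[OF *(2,4)] fA)
qed

text \<open>Countably many representing sequences are merged into one along \<open>\<nat> \<times> \<nat> \<cong> \<nat>\<close>.\<close>

lemma l2_rep_sums:
  assumes d: "\<And>m. l2_rep (r m) (d m)" and r: "summable r" and f: "\<And>A. (\<lambda>m. d m A) sums f A"
  shows "l2_rep (suminf r) f"
proof -
  have "\<forall>m. \<exists>x y :: nat \<Rightarrow> 'a. summable (\<lambda>n. (norm (x n))\<^sup>2) \<and> summable (\<lambda>n. (norm (y n))\<^sup>2) \<and>
     (\<Sum>n. (norm (x n))\<^sup>2) \<le> r m \<and> (\<Sum>n. (norm (y n))\<^sup>2) \<le> r m \<and>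
     (\<forall>A. d m A = (\<Sum>n. cinner (bop_apply A (x n)) (y n)))"
    using d unfolding l2_rep_def by blast
  from choice[OF this] obtain x :: "nat \<Rightarrow> nat \<Rightarrow> 'a" where
    "\<forall>m. \<exists>y. summable (\<lambda>n. (norm (x m n))\<^sup>2) \<and> summable (\<lambda>n. (norm (y n))\<^sup>2) \<and>
     (\<Sum>n. (norm (x m n))\<^sup>2) \<le> r m \<and> (\<Sum>n. (norm (y n))\<^sup>2) \<le> r m \<and>
     (\<forall>A. d m A = (\<Sum>n. cinner (bop_apply A (x m n)) (y n)))" ..
  from choice[OF this] obtain y :: "nat \<Rightarrow> nat \<Rightarrow> 'a" where
    "\<forall>m. summable (\<lambda>n. (norm (x m n))\<^sup>2) \<and> summable (\<lambda>n. (norm (y m n))\<^sup>2) \<and>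
     (\<Sum>n. (norm (x m n))\<^sup>2) \<le> r m \<and> (\<Sum>n. (norm (y m n))\<^sup>2) \<le> r m \<and>
     (\<forall>A. d m A = (\<Sum>n. cinner (bop_apply A (x m n)) (y m n)))" ..
  then have
    x: "\<And>m. summable (\<lambda>n. (norm (x m n))\<^sup>2)" and y: "\<And>m. summable (\<lambda>n. (norm (y m n))\<^sup>2)" and
    xr: "\<And>m. (\<Sum>n. (norm (x m n))\<^sup>2) \<le> r m" and yr: "\<And>m. (\<Sum>n. (norm (y m n))\<^sup>2) \<le> r m" and
    dA: "\<And>m A. d m A = (\<Sum>n. cinner (bop_apply A (x m n)) (y m n))" by blast+
  have sq: "((\<lambda>(m, n). (norm (z m n))\<^sup>2) has_sum (\<Sum>m. \<Sum>n. (norm (z m n))\<^sup>2)) UNIV \<and>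
      (\<Sum>m. \<Sum>n. (norm (z m n))\<^sup>2) \<le> suminf r"
    if z: "\<And>m. summable (\<lambda>n. (norm (z m n))\<^sup>2)" and zr: "\<And>m. (\<Sum>n. (norm (z m n))\<^sup>2) \<le> r m"
    for z :: "nat \<Rightarrow> nat \<Rightarrow> 'a"
  proof
    have row: "((\<lambda>n. (\<lambda>(m, n). (norm (z m n))\<^sup>2) (m, n)) has_sum (\<Sum>n. (norm (z m n))\<^sup>2)) UNIV" for m
      using z[of m] by (intro sums_nonneg_imp_has_sum) (auto simp: summable_sums)
    have nn: "0 \<le> (\<Sum>n. (norm (z m n))\<^sup>2)" for m by (intro suminf_nonneg z) simp
    have col: "summable (\<lambda>m. \<Sum>n. (norm (z m n))\<^sup>2)"
      by (rule summable_comparison_test'[OF r]) (use nn zr in auto)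
    then have col': "((\<lambda>m. \<Sum>n. (norm (z m n))\<^sup>2) has_sum (\<Sum>m. \<Sum>n. (norm (z m n))\<^sup>2)) UNIV"
      using nn by (intro sums_nonneg_imp_has_sum) (auto simp: summable_sums)
    have "(\<lambda>(m, n). (norm (z m n))\<^sup>2) summable_on (UNIV \<times> UNIV)"
      by (rule summable_on_SigmaI[OF row]) (use col' in \<open>auto simp: summable_on_def\<close>)
    from has_sum_SigmaI[OF row col' this]
    show "((\<lambda>(m, n). (norm (z m n))\<^sup>2) has_sum (\<Sum>m. \<Sum>n. (norm (z m n))\<^sup>2)) UNIV" by simp
    show "(\<Sum>m. \<Sum>n. (norm (z m n))\<^sup>2) \<le> suminf r" by (rule suminf_le[OF zr col r])
  qed
  note X = sq[OF x xr] and Y = sq[OF y yr]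
  define x' y' where "x' k = (case prod_decode k of (m, n) \<Rightarrow> x m n)"
    and "y' k = (case prod_decode k of (m, n) \<Rightarrow> y m n)" for k
  have re: "((\<lambda>k. h (prod_decode k)) has_sum S) UNIV \<longleftrightarrow> (h has_sum S) UNIV"
    for h :: "nat \<times> nat \<Rightarrow> 'c::{topological_comm_monoid_add, t2_space}" and S
    by (rule has_sum_reindex_bij_betw[OF bij_prod_decode])
  have X': "(\<lambda>k. (norm (x' k))\<^sup>2) sums (\<Sum>m. \<Sum>n. (norm (x m n))\<^sup>2)"
    using has_sum_imp_sums[OF iffD2[OF re conjunct1[OF X]]] by (simp add: x'_def case_prod_unfold)
  have Y': "(\<lambda>k. (norm (y' k))\<^sup>2) sums (\<Sum>m. \<Sum>n. (norm (y m n))\<^sup>2)"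
    using has_sum_imp_sums[OF iffD2[OF re conjunct1[OF Y]]] by (simp add: y'_def case_prod_unfold)
  have "(\<lambda>k. cinner (bop_apply A (x' k)) (y' k)) sums f A" for A
  proof -
    let ?g = "\<lambda>(m, n). cinner (bop_apply A (x m n)) (y m n)"
    have le: "norm (?g p) \<le> norm A * ((case p of (m, n) \<Rightarrow> (norm (x m n))\<^sup>2) + (case p of (m, n) \<Rightarrow> (norm (y m n))\<^sup>2))" for p
    proof -
      obtain m n where p: "p = (m, n)" by (cases p)
      have "norm (?g p) \<le> norm (bop_apply A (x m n)) * norm (y m n)" using cmod_cinner_le p by simp
      also have "\<dots> \<le> norm A * norm (x m n) * norm (y m n)"
        by (intro mult_right_mono norm_bop_apply) auto
      also have "\<dots> \<le> norm A * ((norm (x m n))\<^sup>2 + (norm (y m n))\<^sup>2)"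
        using mult_left_mono[OF mult_norm_le_squares, of "norm A"] by (simp add: mult.assoc)
      finally show ?thesis using p by simp
    qed
    \<comment> \<open>Absolute summability over all pairs lets the same sum be read row by row,
      which gives \<open>f A\<close>, and along \<open>prod_decode\<close>, which gives the merged
      sequences.\<close>
    have abs: "(\<lambda>p. norm (?g p)) summable_on UNIV"
    proof (rule summable_on_comparison_test[OF _ le])
      show "(\<lambda>p. norm A * ((case p of (m, n) \<Rightarrow> (norm (x m n))\<^sup>2) + (case p of (m, n) \<Rightarrow> (norm (y m n))\<^sup>2))) summable_on UNIV"
        using X Y by (intro summable_on_cmult_right summable_on_add) (auto simp: summable_on_def)
    qed auto
    then have "?g summable_on UNIV" by (rule abs_summable_summable)
    then obtain S where S: "(?g has_sum S) UNIV" by (auto simp: summable_on_def)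
    have row: "((\<lambda>n. ?g (m, n)) has_sum d m A) UNIV" for m
    proof -
      have "(\<lambda>n. norm (cinner (bop_apply A (x m n)) (y m n))) summable_on UNIV"
        using abs Infinite_Sum.abs_summable_on_Sigma_iff[of ?g UNIV "\<lambda>_. UNIV"] by simp
      then have "(\<lambda>n. cinner (bop_apply A (x m n)) (y m n)) summable_on UNIV" by (rule abs_summable_summable)
      note hs = has_sum_infsum[OF this]
      show ?thesis using hs sums_unique[OF has_sum_imp_sums[OF hs]] by (simp add: dA)
    qed
    have "((\<lambda>m. d m A) has_sum S) UNIV"
      by (rule has_sum_SigmaD[OF _ row]) (use S in simp)
    from sums_unique2[OF has_sum_imp_sums[OF this] f] have "(?g has_sum f A) UNIV" using S by simp
    from has_sum_imp_sums[OF iffD2[OF re this]] show ?thesis by (simp add: x'_def y'_def case_prod_unfold)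
  qed
  note fA = this
  show ?thesis
    unfolding l2_rep_def
    by (rule exI[of _ x'], rule exI[of _ y'])
      (intro conjI allI sums_summable[OF X'] sums_summable[OF Y'] sums_unique[OF fA],
       use X X' Y Y' in \<open>simp_all add: sums_iff\<close>)
qed

lemma l2_rep_zero: "l2_rep 0 (\<lambda>_. 0)"
  using l2_rep_vec_functional[of "0::'a" 0] by simp

text \<open>The sum is read as a series with zero tail, so the merging of sequences is done only in
  \<open>l2_rep_sums\<close>.\<close>

lemma l2_rep_add:
  assumes "l2_rep r f" "l2_rep s g"
  shows "l2_rep (r + s) (\<lambda>A. f A + g A)"
proof -
  define d where "d m = (if m = 0 then f else if m = 1 then g else (\<lambda>_. 0))" for m :: nat
  define t where "t m = (if m = 0 then r else if m = 1 then s else 0)" for m :: nat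
  have "t sums sum t {..<2}" by (rule sums_finite) (auto simp: t_def)
  then have t: "t sums (r + s)" by (simp add: t_def numeral_2_eq_2)
  have "(\<lambda>m. d m A) sums (\<Sum>m<2. d m A)" for A by (rule sums_finite) (auto simp: d_def)
  then have dA: "(\<lambda>m. d m A) sums (f A + g A)" for A by (simp add: d_def numeral_2_eq_2)
  have "l2_rep (t m) (d m)" for m unfolding t_def d_def by (simp add: assms l2_rep_zero)
  from l2_rep_sums[OF this _ dA] t show ?thesis by (simp add: sums_iff)
qed

lemma l2_rep_cmult:
  assumes "l2_rep r f"
  shows "\<exists>s. l2_rep s (\<lambda>A. c * f A)"
proof -
  from assms obtain x y where x: "summable (\<lambda>n. (norm (x n))\<^sup>2)" and y: "summable (\<lambda>n. (norm (y n))\<^sup>2)"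
    and f: "f = blinfun_apply (\<Sum>n. vec_functional (x n) (y n))" using l2_rep_blinfun by blast
  show ?thesis
  proof (rule l2_repI[of "\<lambda>n. c *\<^sub>C x n" y, OF _ y])
    show "summable (\<lambda>n. (norm (c *\<^sub>C x n))\<^sup>2)"
      unfolding norm_scaleC power_mult_distrib by (rule summable_mult[OF x])
    show "c * f A = (\<Sum>n. cinner (bop_apply A (c *\<^sub>C x n)) (y n))" for A
      unfolding bop_scaleC_right cinner_scaleC_left f
      by (rule sums_unique[OF sums_mult[OF suminf_vec_functional[OF x y]]])
  qed
qed

lemma l2_rep_sum:
  assumes "\<And>i. i \<in> I \<Longrightarrow> \<exists>r. l2_rep r (f i)"
  shows "\<exists>r. l2_rep r (\<lambda>A. \<Sum>i\<in>I. f i A)"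
  using assms
proof (induction I rule: infinite_finite_induct)
  case (insert i I)
  obtain r where "l2_rep r (f i)" using insert.prems by blast
  moreover obtain s where "l2_rep s (\<lambda>A. \<Sum>i\<in>I. f i A)" using insert.IH insert.prems by blast
  ultimately have "l2_rep (r + s) (\<lambda>A. f i A + (\<Sum>i\<in>I. f i A))" by (rule l2_rep_add)
  then show ?case using insert.hyps by auto
qed (auto intro!: exI[of _ 0] l2_rep_zero)

section \<open>\<open>\<sigma>\<close>-weak continuity\<close>

text \<open>The subspace \<open>V\<close> is variable because the induction passes to the kernel of
  \<open>g j\<close> in it. A combination that represents \<open>f\<close> on this kernel leaves an
  error that vanishes there, and such an error is a multiple of \<open>g j\<close>.\<close>

lemma functional_in_span:
  fixes g :: "'i \<Rightarrow> 'v::complex_vector \<Rightarrow> complex"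
  assumes "finite I" "\<And>i. i \<in> I \<Longrightarrow> clinear (g i)" "clinear f"
    "cvec.subspace V" "\<And>v. v \<in> V \<Longrightarrow> (\<And>i. i \<in> I \<Longrightarrow> g i v = 0) \<Longrightarrow> f v = 0"
  shows "\<exists>c. \<forall>v\<in>V. f v = (\<Sum>i\<in>I. c i * g i v)"
  using assms
proof (induction I arbitrary: V)
  case empty
  then show ?case by auto
next
  case (insert j I)
  have g: "g i (u + v) = g i u + g i v" "g i (c *\<^sub>C v) = c * g i v" if "i \<in> insert j I" for i u v c
    using insert.prems(1)[OF that] by (auto simp: clinear_functional_iff)
  have f: "f (u + v) = f u + f v" "f (c *\<^sub>C v) = c * f v" for u v c
    using insert.prems(2) by (auto simp: clinear_functional_iff)
  let ?V = "{v \<in> V. g j v = 0}"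
  have gj0: "g j 0 = 0" using g(2)[of j 0 0] by simp
  have V': "cvec.subspace ?V"
    using insert.prems(3) g[of j] gj0 by (auto simp: cvec.subspace_def)
  have "\<exists>c. \<forall>v\<in>?V. f v = (\<Sum>i\<in>I. c i * g i v)"
    by (rule insert.IH) (use insert.prems V' in auto)
  then obtain c where c: "\<And>v. v \<in> V \<Longrightarrow> g j v = 0 \<Longrightarrow> f v = (\<Sum>i\<in>I. c i * g i v)" by blast
  show ?case
  proof (cases "\<exists>w\<in>V. g j w \<noteq> 0")
    case True
    then obtain w where w: "w \<in> V" "g j w \<noteq> 0" by blast
    define h where "h v = f v - (\<Sum>i\<in>I. c i * g i v)" for v
    have h: "h (u + v) = h u + h v" "h (a *\<^sub>C v) = a * h v" for u v a
      using f g by (auto simp: h_def sum.distrib algebra_simps sum_distrib_left)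
    have "f v = (\<Sum>i\<in>I. c i * g i v) + (h w / g j w) * g j v" if v: "v \<in> V" for v
    proof -
      let ?u = "v + (- (g j v / g j w)) *\<^sub>C w"
      have "?u \<in> V" by (intro cvec.subspace_add cvec.subspace_scale v w insert.prems(3))
      moreover have "g j ?u = 0" unfolding g(1)[OF insertI1] g(2)[OF insertI1] using w by simp
      ultimately have "h ?u = 0" using c by (simp add: h_def)
      then have "h v = (g j v / g j w) * h w" unfolding h by simp
      then show ?thesis unfolding h_def[of v] by (simp add: algebra_simps)
    qed
    then show ?thesis using insert.hyps
      by (intro exI[of _ "c(j := h w / g j w)"])
        (auto simp: add.commute intro!: sum.cong)
  next
    case False
    then show ?thesis using insert.hyps c
      by (intro exI[of _ "c(j := 0)"]) (auto intro!: sum.cong)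
  qed
qed

lemma generate_topology_on_base:
  assumes "generate_topology_on S U" "a \<in> U"
  shows "\<exists>T. finite T \<and> T \<subseteq> S \<and> a \<in> \<Inter>T \<and> \<Inter>T \<subseteq> U"
  using assms
proof (induction rule: generate_topology_on.induct)
  case (Int U V)
  from Int.IH(1) Int.prems obtain T where T: "finite T" "T \<subseteq> S" "a \<in> \<Inter>T" "\<Inter>T \<subseteq> U" by blast
  from Int.IH(2) Int.prems obtain T' where T': "finite T'" "T' \<subseteq> S" "a \<in> \<Inter>T'" "\<Inter>T' \<subseteq> V" by blast
  have "\<Inter>(T \<union> T') \<subseteq> U \<inter> V" using T(4) T'(4) by blast
  then show ?case using T(1-3) T'(1-3) by (intro exI[of _ "T \<union> T'"] conjI) (blast | simp)+
next
  case (UN K)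
  then obtain k where k: "k \<in> K" "a \<in> k" by blast
  from UN.IH[OF this] obtain T where T: "finite T" "T \<subseteq> S" "a \<in> \<Inter>T" "\<Inter>T \<subseteq> k" by blast
  have "\<Inter>T \<subseteq> \<Union>K" using T(4) k(1) by blast
  then show ?case using T(1-3) by blast
next
  case (Basis s)
  then show ?case by (intro exI[of _ "{s}"]) simp
qed simp

text \<open>The preimage of the unit disc contains a basic neighbourhood of 0, hence the common
  kernel of finitely many of the defining functionals. There \<open>f\<close> is bounded on a linear
  subspace and so vanishes, which makes it a combination of these functionals.\<close>

lemma sigma_weak_continuous_l2_rep:
  assumes f: "clinear f" and c: "continuous_map sigma_weak euclidean f"
  shows "\<exists>r. l2_rep r f"
proof -
  have fs: "f (c *\<^sub>C A) = c * f A" for c A using f by (simp add: clinear_functional_iff)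
  then have f0: "f 0 = 0" by (metis (no_types) cvec.scale_zero_left mult_zero_left)
  let ?U = "{A. f A \<in> ball 0 1}"
  let ?S = "{{A. (\<Sum>n. cinner (bop_apply A (x n)) (y n)) \<in> U} |(x :: nat \<Rightarrow> 'a) (y :: nat \<Rightarrow> 'a) U.
        summable (\<lambda>n. (norm (x n))\<^sup>2) \<and> summable (\<lambda>n. (norm (y n))\<^sup>2) \<and> open U}"
  have "openin sigma_weak {A \<in> topspace sigma_weak. f A \<in> ball 0 1}"
    by (rule openin_continuous_map_preimage[OF c]) (simp flip: open_openin)
  then have "generate_topology_on ?S ?U"
    unfolding topspace_sigma_weak by (simp add: sigma_weak_def openin_topology_generated_by_iff)
  moreover have "0 \<in> ?U" using f0 by simp
  ultimately obtain T where T: "finite T" "T \<subseteq> ?S" "0 \<in> \<Inter>T" "\<Inter>T \<subseteq> ?U"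
    using generate_topology_on_base[of ?S ?U 0] by blast
  have "\<forall>t\<in>T. \<exists>g. (\<exists>r. l2_rep r g) \<and> (\<forall>A. g A = 0 \<longrightarrow> A \<in> t)"
  proof
    fix t assume "t \<in> T"
    with T(2) obtain x y :: "nat \<Rightarrow> 'a" and U where t: "t = {A. (\<Sum>n. cinner (bop_apply A (x n)) (y n)) \<in> U}"
      and s: "summable (\<lambda>n. (norm (x n))\<^sup>2)" "summable (\<lambda>n. (norm (y n))\<^sup>2)" by blast
    let ?g = "\<lambda>A. \<Sum>n. cinner (bop_apply A (x n)) (y n)"
    have "\<exists>r. l2_rep r ?g" using s by (rule l2_repI) (rule refl)
    moreover have "0 \<in> t" using T(3) \<open>t \<in> T\<close> by blast
    then have "0 \<in> U" using t by simp
    ultimately show "\<exists>g. (\<exists>r. l2_rep r g) \<and> (\<forall>A. g A = 0 \<longrightarrow> A \<in> t)"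
      using t by (intro exI[of _ ?g]) auto
  qed
  from bchoice[OF this] obtain g where
    "\<forall>t\<in>T. (\<exists>r. l2_rep r (g t)) \<and> (\<forall>A. g t A = 0 \<longrightarrow> A \<in> t)" ..
  then have g: "\<And>t. t \<in> T \<Longrightarrow> \<exists>r. l2_rep r (g t)" "\<And>t A. t \<in> T \<Longrightarrow> g t A = 0 \<Longrightarrow> A \<in> t"
    by blast+
  have "\<exists>c. \<forall>v\<in>UNIV. f v = (\<Sum>t\<in>T. c t * g t v)"
  proof (rule functional_in_span[OF T(1) _ f])
    show "clinear (g t)" if "t \<in> T" for t using g(1)[OF that] l2_rep_clinear by blast
    fix A assume A: "\<And>t. t \<in> T \<Longrightarrow> g t A = 0"
    have "cmod z * cmod (f A) < 1" for z
    proof -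
      have "g t (z *\<^sub>C A) = 0" if t: "t \<in> T" for t
      proof -
        obtain r where "l2_rep r (g t)" using g(1)[OF t] by blast
        from l2_rep_clinear[OF this] show ?thesis using A[OF t] by (simp add: clinear_functional_iff)
      qed
      then have "z *\<^sub>C A \<in> \<Inter>T" using g(2) by blast
      then have "z *\<^sub>C A \<in> ?U" using T(4) by blast
      then show ?thesis by (simp add: fs norm_mult)
    qed
    from this[of "inverse (f A)"] show "f A = 0" by (cases "f A = 0") (auto simp: norm_inverse)
  qed simp
  then obtain c where "f = (\<lambda>A. \<Sum>t\<in>T. c t * g t A)" by auto
  moreover have "\<exists>r. l2_rep r (\<lambda>A. \<Sum>t\<in>T. c t * g t A)"
    using g(1) l2_rep_cmult by (intro l2_rep_sum) blast
  ultimately show ?thesis by simp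
qed

lemma l2_rep_sigma_weak_continuous:
  assumes "l2_rep r f" shows "continuous_map sigma_weak euclidean f"
proof -
  from assms obtain x y where s: "summable (\<lambda>n. (norm (x n))\<^sup>2)" "summable (\<lambda>n. (norm (y n))\<^sup>2)"
    and f: "f = (\<lambda>A. \<Sum>n. cinner (bop_apply A (x n)) (y n))" unfolding l2_rep_def by blast
  have "openin sigma_weak {A. f A \<in> U}" if "open U" for U
    unfolding sigma_weak_def f using s that by (intro topology_generated_by_Basis) blast
  then show ?thesis by (simp add: continuous_map_def)
qed

lemma predual_iff: "\<rho> \<in> predual \<longleftrightarrow> (\<exists>r. l2_rep r (blinfun_apply \<rho>))"
  unfolding predual_def
  using sigma_weak_continuous_l2_rep l2_rep_sigma_weak_continuous l2_rep_clinear by blast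

text \<open>The \<sigma>-weak topology is the initial topology for the functionals with a square
  summable representation, and these are all its continuous linear functionals. Normality of a map
  can therefore be tested by composition with them.\<close>

lemma normal_map_iff:
  fixes \<Phi> :: "'a::complex_hilbert bop \<Rightarrow> 'b::complex_hilbert bop"
  assumes \<Phi>: "clinear \<Phi>"
  shows "normal_map \<Phi> \<longleftrightarrow> (\<forall>g r. l2_rep r g \<longrightarrow> (\<exists>s. l2_rep s (\<lambda>A. g (\<Phi> A))))"
proof
  assume n: "normal_map \<Phi>"
  show "\<forall>g r. l2_rep r g \<longrightarrow> (\<exists>s. l2_rep s (\<lambda>A. g (\<Phi> A)))"
  proof (intro allI impI)
    fix g :: "'b bop \<Rightarrow> complex" and r assume g: "l2_rep r g"
    have "continuous_map sigma_weak euclidean (g \<circ> \<Phi>)"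
      using n l2_rep_sigma_weak_continuous[OF g] unfolding normal_map_def by (rule continuous_map_compose)
    moreover have "clinear (g \<circ> \<Phi>)" using \<Phi> l2_rep_clinear[OF g] by (simp add: clinear_iff)
    ultimately show "\<exists>s. l2_rep s (\<lambda>A. g (\<Phi> A))"
      using sigma_weak_continuous_l2_rep[of "g \<circ> \<Phi>"] by (simp add: o_def)
  qed
next
  assume *: "\<forall>g r. l2_rep r g \<longrightarrow> (\<exists>s. l2_rep s (\<lambda>A. g (\<Phi> A)))"
  show "normal_map \<Phi>"
    unfolding normal_map_def
  proof (subst sigma_weak_def, rule continuous_on_generated_topo)
    fix V assume "V \<in> {{A. (\<Sum>n. cinner (bop_apply A (x n)) (y n)) \<in> U} |(x :: nat \<Rightarrow> 'b) (y :: nat \<Rightarrow> 'b) U.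
        summable (\<lambda>n. (norm (x n))\<^sup>2) \<and> summable (\<lambda>n. (norm (y n))\<^sup>2) \<and> open U}"
    then obtain x y :: "nat \<Rightarrow> 'b" and U where V: "V = {A. (\<Sum>n. cinner (bop_apply A (x n)) (y n)) \<in> U}"
      and s: "summable (\<lambda>n. (norm (x n))\<^sup>2)" "summable (\<lambda>n. (norm (y n))\<^sup>2)" and U: "open U" by blast
    let ?g = "\<lambda>A. \<Sum>n. cinner (bop_apply A (x n)) (y n)"
    have "\<exists>r. l2_rep r ?g" using s by (rule l2_repI) (rule refl)
    then obtain t where "l2_rep t (\<lambda>A. ?g (\<Phi> A))" using *[rule_format, of _ ?g] by blast
    from openin_continuous_map_preimage[OF l2_rep_sigma_weak_continuous[OF this], of U] U
    show "openin sigma_weak (\<Phi> -` V \<inter> topspace sigma_weak)"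
      unfolding V topspace_sigma_weak by (simp add: vimage_def)
  next
    show "\<Phi> ` topspace sigma_weak \<subseteq> \<Union> {{A. (\<Sum>n. cinner (bop_apply A (x n)) (y n)) \<in> U} |(x :: nat \<Rightarrow> 'b) (y :: nat \<Rightarrow> 'b) U.
        summable (\<lambda>n. (norm (x n))\<^sup>2) \<and> summable (\<lambda>n. (norm (y n))\<^sup>2) \<and> open U}"
      using topspace_sigma_weak[where 'a = 'b]
      unfolding sigma_weak_def topology_generated_by_topspace by simp
  qed
qed

section \<open>Compression to finite-dimensional subspaces\<close>

definition ortho_proj :: "'a::complex_hilbert set \<Rightarrow> 'a bop" where
  "ortho_proj F = (\<Sum>p\<in>F. p \<boxtimes> p)"

lemma ortho_proj_apply: "bop_apply (ortho_proj F) v = (\<Sum>p\<in>F. cinner v p *\<^sub>C p)"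
  by (simp add: ortho_proj_def bop_sum_left rank_one_apply)

lemma norm_ortho_proj_apply:
  assumes "is_ortho F" "finite F"
  shows "norm (bop_apply (ortho_proj F) v) \<le> norm v"
proof (rule power2_le_imp_le)
  show "(norm (bop_apply (ortho_proj F) v))\<^sup>2 \<le> (norm v)\<^sup>2"
    unfolding ortho_proj_apply norm_sum_ortho[OF assms subset_refl] by (rule bessel[OF assms subset_refl])
qed simp

lemma cinner_bop_ortho_proj:
  "cinner (bop_apply A (bop_apply (ortho_proj F) x)) p = (\<Sum>q\<in>F. cinner x q * cinner (bop_apply A q) p)"
  unfolding ortho_proj_apply bop_sum_right cinner_sum_left bop_scaleC_right cinner_scaleC_left ..

lemma cinner_ortho_proj:
  "cinner (bop_apply A (bop_apply (ortho_proj F) x)) (bop_apply (ortho_proj F) y)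
    = (\<Sum>p\<in>F. \<Sum>q\<in>F. cinner x q * cinner p y * cinner (bop_apply A q) p)"
proof -
  have 1: "cinner u (bop_apply (ortho_proj F) y) = (\<Sum>p\<in>F. cinner p y * cinner u p)" for u
    unfolding ortho_proj_apply cinner_sum_right cinner_scaleC_right
    by (intro sum.cong refl) (metis cinner_commute)
  show ?thesis
    unfolding 1 cinner_bop_ortho_proj sum_distrib_left by (intro sum.cong refl) (simp add: mult_ac)
qed

definition cut :: "'a::complex_hilbert set \<Rightarrow> 'a bop \<Rightarrow> 'a bop" where
  "cut F A = ortho_proj F \<odot> A \<odot> ortho_proj F"

lemma cut_eq: "cut F A = (\<Sum>p\<in>F. \<Sum>q\<in>F. cinner (bop_apply A q) p *\<^sub>C (p \<boxtimes> q))"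
proof (rule bop_eqI)
  fix v
  show "bop_apply (cut F A) v = bop_apply (\<Sum>p\<in>F. \<Sum>q\<in>F. cinner (bop_apply A q) p *\<^sub>C (p \<boxtimes> q)) v"
    unfolding cut_def bop_comp_apply ortho_proj_apply[of _ "bop_apply A _"] cinner_bop_ortho_proj
    by (simp add: bop_sum_left rank_one_apply cvec.scale_sum_left scaleC_scaleC mult.commute)
qed

lemma norm_cut_le:
  assumes "is_ortho F" "finite F"
  shows "norm (cut F A) \<le> norm A"
proof (rule norm_bop_bound)
  fix v
  have "norm (bop_apply (cut F A) v) \<le> norm (bop_apply A (bop_apply (ortho_proj F) v))"
    unfolding cut_def bop_comp_apply by (rule norm_ortho_proj_apply[OF assms])
  also have "\<dots> \<le> norm A * norm (bop_apply (ortho_proj F) v)" by (rule norm_bop_apply)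
  also have "\<dots> \<le> norm A * norm v" by (intro mult_left_mono norm_ortho_proj_apply[OF assms]) simp
  finally show "norm (bop_apply (cut F A) v) \<le> norm A * norm v" .
qed simp

text \<open>For complex linear \<open>f\<close> this is \<open>f\<close> composed with
  \<open>cut F\<close>. Elements of the type are only real linear in general; written as a sum of
  vector functionals, the compression is additive in \<open>f\<close> and complex linear as a
  functional without further conditions.\<close>

definition compress :: "'a::complex_hilbert set \<Rightarrow> ('a bop \<Rightarrow>\<^sub>L complex) \<Rightarrow> ('a bop \<Rightarrow>\<^sub>L complex)" where
  "compress F f = (\<Sum>p\<in>F. \<Sum>q\<in>F. vec_functional (blinfun_apply f (p \<boxtimes> q) *\<^sub>C q) p)"

lemma blinfun_apply_sum: "blinfun_apply (sum f F) A = (\<Sum>i\<in>F. blinfun_apply (f i) A)"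
  by (induction F rule: infinite_finite_induct) (simp_all add: plus_blinfun.rep_eq)

lemma clinear_functional_sum:
  assumes "clinear (f :: 'a::complex_vector \<Rightarrow> complex)"
  shows "f (sum g F) = (\<Sum>i\<in>F. f (g i))"
proof -
  have "f 0 = 0" using assms unfolding clinear_functional_iff by (metis add_cancel_right_right)
  then show ?thesis using assms
    by (induction F rule: infinite_finite_induct) (simp_all add: clinear_functional_iff)
qed

lemma compress_apply:
  assumes "clinear (blinfun_apply f)"
  shows "blinfun_apply (compress F f) A = blinfun_apply f (cut F A)"
  using assms
  by (simp add: compress_def cut_eq blinfun_apply_sum clinear_functional_sum bop_scaleC_right cinner_scaleC_left
      clinear_functional_iff mult.commute)

lemma norm_compress_le:
  assumes "is_ortho F" "finite F" "clinear (blinfun_apply f)"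
  shows "norm (compress F f) \<le> norm f"
proof (rule norm_blinfun_bound)
  fix A
  have "norm (blinfun_apply (compress F f) A) \<le> norm f * norm (cut F A)"
    unfolding compress_apply[OF assms(3)] by (rule norm_blinfun)
  also have "\<dots> \<le> norm f * norm A" by (intro mult_left_mono norm_cut_le assms(1,2)) simp
  finally show "norm (blinfun_apply (compress F f) A) \<le> norm f * norm A" .
qed simp

lemma compress_vec_functional:
  "compress F (vec_functional x y) = vec_functional (bop_apply (ortho_proj F) x) (bop_apply (ortho_proj F) y)"
proof (rule blinfun_eqI)
  fix A
  have "cinner (bop_apply (p \<boxtimes> q) x) y = cinner x q * cinner p y" for p q
    by (simp add: rank_one_apply cinner_scaleC_left)
  then show "blinfun_apply (compress F (vec_functional x y)) A =
      blinfun_apply (vec_functional (bop_apply (ortho_proj F) x) (bop_apply (ortho_proj F) y)) A"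
    by (simp add: cinner_ortho_proj compress_def blinfun_apply_sum bop_scaleC_right cinner_scaleC_left)
qed

lemma compress_diff: "compress F (f - g) = compress F f - compress F g"
  by (rule blinfun_eqI) (simp add: compress_def blinfun_apply_sum minus_blinfun.rep_eq bop_scaleC_right
      cinner_scaleC_left left_diff_distrib sum_subtractf)

lemma compress_add: "compress F (f + g) = compress F f + compress F g"
  by (rule blinfun_eqI) (simp add: compress_def blinfun_apply_sum plus_blinfun.rep_eq bop_scaleC_right
      cinner_scaleC_left distrib_right sum.distrib)

lemma compress_scaleR: "compress F (c *\<^sub>R f) = c *\<^sub>R compress F f"
  by (rule blinfun_eqI) (simp add: compress_def blinfun_apply_sum scaleR_blinfun.rep_eq bop_scaleC_right
      cinner_scaleC_left scaleR_sum_right)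

text \<open>A description of the predual that passes to norm limits easily;
  \<open>predual_eq_approximable\<close> identifies the two for every orthonormal basis.\<close>

definition approximable :: "'a::complex_hilbert set \<Rightarrow> ('a bop \<Rightarrow>\<^sub>L complex) set" where
  "approximable B = {f. clinear (blinfun_apply f) \<and> ((\<lambda>F. compress F f) \<longlongrightarrow> f) (finite_subsets_at_top B)}"

lemma approximable_add: "f \<in> approximable B \<Longrightarrow> g \<in> approximable B \<Longrightarrow> f + g \<in> approximable B"
  unfolding approximable_def
  by (auto simp: compress_add clinear_functional_iff plus_blinfun.rep_eq distrib_left intro!: tendsto_add)

lemma approximable_scaleR: "f \<in> approximable B \<Longrightarrow> c *\<^sub>R f \<in> approximable B"
  unfolding approximable_def
  by (auto simp: compress_scaleR clinear_functional_iff scaleR_blinfun.rep_eq scaleR_add_right intro!: tendsto_scaleR)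

lemma approximable_diff: "f \<in> approximable B \<Longrightarrow> g \<in> approximable B \<Longrightarrow> f - g \<in> approximable B"
  using approximable_add[of f B "(-1) *\<^sub>R g"] approximable_scaleR[of g B "-1"] by simp

lemma ortho_proj_tendsto:
  assumes "is_onb B"
  shows "((\<lambda>F. bop_apply (ortho_proj F) x) \<longlongrightarrow> x) (finite_subsets_at_top B)"
  using onb_expansion[OF assms, of x] unfolding ortho_proj_apply has_sum_def .

lemma approximable_vec_functional: "is_onb B \<Longrightarrow> vec_functional x y \<in> approximable B"
  unfolding approximable_def mem_Collect_eq compress_vec_functional
  by (intro conjI clinear_vec_functional bounded_bilinear.tendsto[OF bounded_bilinear_vec_functional]
      ortho_proj_tendsto)

lemma eventually_finite_ortho:
  assumes "is_onb B"
  shows "\<forall>\<^sub>F F in finite_subsets_at_top B. is_ortho F \<and> finite F \<and> F \<subseteq> B"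
  by (rule eventually_finite_subsets_at_top_weakI)
    (use assms in \<open>auto simp: is_onb_def is_ortho_def subset_iff\<close>)

text \<open>Compressions to orthonormal sets are contractions on complex linear functionals, so the
  usual argument with three thirds of \<open>e\<close> applies.\<close>

lemma approximable_limit:
  assumes B: "is_onb B" and f: "\<And>n. f n \<in> approximable B" and lim: "f \<longlonglongrightarrow> g"
  shows "g \<in> approximable B"
proof -
  have ap: "(\<lambda>n. blinfun_apply (f n) A) \<longlonglongrightarrow> blinfun_apply g A" for A
    by (intro tendsto_intros lim)
  have cl: "clinear (blinfun_apply (f n))" for n using f by (simp add: approximable_def)
  have "blinfun_apply g (c *\<^sub>C A) = c * blinfun_apply g A" for c A
  proof (rule LIMSEQ_unique[OF ap])
    show "(\<lambda>n. blinfun_apply (f n) (c *\<^sub>C A)) \<longlonglongrightarrow> c * blinfun_apply g A"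
      using cl by (simp add: clinear_functional_iff) (intro tendsto_intros ap)
  qed
  then have g: "clinear (blinfun_apply g)" by (simp add: clinear_functional_iff blinfun.add_right)
  have "((\<lambda>F. compress F g) \<longlongrightarrow> g) (finite_subsets_at_top B)"
  proof (rule tendstoI)
    fix e :: real assume e: "0 < e"
    then obtain n where n: "norm (f n - g) < e / 3"
      using LIMSEQ_D[OF lim, of "e / 3"] by auto
    have gf: "clinear (blinfun_apply (g - f n))"
      using g cl[of n] by (simp add: clinear_functional_iff minus_blinfun.rep_eq right_diff_distrib)
    have "\<forall>\<^sub>F F in finite_subsets_at_top B. dist (compress F (f n)) (f n) < e / 3"
      using f[of n] e by (auto simp: approximable_def dest!: tendstoD[where e = "e / 3"])
    with eventually_finite_ortho[OF B]
    show "\<forall>\<^sub>F F in finite_subsets_at_top B. dist (compress F g) g < e"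
    proof eventually_elim
      case (elim F)
      have "norm (compress F g - compress F (f n)) \<le> norm (g - f n)"
        unfolding compress_diff[symmetric] using norm_compress_le[OF _ _ gf] elim by blast
      moreover have "norm (compress F g - g) \<le> norm (compress F g - compress F (f n))
          + norm (compress F (f n) - f n) + norm (f n - g)"
        using norm_triangle_ineq[of "compress F g - compress F (f n)" "(compress F (f n) - f n) + (f n - g)"]
          norm_triangle_ineq[of "compress F (f n) - f n" "f n - g"] by simp
      ultimately show ?case using n elim by (simp add: dist_norm norm_minus_commute)
    qed
  qed
  with g show ?thesis by (simp add: approximable_def)
qed

lemma l2_rep_approximable:
  assumes B: "is_onb B" and f: "l2_rep r (blinfun_apply f)"
  shows "f \<in> approximable B"
proof -
  obtain x y where s: "summable (\<lambda>n. (norm (x n))\<^sup>2)" "summable (\<lambda>n. (norm (y n))\<^sup>2)"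
    and "blinfun_apply f = blinfun_apply (\<Sum>n. vec_functional (x n) (y n))" using l2_rep_blinfun[OF f] by blast
  then have f: "f = (\<Sum>n. vec_functional (x n) (y n))" by (simp add: blinfun_apply_inject)
  have "(\<lambda>n. \<Sum>i<n. vec_functional (x i) (y i)) \<longlonglongrightarrow> f"
    unfolding f by (rule summable_LIMSEQ[OF summable_norm_cancel[OF summable_norm_vec_functional[OF s]]])
  moreover have "(\<Sum>i<n. vec_functional (x i) (y i)) \<in> approximable B" for n
  proof (induction n)
    case 0
    then show ?case using approximable_scaleR[OF approximable_vec_functional[OF B], of 0] by simp
  next
    case (Suc n)
    show ?case unfolding sum.lessThan_Suc
      by (rule approximable_add[OF Suc approximable_vec_functional[OF B]])
  qed
  ultimately show ?thesis by (rule approximable_limit[OF B, rotated])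
qed

text \<open>A compression depends only on the values at the matrix units
  \<open>p \<boxtimes> q\<close>, and the functionals are limits of their compressions.\<close>

lemma approximable_eqI:
  assumes B: "is_onb B" and "f \<in> approximable B" "g \<in> approximable B"
    and eq: "\<And>p q. p \<in> B \<Longrightarrow> q \<in> B \<Longrightarrow> blinfun_apply f (p \<boxtimes> q) = blinfun_apply g (p \<boxtimes> q)"
  shows "f = g"
proof -
  have f: "((\<lambda>F. compress F f) \<longlongrightarrow> f) (finite_subsets_at_top B)"
    and g: "((\<lambda>F. compress F g) \<longlongrightarrow> g) (finite_subsets_at_top B)"
    using assms(2,3) by (simp_all add: approximable_def)
  have "compress F f = compress F g" if "F \<subseteq> B" for F
    unfolding compress_def using that by (intro sum.cong refl) (simp add: eq subset_iff)
  then have "\<forall>\<^sub>F F in finite_subsets_at_top B. compress F f = compress F g"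
    by (intro eventually_finite_subsets_at_top_weakI)
  from iffD2[OF tendsto_cong[OF this] g] show ?thesis
    by (rule tendsto_unique[OF finite_subsets_at_top_neq_bot f])
qed

section \<open>The predual is norm closed\<close>

text \<open>
  The functional \<open>A \<mapsto> (Q A Q | s)\<close> on \<open>\<B>(H)\<close>, for \<open>s\<close> Hilbert--Schmidt and \<open>Q\<close> the projection onto the
  span of \<open>F\<close>; it carries separation arguments from the Hilbert space \<open>\<H>\<S>(H)\<close> to the predual.
\<close>

definition hs_functional :: "'a::complex_hilbert set \<Rightarrow> 'a hs \<Rightarrow> ('a bop \<Rightarrow>\<^sub>L complex)" where
  "hs_functional F s = (\<Sum>p\<in>F. \<Sum>q\<in>F. vec_functional (cnj (cinner s (tens p q)) *\<^sub>C q) p)"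

lemma bounded_linear_hs_functional: "bounded_linear (hs_functional F)"
  unfolding hs_functional_def
proof (intro bounded_linear_sum)
  fix p q :: 'a
  show "bounded_linear (\<lambda>s. vec_functional (cnj (cinner s (tens p q)) *\<^sub>C q) p)"
  proof (rule bounded_linear_intro)
    fix s t :: "'a hs" and r :: real
    show "vec_functional (cnj (cinner (s + t) (tens p q)) *\<^sub>C q) p
        = vec_functional (cnj (cinner s (tens p q)) *\<^sub>C q) p + vec_functional (cnj (cinner t (tens p q)) *\<^sub>C q) p"
      by (simp add: cinner_add_left scaleC_add_left vec_functional_add_left)
    show "vec_functional (cnj (cinner (r *\<^sub>R s) (tens p q)) *\<^sub>C q) p
        = r *\<^sub>R vec_functional (cnj (cinner s (tens p q)) *\<^sub>C q) p"
      by (rule blinfun_eqI) (simp add: scaleR_blinfun.rep_eq cinner_scaleR_left bop_scaleC_right cinner_scaleC_left)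
    have "norm (vec_functional (cnj (cinner s (tens p q)) *\<^sub>C q) p) \<le> cmod (cinner s (tens p q)) * norm q * norm p"
      using norm_vec_functional[of "cnj (cinner s (tens p q)) *\<^sub>C q" p] by (simp add: norm_scaleC)
    also have "\<dots> \<le> norm s * norm (tens p q) * norm q * norm p"
      by (intro mult_right_mono cmod_cinner_le) auto
    finally show "norm (vec_functional (cnj (cinner s (tens p q)) *\<^sub>C q) p) \<le> norm s * (norm (tens p q) * norm q * norm p)"
      by (simp add: mult_ac)
  qed
qed

lemma hs_functional_tens:
  "hs_functional F (tens x y) = vec_functional (bop_apply (ortho_proj F) y) (bop_apply (ortho_proj F) x)"
proof (rule blinfun_eqI)
  fix A
  have "cnj (cinner (tens x y) (tens p q)) = cinner y q * cinner p x" for p q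
  proof -
    have "cnj (cinner (tens x y) (tens p q)) = cinner (tens p q) (tens x y)" by (metis cinner_commute)
    then show ?thesis by (simp add: cinner_tens_right cinner_scaleC_left)
  qed
  then show "blinfun_apply (hs_functional F (tens x y)) A =
      blinfun_apply (vec_functional (bop_apply (ortho_proj F) y) (bop_apply (ortho_proj F) x)) A"
    by (simp add: cinner_ortho_proj hs_functional_def blinfun_apply_sum bop_scaleC_right cinner_scaleC_left)
qed

text \<open>The conjugates compensate the conjugate linearity of \<open>cinner\<close> in its second
  argument: pairing \<open>b\<close> with this vector gives the value of a complex linear
  \<open>f\<close> at the compression of \<open>b\<close>.\<close>

definition hs_density :: "'a::complex_hilbert set \<Rightarrow> ('a bop \<Rightarrow>\<^sub>L complex) \<Rightarrow> 'a hs" where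
  "hs_density F f = (\<Sum>p\<in>F. \<Sum>q\<in>F. cnj (blinfun_apply f (p \<boxtimes> q)) *\<^sub>C tens p q)"

lemma hs_functional_density:
  assumes F: "is_ortho F" "finite F"
  shows "hs_functional F (hs_density F f) = compress F f"
proof -
  have "cnj (cinner (hs_density F f) (tens p q)) = blinfun_apply f (p \<boxtimes> q)" if "p \<in> F" "q \<in> F" for p q
  proof -
    have o: "cinner e e' = (if e = e' then 1 else 0)" if "e \<in> F" "e' \<in> F" for e e'
      using F that by (auto simp: is_ortho_def)
    have "cinner (hs_density F f) (tens p q)
        = (\<Sum>p'\<in>F. \<Sum>q'\<in>F. cnj (blinfun_apply f (p' \<boxtimes> q')) * (cinner q q' * cinner p' p))"
      unfolding hs_density_def cinner_sum_left cinner_scaleC_left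
      by (simp add: cinner_tens_right cinner_scaleC_left)
    also have "\<dots> = (\<Sum>p'\<in>F. \<Sum>q'\<in>F. if p' = p then (if q' = q then cnj (blinfun_apply f (p' \<boxtimes> q')) else 0) else 0)"
      using that by (intro sum.cong refl) (auto simp: o)
    also have "\<dots> = (\<Sum>p'\<in>F. if p' = p then cnj (blinfun_apply f (p' \<boxtimes> q)) else 0)"
      using F(2) that by (intro sum.cong refl) auto
    also have "\<dots> = cnj (blinfun_apply f (p \<boxtimes> q))" using F(2) that by simp
    finally show ?thesis by simp
  qed
  then show ?thesis unfolding hs_functional_def compress_def by (intro sum.cong refl) simp
qed

lemma cinner_hs_density:
  assumes "clinear (blinfun_apply f)"
  shows "cinner b (hs_density F f) = blinfun_apply f (cut F (hs_op b))"
  using assms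
  by (simp add: hs_density_def cut_eq cinner_sum_right cinner_scaleC_right cinner_tens_right
      clinear_functional_sum clinear_functional_iff mult.commute)

section \<open>From norm approximation to series of vector functionals\<close>

definition unit_functionals :: "('a::complex_hilbert bop \<Rightarrow>\<^sub>L complex) set" where
  "unit_functionals = {vec_functional x y |x y. norm x \<le> 1 \<and> norm y \<le> 1}"

lemma bounded_linear_image_closure_subset:
  fixes T :: "'a::real_normed_vector \<Rightarrow> 'b::real_normed_vector"
  assumes "bounded_linear T" "T ` S \<subseteq> M" "closed M"
  shows "T ` closure S \<subseteq> M"
  by (rule image_closure_subset[OF linear_continuous_on[OF assms(1)] assms(3,2)])

text \<open>
  The nuclear norm of a functional on a compression is its operator norm: otherwise a separating
  element of \<open>\<H>\<S>(H)\<close> would be an operator of norm at most \<open>c\<close> on which the functional exceeds \<open>c\<close>.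
\<close>

lemma compress_in_hull:
  assumes F: "is_ortho F" "finite F" and f: "clinear (blinfun_apply f)" "norm f \<le> 1"
  shows "compress F f \<in> closure (convex hull unit_functionals)"
proof -
  let ?S = "{tens x y |x y. norm x \<le> 1 \<and> norm y \<le> 1}"
  have "hs_density F f \<in> closure (convex hull ?S)"
  proof (rule ccontr)
    assume nin: "hs_density F f \<notin> closure (convex hull ?S)"
    have S: "?S \<subseteq> closure (convex hull ?S)" by (rule order_trans[OF hull_subset closure_subset])
    have "tens 0 0 \<in> ?S" by (rule CollectI, rule exI[of _ 0], rule exI[of _ 0]) simp
    from subsetD[OF S this] have ne: "closure (convex hull ?S) \<noteq> {}" by (rule ex_in_conv[THEN iffD1, OF exI])
    from separation_closed_convex[OF closed_closure convex_closure[OF convex_convex_hull] ne nin]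
    obtain b c where b: "\<And>s. s \<in> closure (convex hull ?S) \<Longrightarrow> inner b s \<le> c"
      and c: "c < inner b (hs_density F f)" by blast
    have bt: "Re (cinner (bop_apply (hs_op b) y) x) \<le> c" if "norm x \<le> 1" "norm y \<le> 1" for x y
    proof -
      have "tens x y \<in> ?S" using that by blast
      from b[OF subsetD[OF S this]] show ?thesis by (simp add: cinner_tens_right flip: Re_cinner)
    qed
    have c0: "0 \<le> c" using bt[of 0 0] by simp
    have "norm (hs_op b) \<le> c"
    proof (rule norm_bop_bound[OF c0])
      fix v
      let ?w = "bop_apply (hs_op b) v"
      show "norm ?w \<le> c * norm v"
      proof (cases "v = 0 \<or> ?w = 0")
        case True
        then show ?thesis using c0 by auto
      next
        case False
        let ?x = "(1 / norm ?w) *\<^sub>R ?w" and ?y = "(1 / norm v) *\<^sub>R v"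
        have "bop_apply (hs_op b) ?y = (1 / norm v) *\<^sub>R ?w"
          by (rule linear_scale[OF bounded_linear.linear[OF bounded_linear_bop]])
        then have "Re (cinner (bop_apply (hs_op b) ?y) ?x) = norm ?w / norm v"
          unfolding Re_cinner using False by (simp add: dot_square_norm power2_eq_square)
        moreover have "Re (cinner (bop_apply (hs_op b) ?y) ?x) \<le> c" by (rule bt) (use False in simp_all)
        ultimately show ?thesis using False by (simp add: divide_le_eq)
      qed
    qed
    then have "norm (cut F (hs_op b)) \<le> c" using norm_cut_le[OF F, of "hs_op b"] by linarith
    moreover have "norm (blinfun_apply f (cut F (hs_op b))) \<le> norm f * norm (cut F (hs_op b))"
      by (rule norm_blinfun)
    moreover have "norm f * norm (cut F (hs_op b)) \<le> 1 * norm (cut F (hs_op b))"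
      by (intro mult_right_mono f(2)) simp
    moreover have "inner b (hs_density F f) = Re (blinfun_apply f (cut F (hs_op b)))"
      by (simp flip: Re_cinner add: cinner_hs_density[OF f(1)])
    ultimately show False
      using c complex_Re_le_cmod[of "blinfun_apply f (cut F (hs_op b))"] by linarith
  qed
  moreover have "hs_functional F ` closure (convex hull ?S) \<subseteq> closure (convex hull unit_functionals)"
  proof (rule bounded_linear_image_closure_subset[OF bounded_linear_hs_functional _ closed_closure])
    have "hs_functional F ` ?S \<subseteq> unit_functionals"
    proof clarify
      fix x y :: 'a assume "norm x \<le> 1" "norm y \<le> 1"
      then have "norm (bop_apply (ortho_proj F) x) \<le> 1" "norm (bop_apply (ortho_proj F) y) \<le> 1"
        using norm_ortho_proj_apply[OF F, of x] norm_ortho_proj_apply[OF F, of y] by linarith+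
      then show "hs_functional F (tens x y) \<in> unit_functionals"
        unfolding hs_functional_tens unit_functionals_def
        by (intro CollectI exI[of _ "bop_apply (ortho_proj F) y"] exI[of _ "bop_apply (ortho_proj F) x"] conjI refl)
    qed
    then have "convex hull (hs_functional F ` ?S) \<subseteq> convex hull unit_functionals" by (rule hull_mono)
    then show "hs_functional F ` (convex hull ?S) \<subseteq> closure (convex hull unit_functionals)"
      unfolding convex_hull_linear_image[OF bounded_linear.linear[OF bounded_linear_hs_functional]]
      by (rule order_trans[OF _ closure_subset])
  qed
  ultimately have "hs_functional F (hs_density F f) \<in> closure (convex hull unit_functionals)" by blast
  then show ?thesis unfolding hs_functional_density[OF F] .
qed

lemma approximable_in_hull:
  assumes B: "is_onb B" and f: "f \<in> approximable B" "norm f \<le> 1"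
  shows "f \<in> closure (convex hull unit_functionals)"
proof (rule Lim_in_closed_set[OF closed_closure])
  show "\<forall>\<^sub>F F in finite_subsets_at_top B. compress F f \<in> closure (convex hull unit_functionals)"
    using eventually_finite_ortho[OF B]
    by eventually_elim (use f compress_in_hull in \<open>auto simp: approximable_def\<close>)
  show "((\<lambda>F. compress F f) \<longlongrightarrow> f) (finite_subsets_at_top B)" using f by (simp add: approximable_def)
qed simp

text \<open>Bounds add and scale linearly, so the functionals with bound 1 form a convex set and no
  constant is lost in the hull.\<close>

lemma hull_unit_functionals_l2_rep:
  assumes "d \<in> convex hull unit_functionals"
  shows "l2_rep 1 (blinfun_apply d)"
proof -
  have "convex hull unit_functionals \<subseteq> {d :: 'a bop \<Rightarrow>\<^sub>L complex. l2_rep 1 (blinfun_apply d)}"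
  proof (rule hull_minimal)
    show "unit_functionals \<subseteq> {d :: 'a bop \<Rightarrow>\<^sub>L complex. l2_rep 1 (blinfun_apply d)}"
    proof
      fix d :: "'a bop \<Rightarrow>\<^sub>L complex" assume "d \<in> unit_functionals"
      then obtain x y where d: "d = vec_functional x y" and xy: "norm x \<le> 1" "norm y \<le> 1"
        unfolding unit_functionals_def by blast
      have "max ((norm x)\<^sup>2) ((norm y)\<^sup>2) \<le> 1" using xy by (simp add: power_le_one)
      from l2_rep_mono[OF l2_rep_vec_functional this] show "d \<in> {d. l2_rep 1 (blinfun_apply d)}"
        by (simp add: d vec_functional_apply[abs_def])
    qed
    show "convex {d :: 'a bop \<Rightarrow>\<^sub>L complex. l2_rep 1 (blinfun_apply d)}"
    proof (rule convexI, unfold mem_Collect_eq)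
      fix d e :: "'a bop \<Rightarrow>\<^sub>L complex" and u v :: real
      assume *: "l2_rep 1 (blinfun_apply d)" "l2_rep 1 (blinfun_apply e)" "0 \<le> u" "0 \<le> v" "u + v = 1"
      have "l2_rep (u * 1 + v * 1) (\<lambda>A. of_real u * blinfun_apply d A + of_real v * blinfun_apply e A)"
        by (intro l2_rep_add l2_rep_scale *)
      moreover have "(\<lambda>A. of_real u * blinfun_apply d A + of_real v * blinfun_apply e A) = blinfun_apply (u *\<^sub>R d + v *\<^sub>R e)"
        by (simp add: fun_eq_iff plus_blinfun.rep_eq scaleR_blinfun.rep_eq scaleR_conv_of_real)
      ultimately show "l2_rep 1 (blinfun_apply (u *\<^sub>R d + v *\<^sub>R e))" using *(5) by simp
    qed
  qed
  then show ?thesis using assms by blast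
qed

text \<open>One round of successive approximation: an explicitly represented \<open>d\<close>, whose
  bound is as small as the current remainder, leaves a remainder of half the size. The remainder
  stays approximable, so the round can be repeated.\<close>

lemma approximable_step:
  assumes B: "is_onb B" and h: "h \<in> approximable B" "norm h \<le> (1/2) ^ n"
  shows "\<exists>d. l2_rep ((1/2) ^ n) (blinfun_apply d) \<and> h - d \<in> approximable B \<and> norm (h - d) \<le> (1/2) ^ Suc n"
proof -
  let ?r = "(1/2) ^ n :: real"
  have r: "0 < ?r" by simp
  have "norm ((1 / ?r) *\<^sub>R h) \<le> 1" using h(2) by (simp add: divide_le_eq)
  from approximable_in_hull[OF B approximable_scaleR[OF h(1)] this]
  obtain e where e: "e \<in> convex hull unit_functionals" "norm (e - (1 / ?r) *\<^sub>R h) < 1 / 2"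
    unfolding closure_approachable dist_norm using half_gt_zero[OF zero_less_one] by blast
  let ?d = "?r *\<^sub>R e"
  have "l2_rep (?r * 1) (\<lambda>A. of_real ?r * blinfun_apply e A)"
    by (intro l2_rep_scale hull_unit_functionals_l2_rep e(1)) simp
  moreover have "(\<lambda>A. of_real ?r * blinfun_apply e A) = blinfun_apply ?d"
    by (simp add: fun_eq_iff scaleR_blinfun.rep_eq scaleR_conv_of_real)
  ultimately have d: "l2_rep ?r (blinfun_apply ?d)" by simp
  moreover have "h - ?d \<in> approximable B" by (rule approximable_diff[OF h(1) l2_rep_approximable[OF B d]])
  moreover have "norm (h - ?d) \<le> (1/2) ^ Suc n"
  proof -
    have "?d - h = ?r *\<^sub>R (e - (1 / ?r) *\<^sub>R h)" by (simp add: scaleR_diff_right)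
    then have "norm (h - ?d) = ?r * norm (e - (1 / ?r) *\<^sub>R h)"
      unfolding norm_minus_commute[of h] by (simp only: norm_scaleR abs_of_pos[OF r])
    also have "\<dots> \<le> ?r * (1 / 2)" using e(2) r by (intro mult_left_mono) auto
    finally show ?thesis by simp
  qed
  ultimately show ?thesis by blast
qed

text \<open>\<open>H\<close> is the sequence of remainders. Its successive differences telescope to
  the normalized functional, and their bounds form a geometric series, so \<open>l2_rep_sums\<close>
  merges their representations.\<close>

lemma approximable_l2_rep:
  assumes B: "is_onb B" and f: "f \<in> approximable B"
  shows "\<exists>r. l2_rep r (blinfun_apply f)"
proof -
  define c where "c = norm f + 1"
  have c: "0 < c" by (simp add: c_def add_nonneg_pos)
  let ?h = "(1 / c) *\<^sub>R f"
  have h1: "?h \<in> approximable B" "norm ?h \<le> (1/2) ^ 0"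
    using approximable_scaleR[OF f] c by (simp_all add: c_def)
  \<comment> \<open>The clause for \<open>n = 0\<close> pins the start of the sequence, because the
    choice principle yields only some sequence with the required steps.\<close>
  let ?P = "\<lambda>n h. (n = 0 \<longrightarrow> h = ?h) \<and> h \<in> approximable B \<and> norm h \<le> (1/2) ^ n"
  let ?Q = "\<lambda>n h h'. l2_rep ((1/2) ^ n) (blinfun_apply (h - h'))"
  have "\<exists>H. \<forall>n. ?P n (H n) \<and> ?Q n (H n) (H (Suc n))"
  proof (rule dependent_nat_choice)
    show "\<exists>h. ?P 0 h" using h1 by (intro exI[of _ ?h]) simp
    fix h n assume "?P n h"
    then obtain d where d: "l2_rep ((1/2) ^ n) (blinfun_apply d)" "h - d \<in> approximable B" "norm (h - d) \<le> (1/2) ^ Suc n"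
      using approximable_step[OF B, of h n] by blast
    then show "\<exists>h'. ?P (Suc n) h' \<and> ?Q n h h'" by (intro exI[of _ "h - d"]) simp
  qed
  then obtain H where H: "\<And>n. ?P n (H n)" "\<And>n. ?Q n (H n) (H (Suc n))" by blast
  have "H \<longlonglongrightarrow> 0"
  proof (rule Lim_null_comparison)
    show "\<forall>\<^sub>F n in sequentially. norm (H n) \<le> (1/2) ^ n" using H(1) by simp
    show "(\<lambda>n. (1/2) ^ n :: real) \<longlonglongrightarrow> 0" by (rule LIMSEQ_realpow_zero) simp_all
  qed
  from telescope_sums'[OF this] have "(\<lambda>n. H n - H (Suc n)) sums ?h" using H(1)[of 0] by simp
  from bounded_linear.sums[OF blinfun.bounded_linear_left this]
  have "(\<lambda>n. blinfun_apply (H n - H (Suc n)) A) sums blinfun_apply ?h A" for A .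
  moreover have "summable (\<lambda>n. (1/2) ^ n :: real)" by (rule summable_geometric) simp
  ultimately have "l2_rep (\<Sum>n. (1/2) ^ n) (blinfun_apply ?h)" using H(2) by (intro l2_rep_sums)
  from l2_rep_scale[OF this, of c] c
  have "l2_rep (c * (\<Sum>n. (1/2) ^ n)) (\<lambda>A. of_real c * blinfun_apply ?h A)" by simp
  moreover have "(\<lambda>A. of_real c * blinfun_apply ?h A) = blinfun_apply f"
    using c by (simp add: fun_eq_iff scaleR_blinfun.rep_eq scaleR_conv_of_real)
  ultimately show ?thesis by auto
qed

lemma predual_eq_approximable: "is_onb B \<Longrightarrow> predual = approximable B"
  using approximable_l2_rep l2_rep_approximable predual_iff by blast

lemma predual_limit:
  fixes f :: "'b \<Rightarrow> 'a::complex_hilbert bop \<Rightarrow>\<^sub>L complex"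
  assumes "\<And>F. f F \<in> predual" "(f \<longlongrightarrow> g) \<F>" "\<F> \<noteq> bot"
  shows "g \<in> predual"
proof -
  have c: "closed (predual :: ('a bop \<Rightarrow>\<^sub>L complex) set)"
    unfolding closed_sequential_limits predual_eq_approximable[OF is_onb_onb]
    by (intro allI impI, elim conjE) (rule approximable_limit[OF is_onb_onb], blast+)
  show ?thesis by (rule Lim_in_closed_set[OF c _ assms(3,2)]) (simp add: assms(1))
qed

section \<open>Slices and the extension to the commutant\<close>

text \<open>\<open>slice v' v A = V\<^sub>v\<^sub>'\<^sup>* A V\<^sub>v\<close> for the isometric-up-to-scale maps \<open>V\<^sub>v u = u \<boxtimes> v\<close> from \<open>K\<close> to \<open>H\<close>.\<close>

definition slice :: "'a::complex_hilbert \<Rightarrow> 'a \<Rightarrow> 'a hs bop \<Rightarrow> 'a bop" where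
  "slice v' v A = Bop (\<lambda>u. bop_apply (hs_op (bop_apply A (tens u v))) v')"

lemma slice_apply: "bop_apply (slice v' v A) u = bop_apply (hs_op (bop_apply A (tens u v))) v'"
proof -
  let ?f = "\<lambda>u. bop_apply (hs_op (bop_apply A (tens u v))) v'"
  have "norm (?f u) \<le> norm u * (norm A * norm v * norm v')" for u
  proof -
    have "norm (?f u) \<le> norm (hs_op (bop_apply A (tens u v))) * norm v'" by (rule norm_bop_apply)
    also have "\<dots> \<le> norm (bop_apply A (tens u v)) * norm v'" by (intro mult_right_mono norm_hs_op_le) simp
    also have "\<dots> \<le> norm A * norm (tens u v) * norm v'" by (intro mult_right_mono norm_bop_apply) simp
    finally show ?thesis by (simp add: norm_tens mult_ac)
  qed
  then have "bounded_linear ?f"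
    by (intro bounded_linear_intro)
      (simp_all add: tens_add_left bop_add_right scaleR_scaleC tens_scaleC_left bop_scaleC_right)
  moreover have "clinear ?f"
    by (simp add: clinear_iff tens_add_left bop_add_right tens_scaleC_left bop_scaleC_right)
  ultimately show ?thesis by (simp add: slice_def Bop_inverse)
qed

lemma cinner_slice: "cinner (bop_apply (slice v' v A) u) u' = cinner (bop_apply A (tens u v)) (tens u' v')"
  by (simp add: slice_apply cinner_tens_right)

lemma slice_rmult_lmult: "slice v' v (rmult y \<odot> lmult a) = cinner (bop_apply y v') v *\<^sub>C a"
  by (rule bop_eqI) (simp add: slice_apply rmult_hs.rep_eq lmult_hs.rep_eq bop_scaleC_right)

lemma slice_rank_one: "slice v' v (x \<boxtimes> y) = bop_apply (hs_op x) v' \<boxtimes> bop_apply (hs_op y) v"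
  by (rule bop_eqI) (simp add: slice_apply rank_one_apply cinner_tens_left)

lemma l2_rep_slice:
  assumes \<phi>: "clinear \<phi>" "normal_map \<phi>"
  shows "\<exists>r. l2_rep r (\<lambda>A. cinner (bop_apply (\<phi> (slice v' v A)) u) u')"
proof -
  have "\<exists>s. l2_rep s (\<lambda>a. cinner (bop_apply (\<phi> a) u) u')"
    using \<phi>(2) l2_rep_vec_functional[of u u'] unfolding normal_map_iff[OF \<phi>(1)] by blast
  then obtain x y where x: "summable (\<lambda>n. (norm (x n))\<^sup>2)" and y: "summable (\<lambda>n. (norm (y n))\<^sup>2)"
    and f: "\<And>a. cinner (bop_apply (\<phi> a) u) u' = (\<Sum>n. cinner (bop_apply a (x n)) (y n))"
    unfolding l2_rep_def by blast
  have s: "summable (\<lambda>n. (norm (tens (z n) w))\<^sup>2)" if "summable (\<lambda>n. (norm (z n))\<^sup>2)" for z :: "nat \<Rightarrow> 'a" and w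
    unfolding norm_tens power_mult_distrib by (rule summable_mult2[OF that])
  show ?thesis
    by (rule l2_repI[OF s[OF x, of v] s[OF y, of v']]) (simp add: f cinner_slice)
qed

section \<open>Matrix norms and matrices of slices\<close>

lemma mat_norm_bdd:
  "bdd_above ((\<lambda>v :: nat \<Rightarrow> 'a::complex_hilbert. sqrt (\<Sum>i<n. (norm (\<Sum>j<n. bop_apply (X i j) (v j)))\<^sup>2))
     ` {v. (\<Sum>j<n. (norm (v j))\<^sup>2) \<le> 1})"
proof (rule bdd_aboveI2)
  fix v :: "nat \<Rightarrow> 'a" assume "v \<in> {v. (\<Sum>j<n. (norm (v j))\<^sup>2) \<le> 1}"
  then have v: "(\<Sum>j<n. (norm (v j))\<^sup>2) \<le> 1" by simp
  have v1: "norm (v j) \<le> 1" if "j < n" for j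
  proof -
    have "(norm (v j))\<^sup>2 \<le> (\<Sum>j<n. (norm (v j))\<^sup>2)" by (rule member_le_sum) (use that in auto)
    then have "(norm (v j))\<^sup>2 \<le> 1\<^sup>2" using v by simp
    then show ?thesis by (rule power2_le_imp_le) simp
  qed
  have "norm (\<Sum>j<n. bop_apply (X i j) (v j)) \<le> (\<Sum>j<n. norm (X i j))" for i
  proof (rule sum_norm_le)
    fix j assume "j \<in> {..<n}"
    then have "norm (X i j) * norm (v j) \<le> norm (X i j) * 1" by (intro mult_left_mono v1) auto
    then show "norm (bop_apply (X i j) (v j)) \<le> norm (X i j)" using norm_bop_apply[of "X i j" "v j"] by simp
  qed
  then show "sqrt (\<Sum>i<n. (norm (\<Sum>j<n. bop_apply (X i j) (v j)))\<^sup>2) \<le> sqrt (\<Sum>i<n. (\<Sum>j<n. norm (X i j))\<^sup>2)"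
    by (intro real_sqrt_le_mono sum_mono power_mono) auto
qed

lemma mat_norm_nonneg: "0 \<le> mat_norm n X"
proof -
  have "sqrt (\<Sum>i<n. (norm (\<Sum>j<n. bop_apply (X i j) ((\<lambda>_. 0) j)))\<^sup>2) \<le> mat_norm n X"
    unfolding mat_norm_def by (rule cSUP_upper[OF _ mat_norm_bdd]) simp
  then show ?thesis by simp
qed

lemma mat_norm_bound:
  "sqrt (\<Sum>i<n. (norm (\<Sum>j<n. bop_apply (X i j) (v j)))\<^sup>2) \<le> mat_norm n X * sqrt (\<Sum>j<n. (norm (v j))\<^sup>2)"
proof (cases "(\<Sum>j<n. (norm (v j))\<^sup>2) = 0")
  case True
  then have "\<forall>j\<in>{..<n}. (norm (v j))\<^sup>2 = 0" by (subst (asm) sum_nonneg_eq_0_iff) auto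
  then have "(\<Sum>j<n. bop_apply (X i j) (v j)) = 0" for i by (intro sum.neutral) auto
  then show ?thesis using True by simp
next
  case False
  define s where "s = sqrt (\<Sum>j<n. (norm (v j))\<^sup>2)"
  have "0 \<le> (\<Sum>j<n. (norm (v j))\<^sup>2)" by (intro sum_nonneg) simp
  then have s: "0 < s" "s\<^sup>2 = (\<Sum>j<n. (norm (v j))\<^sup>2)" using False by (simp_all add: s_def)
  define w where "w j = (1 / s) *\<^sub>R v j" for j
  have "(\<Sum>j<n. (norm (w j))\<^sup>2) = (1 / s)\<^sup>2 * (\<Sum>j<n. (norm (v j))\<^sup>2)"
    unfolding sum_distrib_left by (intro sum.cong refl) (simp add: w_def power_mult_distrib power_divide)
  also have "\<dots> \<le> 1" unfolding s(2)[symmetric] using s(1) by (simp add: power_divide)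
  finally have "sqrt (\<Sum>i<n. (norm (\<Sum>j<n. bop_apply (X i j) (w j)))\<^sup>2) \<le> mat_norm n X"
    unfolding mat_norm_def by (intro cSUP_upper mat_norm_bdd) simp
  moreover have "norm (\<Sum>j<n. bop_apply (X i j) (w j)) = (1 / s) * norm (\<Sum>j<n. bop_apply (X i j) (v j))" for i
  proof -
    have "(\<Sum>j<n. bop_apply (X i j) (w j)) = (1 / s) *\<^sub>R (\<Sum>j<n. bop_apply (X i j) (v j))"
      by (simp add: w_def linear_scale[OF bounded_linear.linear[OF bounded_linear_bop]] scaleR_sum_right)
    then show ?thesis using s(1) by simp
  qed
  moreover have "sqrt (\<Sum>i<n. ((1 / s) * norm (\<Sum>j<n. bop_apply (X i j) (v j)))\<^sup>2)
      = (1 / s) * sqrt (\<Sum>i<n. (norm (\<Sum>j<n. bop_apply (X i j) (v j)))\<^sup>2)"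
    unfolding power_mult_distrib sum_distrib_left[symmetric] real_sqrt_mult using s(1) by simp
  ultimately show ?thesis using s(1) by (simp add: s_def[symmetric] divide_le_eq)
qed

lemma mat_norm_least:
  assumes "\<And>v. (\<Sum>j<n. (norm (v j))\<^sup>2) \<le> 1 \<Longrightarrow> sqrt (\<Sum>i<n. (norm (\<Sum>j<n. bop_apply (X i j) (v j)))\<^sup>2) \<le> M"
  shows "mat_norm n X \<le> M"
  unfolding mat_norm_def
proof (rule cSUP_least)
  show "{v :: nat \<Rightarrow> 'a. (\<Sum>j<n. (norm (v j))\<^sup>2) \<le> 1} \<noteq> {}"
    by (rule ex_in_conv[THEN iffD1, OF exI[of _ "\<lambda>_. 0"]]) simp
qed (simp add: assms)

lemma cinner_sum_le:
  fixes u w :: "'i \<Rightarrow> 'a::complex_hilbert"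
  shows "cmod (\<Sum>i\<in>I. cinner (u i) (w i)) \<le> sqrt (\<Sum>i\<in>I. (norm (u i))\<^sup>2) * sqrt (\<Sum>i\<in>I. (norm (w i))\<^sup>2)"
proof -
  have "cmod (\<Sum>i\<in>I. cinner (u i) (w i)) \<le> (\<Sum>i\<in>I. \<bar>norm (u i)\<bar> * \<bar>norm (w i)\<bar>)"
    by (rule sum_norm_le) (simp add: cmod_cinner_le)
  also have "\<dots> \<le> L2_set (\<lambda>i. norm (u i)) I * L2_set (\<lambda>i. norm (w i)) I" by (rule L2_set_mult_ineq)
  finally show ?thesis by (simp add: L2_set_def)
qed

text \<open>An orthonormal family embeds \<open>n\<close> copies of K isometrically into H.\<close>

lemma norm_sum_tens:
  fixes n :: nat
  assumes o: "\<And>i j. i < n \<Longrightarrow> j < n \<Longrightarrow> cinner (e i) (e j) = (if i = j then 1 else 0)"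
  shows "(norm (\<Sum>j<n. tens (v j) (e j)))\<^sup>2 = (\<Sum>j<n. (norm (v j))\<^sup>2)"
proof -
  let ?x = "\<Sum>j<n. tens (v j) (e j)"
  have "bop_apply (hs_op ?x) (e i) = v i" if "i < n" for i
  proof -
    have "bop_apply (hs_op ?x) (e i) = (\<Sum>j<n. if i = j then v j else 0)"
      unfolding hs_op_sum bop_sum_left tens_apply by (intro sum.cong refl) (use o that in auto)
    then show ?thesis using that by simp
  qed
  then have "cinner ?x ?x = (\<Sum>j<n. cinner (v j) (v j))"
    unfolding cinner_sum_right cinner_tens_right by (intro sum.cong refl) simp
  also have "\<dots> = complex_of_real (\<Sum>j<n. (norm (v j))\<^sup>2)" by (simp add: cinner_self)
  finally show ?thesis unfolding cinner_self of_real_eq_iff .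
qed

lemma cinner_onb: "e \<in> onb \<Longrightarrow> f \<in> onb \<Longrightarrow> cinner e f = (if e = f then 1 else 0)"
  for e f :: "'a::complex_hilbert"
  using is_onb_onb[where 'a = 'a] by (simp add: is_onb_def is_ortho_def)

text \<open>The matrix of slices is the compression of \<open>A\<close> to the copy of K^n in H
  given by the vectors \<open>e i\<close>, so its norm cannot exceed that of
  \<open>A\<close>.\<close>

lemma mat_norm_slice:
  assumes e: "inj_on e {..<n}" "e ` {..<n} \<subseteq> onb"
  shows "mat_norm n (\<lambda>i j. slice (e i) (e j) A) \<le> norm A"
proof (rule mat_norm_least)
  fix v :: "nat \<Rightarrow> 'a" assume v: "(\<Sum>j<n. (norm (v j))\<^sup>2) \<le> 1"
  have o: "cinner (e i) (e j) = (if i = j then 1 else 0)" if "i < n" "j < n" for i j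
  proof -
    have "e i \<in> onb" "e j \<in> onb" using e(2) that by auto
    moreover have "e i = e j \<longleftrightarrow> i = j" using e(1) that by (simp add: inj_on_eq_iff)
    ultimately show ?thesis by (simp add: cinner_onb)
  qed
  let ?x = "\<Sum>j<n. tens (v j) (e j)"
  have x1: "norm ?x \<le> 1"
    by (rule power2_le_imp_le) (use v norm_sum_tens[of n e v] o in simp_all)
  have "(\<Sum>i<n. (norm (\<Sum>j<n. bop_apply (slice (e i) (e j) A) (v j)))\<^sup>2)
      = (\<Sum>i<n. (norm (bop_apply (hs_op (bop_apply A ?x)) (e i)))\<^sup>2)"
    by (simp add: slice_apply bop_sum_right hs_op_sum bop_sum_left)
  also have "\<dots> = (\<Sum>f\<in>e ` {..<n}. (norm (bop_apply (hs_op (bop_apply A ?x)) f))\<^sup>2)"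
    by (simp add: sum.reindex[OF e(1)])
  also have "\<dots> \<le> (norm (bop_apply A ?x))\<^sup>2"
    by (rule finite_sum_le_has_sum[OF norm_hs_has_sum(1)]) (use e in auto)
  finally have "sqrt (\<Sum>i<n. (norm (\<Sum>j<n. bop_apply (slice (e i) (e j) A) (v j)))\<^sup>2) \<le> norm (bop_apply A ?x)"
    by (rule real_le_lsqrt[rotated]) simp
  also have "\<dots> \<le> norm A * norm ?x" by (rule norm_bop_apply)
  also have "\<dots> \<le> norm A * 1" by (intro mult_left_mono x1) simp
  finally show "sqrt (\<Sum>i<n. (norm (\<Sum>j<n. bop_apply (slice (e i) (e j) A) (v j)))\<^sup>2) \<le> norm A" by simp
qed

text \<open>The matrix coefficient (\<Phi>(A) x | y) of the extension \<Phi> to be constructed,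
  truncated to \<open>F\<close>: H is decomposed along the basis, \<open>slice e f A\<close> is the
  block of \<open>A\<close> at (e, f), and \<phi> is applied to each block.\<close>

definition ext_form :: "('a::complex_hilbert bop \<Rightarrow> 'a bop) \<Rightarrow> 'a set \<Rightarrow> 'a hs \<Rightarrow> 'a hs \<Rightarrow> 'a hs bop \<Rightarrow> complex" where
  "ext_form \<phi> F x y A =
     (\<Sum>e\<in>F. \<Sum>f\<in>F. cinner (bop_apply (\<phi> (slice e f A)) (bop_apply (hs_op x) f)) (bop_apply (hs_op y) e))"

lemma ext_form_l2_rep:
  assumes "clinear \<phi>" "normal_map \<phi>"
  shows "\<exists>r. l2_rep r (ext_form \<phi> F x y)"
  unfolding ext_form_def[abs_def] by (intro l2_rep_sum l2_rep_slice assms)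

text \<open>Complete boundedness enters here. The map is applied to matrices whose size is the
  cardinality of \<open>F\<close>, and the constant has to be the same for all
  \<open>F\<close>.\<close>

lemma ext_form_bound:
  assumes "completely_bounded \<phi>"
  shows "\<exists>C\<ge>0. \<forall>F x y A. finite F \<and> F \<subseteq> onb \<longrightarrow> cmod (ext_form \<phi> F x y A) \<le> C * norm x * norm y * norm A"
proof -
  from assms obtain C0 where "\<forall>n X. mat_norm n (\<lambda>i j. \<phi> (X i j)) \<le> C0 * mat_norm n X"
    unfolding completely_bounded_def ..
  then have C0: "mat_norm n (\<lambda>i j. \<phi> (X i j)) \<le> C0 * mat_norm n X" for n X by (elim allE)
  define C where "C = max C0 0"
  have C: "0 \<le> C" "C0 \<le> C" by (simp_all add: C_def)
  have "cmod (ext_form \<phi> F x y A) \<le> C * norm x * norm y * norm A" if F: "finite F" "F \<subseteq> onb" for F x y A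
  proof -
    define n where "n = card F"
    obtain e where e: "bij_betw e {..<n} F"
      using ex_bij_betw_nat_finite[OF F(1)] by (auto simp: atLeast0LessThan n_def)
    let ?n = n
    have inj: "inj_on e {..<?n}" and im: "e ` {..<?n} = F" using e by (simp_all add: bij_betw_def)
    let ?S = "\<lambda>i j. slice (e i) (e j) A"
    let ?u = "\<lambda>z i. bop_apply (hs_op z) (e i)"
    have "C0 * mat_norm ?n ?S \<le> C * norm A"
      using mat_norm_slice[of e ?n A] mat_norm_nonneg[of ?n ?S] inj im F(2) C by (intro mult_mono) auto
    then have M: "mat_norm ?n (\<lambda>i j. \<phi> (?S i j)) \<le> C * norm A" using C0[of ?n ?S] by linarith
    have z: "sqrt (\<Sum>i<?n. (norm (?u z i))\<^sup>2) \<le> norm z" for z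
    proof (rule real_le_lsqrt)
      have "(\<Sum>i<?n. (norm (?u z i))\<^sup>2) = (\<Sum>f\<in>F. (norm (bop_apply (hs_op z) f))\<^sup>2)"
        unfolding im[symmetric] by (simp add: sum.reindex[OF inj])
      also have "\<dots> \<le> (norm z)\<^sup>2" by (rule finite_sum_le_has_sum[OF norm_hs_has_sum(1)]) (use F in auto)
      finally show "(\<Sum>i<?n. (norm (?u z i))\<^sup>2) \<le> (norm z)\<^sup>2" .
    qed simp
    have "ext_form \<phi> F x y A = (\<Sum>i<?n. \<Sum>j<?n. cinner (bop_apply (\<phi> (?S i j)) (?u x j)) (?u y i))"
      unfolding ext_form_def im[symmetric] by (simp add: sum.reindex[OF inj])
    also have "\<dots> = (\<Sum>i<?n. cinner (\<Sum>j<?n. bop_apply (\<phi> (?S i j)) (?u x j)) (?u y i))"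
      by (simp add: cinner_sum_left)
    also have "cmod \<dots> \<le> sqrt (\<Sum>i<?n. (norm (\<Sum>j<?n. bop_apply (\<phi> (?S i j)) (?u x j)))\<^sup>2)
        * sqrt (\<Sum>i<?n. (norm (?u y i))\<^sup>2)" by (rule cinner_sum_le)
    also have "\<dots> \<le> (mat_norm ?n (\<lambda>i j. \<phi> (?S i j)) * sqrt (\<Sum>j<?n. (norm (?u x j))\<^sup>2))
        * sqrt (\<Sum>i<?n. (norm (?u y i))\<^sup>2)"
      by (intro mult_right_mono mat_norm_bound) (simp add: sum_nonneg)
    also have "\<dots> \<le> ((C * norm A) * norm x) * norm y"
      by (intro mult_mono M z mult_nonneg_nonneg C) (simp_all add: sum_nonneg)
    finally show ?thesis by (simp add: mult_ac)
  qed
  then show ?thesis by (intro exI[of _ C] conjI allI impI C(1)) (elim conjE)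
qed

lemma ext_form_add_left: "ext_form \<phi> F (x + x') y A = ext_form \<phi> F x y A + ext_form \<phi> F x' y A"
  and ext_form_add_right: "ext_form \<phi> F x (y + y') A = ext_form \<phi> F x y A + ext_form \<phi> F x y' A"
  and ext_form_scaleC_left: "ext_form \<phi> F (c *\<^sub>C x) y A = c * ext_form \<phi> F x y A"
  and ext_form_scaleC_right: "ext_form \<phi> F x (c *\<^sub>C y) A = cnj c * ext_form \<phi> F x y A"
  by (simp_all add: ext_form_def bop_add_right cinner_add_left cinner_add_right sum.distrib bop_scaleC_right
      cinner_scaleC_left cinner_scaleC_right sum_distrib_left)

lemma ext_form_diff_left: "ext_form \<phi> F (x - x') y A = ext_form \<phi> F x y A - ext_form \<phi> F x' y A"
  using ext_form_add_left[of \<phi> F "x - x'" x' y A] by simp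

lemma ext_form_diff_right: "ext_form \<phi> F x (y - y') A = ext_form \<phi> F x y A - ext_form \<phi> F x y' A"
  using ext_form_add_right[of \<phi> F x "y - y'" y' A] by simp

section \<open>Truncation of Hilbert-Schmidt vectors and passage to the limit\<close>

definition restr :: "'a::complex_hilbert set \<Rightarrow> 'a hs \<Rightarrow> 'a hs" where
  "restr F x = (\<Sum>e\<in>F. tens (bop_apply (hs_op x) e) e)"

lemma restr_apply:
  assumes "finite F" "F \<subseteq> onb" "e \<in> onb"
  shows "bop_apply (hs_op (restr F x)) e = (if e \<in> F then bop_apply (hs_op x) e else 0)"
proof -
  have "bop_apply (hs_op (restr F x)) e = (\<Sum>f\<in>F. if e = f then bop_apply (hs_op x) f else 0)"
    unfolding restr_def hs_op_sum bop_sum_left tens_apply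
    by (intro sum.cong refl) (use assms in \<open>auto simp: cinner_onb subset_iff\<close>)
  then show ?thesis using assms(1) by simp
qed

lemma norm_diff_restr:
  assumes F: "finite F" "F \<subseteq> onb"
  shows "(norm (x - restr F x))\<^sup>2 = (norm x)\<^sup>2 - (\<Sum>e\<in>F. (norm (bop_apply (hs_op x) e))\<^sup>2)"
    and "norm (restr F x) \<le> norm x"
proof -
  let ?S = "\<Sum>e\<in>F. (norm (bop_apply (hs_op x) e))\<^sup>2"
  have "cinner x (restr F x) = complex_of_real ?S"
    by (simp add: restr_def cinner_sum_right cinner_tens_right cinner_self)
  then have 1: "inner x (restr F x) = ?S" by (simp flip: Re_cinner)
  have "cinner (restr F x) (restr F x) = (\<Sum>e\<in>F. cinner (bop_apply (hs_op (restr F x)) e) (bop_apply (hs_op x) e))"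
    by (subst (2) restr_def) (simp add: cinner_sum_right cinner_tens_right)
  also have "\<dots> = (\<Sum>e\<in>F. cinner (bop_apply (hs_op x) e) (bop_apply (hs_op x) e))"
    using F by (intro sum.cong refl) (auto simp: restr_apply[OF F] subset_iff)
  also have "\<dots> = complex_of_real ?S" by (simp add: cinner_self)
  finally have 2: "inner (restr F x) (restr F x) = ?S" by (simp flip: Re_cinner)
  show "(norm (x - restr F x))\<^sup>2 = (norm x)\<^sup>2 - ?S"
    unfolding power2_norm_eq_inner[of x] power2_norm_eq_inner[of "x - restr F x"] using 1 2 by (simp add: inner_diff_left inner_diff_right inner_commute)
  show "norm (restr F x) \<le> norm x"
  proof (rule power2_le_imp_le)
    show "(norm (restr F x))\<^sup>2 \<le> (norm x)\<^sup>2"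
      unfolding power2_norm_eq_inner[of "restr F x"] 2
      by (rule finite_sum_le_has_sum[OF norm_hs_has_sum(1)]) (use F in auto)
  qed simp
qed

lemma restr_tendsto: "((\<lambda>F. norm (x - restr F x)) \<longlongrightarrow> 0) (finite_subsets_at_top onb)"
proof -
  have "((\<lambda>F. \<Sum>e\<in>F. (norm (bop_apply (hs_op x) e))\<^sup>2) \<longlongrightarrow> (norm x)\<^sup>2) (finite_subsets_at_top onb)"
    using norm_hs_has_sum(1)[of x] unfolding has_sum_def .
  then have "((\<lambda>F. sqrt ((norm x)\<^sup>2 - (\<Sum>e\<in>F. (norm (bop_apply (hs_op x) e))\<^sup>2))) \<longlongrightarrow> sqrt ((norm x)\<^sup>2 - (norm x)\<^sup>2))
      (finite_subsets_at_top onb)" by (intro tendsto_intros)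
  moreover have "\<forall>\<^sub>F F in finite_subsets_at_top onb.
      sqrt ((norm x)\<^sup>2 - (\<Sum>e\<in>F. (norm (bop_apply (hs_op x) e))\<^sup>2)) = norm (x - restr F x)"
    by (rule eventually_finite_subsets_at_top_weakI) (simp flip: norm_diff_restr(1))
  ultimately show ?thesis by (simp add: tendsto_cong)
qed

text \<open>Since \<open>restr F x\<close> is \<open>x\<close> composed with the projection onto the
  span of \<open>F\<close>, a smaller index set can be traded for truncated arguments. The forms for
  two nested sets are then compared over the larger one, where bilinearity and the uniform bound are
  available.\<close>

lemma ext_form_restr:
  assumes G: "finite G" "G \<subseteq> onb" and F: "F \<subseteq> G"
  shows "ext_form \<phi> G (restr F x) (restr F y) A = ext_form \<phi> F x y A"
proof -
  have F': "finite F" "F \<subseteq> onb" using G F finite_subset by auto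
  have r: "bop_apply (hs_op (restr F z)) e = (if e \<in> F then bop_apply (hs_op z) e else 0)" if "e \<in> G" for e z
    using restr_apply[OF F', of e z] that G by auto
  have "ext_form \<phi> G (restr F x) (restr F y) A = (\<Sum>e\<in>G. \<Sum>f\<in>F.
      cinner (bop_apply (\<phi> (slice e f A)) (bop_apply (hs_op (restr F x)) f)) (bop_apply (hs_op (restr F y)) e))"
    unfolding ext_form_def by (intro sum.cong refl sum.mono_neutral_right G F) (use r in auto)
  also have "\<dots> = (\<Sum>e\<in>F. \<Sum>f\<in>F.
      cinner (bop_apply (\<phi> (slice e f A)) (bop_apply (hs_op (restr F x)) f)) (bop_apply (hs_op (restr F y)) e))"
    by (intro sum.mono_neutral_right G F) (use r in auto)
  also have "\<dots> = ext_form \<phi> F x y A"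
    unfolding ext_form_def by (intro sum.cong refl) (use r F in \<open>auto simp: subset_iff\<close>)
  finally show ?thesis .
qed

lemma tendsto_finite_subsets_Cauchy:
  fixes f :: "'a set \<Rightarrow> 'b::complete_space"
  assumes "\<And>\<epsilon>. 0 < \<epsilon> \<Longrightarrow> \<exists>F0. finite F0 \<and> F0 \<subseteq> B \<and> (\<forall>F. finite F \<and> F0 \<subseteq> F \<and> F \<subseteq> B \<longrightarrow> dist (f F) (f F0) < \<epsilon>)"
  shows "\<exists>L. (f \<longlongrightarrow> L) (finite_subsets_at_top B)"
proof -
  have "\<exists>P. eventually P (finite_subsets_at_top B) \<and> (\<forall>F F'. P F \<and> P F' \<longrightarrow> dist (f F) (f F') < \<epsilon>)"
    if "0 < \<epsilon>" for \<epsilon>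
  proof -
    obtain F0 where F0: "finite F0" "F0 \<subseteq> B" "\<And>F. finite F \<Longrightarrow> F0 \<subseteq> F \<Longrightarrow> F \<subseteq> B \<Longrightarrow> dist (f F) (f F0) < \<epsilon> / 2"
      using assms[of "\<epsilon> / 2"] \<open>0 < \<epsilon>\<close> by auto
    define P where "P F \<longleftrightarrow> finite F \<and> F0 \<subseteq> F \<and> F \<subseteq> B" for F
    have "eventually P (finite_subsets_at_top B)"
      unfolding eventually_finite_subsets_at_top P_def using F0(1,2) by blast
    moreover have "dist (f F) (f F') < \<epsilon>" if "P F" "P F'" for F F'
      by (rule dist_triangle_half_l[of _ "f F0"]) (use F0(3) that in \<open>auto simp: P_def\<close>)
    ultimately show ?thesis by blast
  qed
  then have "cauchy_filter (filtermap f (finite_subsets_at_top B))"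
    by (simp add: cauchy_filter_metric_filtermap)
  moreover have "complete (UNIV :: 'b set)"
    by (meson Cauchy_convergent UNIV_I complete_def convergent_def)
  ultimately obtain L where "(f \<longlongrightarrow> L) (finite_subsets_at_top B)"
    using complete_uniform[where S = UNIV] by (force simp add: filterlim_def)
  then show ?thesis by blast
qed

lemma l2_rep_bounded_linear:
  assumes "\<exists>r. l2_rep r f" shows "bounded_linear f"
proof -
  obtain x y where "f = blinfun_apply (\<Sum>n. vec_functional (x n) (y n))"
    using assms l2_rep_blinfun[of _ f] by blast
  then show ?thesis by (simp add: blinfun.bounded_linear_right)
qed

text \<open>Convergence is needed in the norm of functionals, uniformly for \<open>A\<close> in the
  unit ball, because \<open>predual_limit\<close> is about norm limits.\<close>

lemma ext_form_limit:
  assumes \<phi>: "\<phi> \<in> normal_cb"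
  shows "\<exists>L. \<forall>x y. ((\<lambda>F. Blinfun (ext_form \<phi> F x y)) \<longlongrightarrow> L x y) (finite_subsets_at_top onb)"
proof -
  have lin: "clinear \<phi>" "normal_map \<phi>" and cb: "completely_bounded \<phi>" using \<phi> by (auto simp: normal_cb_def)
  from ext_form_bound[OF cb] obtain C where C: "0 \<le> C"
    and bd': "\<forall>F x y A. finite F \<and> F \<subseteq> onb \<longrightarrow> cmod (ext_form \<phi> F x y A) \<le> C * norm x * norm y * norm A"
    by (elim exE conjE)
  have bd: "cmod (ext_form \<phi> F x y A) \<le> C * norm x * norm y * norm A" if "finite F" "F \<subseteq> onb" for F x y A
    by (rule bd'[rule_format, OF conjI[OF that]])
  have B: "blinfun_apply (Blinfun (ext_form \<phi> F x y)) = ext_form \<phi> F x y" for F x y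
    by (rule bounded_linear_Blinfun_apply[OF l2_rep_bounded_linear[OF ext_form_l2_rep[OF lin]]])
  have "\<exists>L. ((\<lambda>F. Blinfun (ext_form \<phi> F x y)) \<longlongrightarrow> L) (finite_subsets_at_top onb)" for x y
  proof (rule tendsto_finite_subsets_Cauchy)
    fix \<epsilon> :: real assume \<epsilon>: "0 < \<epsilon>"
    \<comment> \<open>Truncation errors of \<open>x\<close> and \<open>y\<close> alone: they bound
      the change of the form when \<open>F\<close> grows, relative to the norm of
      \<open>A\<close>.\<close>
    let ?h = "\<lambda>F. C * norm (x - restr F x) * norm y + C * norm x * norm (y - restr F y)"
    have "(?h \<longlongrightarrow> C * 0 * norm y + C * norm x * 0) (finite_subsets_at_top onb)"
      by (intro tendsto_intros restr_tendsto)
    then have "\<forall>\<^sub>F F in finite_subsets_at_top onb. ?h F < \<epsilon>" 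
      by (rule order_tendstoD(2)) (simp add: \<epsilon>)
    then obtain F0 where F0: "finite F0" "F0 \<subseteq> onb" "?h F0 < \<epsilon>"
      unfolding eventually_finite_subsets_at_top by blast
    have "dist (Blinfun (ext_form \<phi> F x y)) (Blinfun (ext_form \<phi> F0 x y)) < \<epsilon>"
      if F: "finite F" "F0 \<subseteq> F" "F \<subseteq> onb" for F
    proof -
      have "norm (Blinfun (ext_form \<phi> F x y) - Blinfun (ext_form \<phi> F0 x y)) \<le> ?h F0"
      proof (rule norm_blinfun_bound)
        show "0 \<le> ?h F0" using C by simp
        fix A
        have "ext_form \<phi> F x y A - ext_form \<phi> F0 x y A
            = ext_form \<phi> F (x - restr F0 x) y A + ext_form \<phi> F (restr F0 x) (y - restr F0 y) A"
          unfolding ext_form_restr[OF F(1,3,2), symmetric] ext_form_diff_left ext_form_diff_right by simp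
        then have "cmod (ext_form \<phi> F x y A - ext_form \<phi> F0 x y A)
            \<le> cmod (ext_form \<phi> F (x - restr F0 x) y A) + cmod (ext_form \<phi> F (restr F0 x) (y - restr F0 y) A)"
          by (simp add: norm_triangle_ineq)
        also have "\<dots> \<le> C * norm (x - restr F0 x) * norm y * norm A
            + C * norm (restr F0 x) * norm (y - restr F0 y) * norm A"
          by (intro add_mono bd F)
        also have "\<dots> \<le> C * norm (x - restr F0 x) * norm y * norm A + C * norm x * norm (y - restr F0 y) * norm A"
          by (intro add_left_mono mult_right_mono mult_left_mono norm_diff_restr(2) F0 C) auto
        finally show "norm (blinfun_apply (Blinfun (ext_form \<phi> F x y) - Blinfun (ext_form \<phi> F0 x y)) A) \<le> ?h F0 * norm A"
          by (simp add: minus_blinfun.rep_eq B distrib_right)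
      qed
      then show ?thesis using F0(3) by (simp add: dist_norm)
    qed
    then show "\<exists>F0. finite F0 \<and> F0 \<subseteq> onb \<and> (\<forall>F. finite F \<and> F0 \<subseteq> F \<and> F \<subseteq> onb \<longrightarrow>
        dist (Blinfun (ext_form \<phi> F x y)) (Blinfun (ext_form \<phi> F0 x y)) < \<epsilon>)"
      using F0(1,2) by (intro exI[of _ F0]) simp
  qed
  then have "\<forall>x. \<exists>L. \<forall>y. ((\<lambda>F. Blinfun (ext_form \<phi> F x y)) \<longlongrightarrow> L y) (finite_subsets_at_top onb)"
    by (intro allI choice)
  from choice[OF this] show ?thesis .
qed

section \<open>Existence and uniqueness of the normal extension\<close>

lemma predual_sum: "(\<And>i. i \<in> I \<Longrightarrow> f i \<in> predual) \<Longrightarrow> sum f I \<in> predual"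
proof -
  assume "\<And>i. i \<in> I \<Longrightarrow> f i \<in> predual"
  then have "\<exists>r. l2_rep r (\<lambda>A. \<Sum>i\<in>I. blinfun_apply (f i) A)"
    by (intro l2_rep_sum) (simp add: predual_iff)
  moreover have "(\<lambda>A. \<Sum>i\<in>I. blinfun_apply (f i) A) = blinfun_apply (sum f I)"
    by (rule ext) (rule blinfun_apply_sum[symmetric])
  ultimately show ?thesis by (simp add: predual_iff)
qed

text \<open>The value at \<open>A\<close> is the operator of the form sending \<open>x\<close> and
  \<open>y\<close> to \<open>L x y\<close> at \<open>A\<close>. It depends normally on
  \<open>A\<close>, since composing a functional given by square summable \<open>x n\<close> and
  \<open>y n\<close> with the extension yields the norm convergent series of the
  \<open>L (x n) (y n)\<close>, all of which lie in the norm closed predual.\<close>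

lemma commutant_ext_exists:
  assumes \<phi>: "\<phi> \<in> normal_cb"
  shows "\<exists>\<Phi>. clinear \<Phi> \<and> normal_map \<Phi> \<and> (\<forall>x y. \<Phi> (rmult y \<odot> lmult x) = rmult y \<odot> lmult (\<phi> x))"
proof -
  let ?\<F> = "finite_subsets_at_top (onb :: 'a set)"
  have lin: "clinear \<phi>" "normal_map \<phi>" and cb: "completely_bounded \<phi>" using \<phi> by (auto simp: normal_cb_def)
  from ext_form_bound[OF cb] obtain C where C: "0 \<le> C"
    and bd': "\<forall>F x y A. finite F \<and> F \<subseteq> onb \<longrightarrow> cmod (ext_form \<phi> F x y A) \<le> C * norm x * norm y * norm A"
    by (elim exE conjE)
  have bd: "cmod (ext_form \<phi> F x y A) \<le> C * norm x * norm y * norm A" if "finite F" "F \<subseteq> onb" for F x y A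
    by (rule bd'[rule_format, OF conjI[OF that]])
  have B: "blinfun_apply (Blinfun (ext_form \<phi> F x y)) = ext_form \<phi> F x y" for F x y
    by (rule bounded_linear_Blinfun_apply[OF l2_rep_bounded_linear[OF ext_form_l2_rep[OF lin]]])
  from ext_form_limit[OF \<phi>] obtain L where "\<forall>x y. ((\<lambda>F. Blinfun (ext_form \<phi> F x y)) \<longlongrightarrow> L x y) ?\<F>" ..
  then have L: "((\<lambda>F. Blinfun (ext_form \<phi> F x y)) \<longlongrightarrow> L x y) ?\<F>" for x y by (elim allE)
  have LA: "((\<lambda>F. ext_form \<phi> F x y A) \<longlongrightarrow> blinfun_apply (L x y) A) ?\<F>" for x y A
    using bounded_linear.tendsto[OF blinfun.bounded_linear_left L[of x y], of A] by (simp add: B)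
  note uniq = tendsto_unique[OF finite_subsets_at_top_neq_bot]
  have Lpre: "L x y \<in> predual" for x y
    by (rule predual_limit[OF _ L finite_subsets_at_top_neq_bot]) (simp add: predual_iff B ext_form_l2_rep[OF lin])
  have Lbd: "cmod (blinfun_apply (L x y) A) \<le> C * norm x * norm y * norm A" for x y A
    by (rule tendsto_upperbound[OF tendsto_norm[OF LA] _ finite_subsets_at_top_neq_bot])
      (rule eventually_finite_subsets_at_top_weakI, rule bd)
  have add1: "blinfun_apply (L (x + x') y) A = blinfun_apply (L x y) A + blinfun_apply (L x' y) A" for x x' y A
    by (rule uniq[OF LA]) (simp only: ext_form_add_left, intro tendsto_intros LA)
  have add2: "blinfun_apply (L x (y + y')) A = blinfun_apply (L x y) A + blinfun_apply (L x y') A" for x y y' A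
    by (rule uniq[OF LA]) (simp only: ext_form_add_right, intro tendsto_intros LA)
  have scl1: "blinfun_apply (L (c *\<^sub>C x) y) A = c * blinfun_apply (L x y) A" for c x y A
    by (rule uniq[OF LA]) (simp only: ext_form_scaleC_left, intro tendsto_intros LA)
  have scl2: "blinfun_apply (L x (c *\<^sub>C y)) A = cnj c * blinfun_apply (L x y) A" for c x y A
    by (rule uniq[OF LA]) (simp only: ext_form_scaleC_right, intro tendsto_intros LA)
  have "\<exists>T. \<forall>x y. cinner (bop_apply T x) y = blinfun_apply (L x y) A" for A
    by (rule sesquilinear_operator[of _ "C * norm A"])
      (use Lbd[of _ _ A] C in \<open>simp_all add: add1 add2 scl1 scl2 mult_ac\<close>)
  then have "\<forall>A. \<exists>T. \<forall>x y. cinner (bop_apply T x) y = blinfun_apply (L x y) A" by (rule allI)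
  from choice[OF this] obtain \<Phi> where "\<forall>A x y. cinner (bop_apply (\<Phi> A) x) y = blinfun_apply (L x y) A" ..
  then have \<Phi>: "cinner (bop_apply (\<Phi> A) x) y = blinfun_apply (L x y) A" for A x y by (elim allE)
  have Lcl: "clinear (blinfun_apply (L x y))" for x y using Lpre[of x y] by (simp add: predual_def)
  have cl: "clinear \<Phi>"
    unfolding clinear_iff
  proof (intro conjI allI)
    show "\<Phi> (A + A') = \<Phi> A + \<Phi> A'" for A A'
      by (intro bop_eqI cinner_ext) (simp add: \<Phi> cinner_add_left blinfun.add_right)
    show "\<Phi> (c *\<^sub>C A) = c *\<^sub>C \<Phi> A" for c A
      using Lcl by (intro bop_eqI cinner_ext) (simp add: \<Phi> cinner_scaleC_left clinear_functional_iff)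
  qed
  have "normal_map \<Phi>"
    unfolding normal_map_iff[OF cl]
  proof (intro allI impI)
    fix g r assume "l2_rep r (g :: 'a hs bop \<Rightarrow> complex)"
    then obtain x y where x: "summable (\<lambda>n. (norm (x n))\<^sup>2)" and y: "summable (\<lambda>n. (norm (y n))\<^sup>2)"
      and g: "\<And>A. g A = (\<Sum>n. cinner (bop_apply A (x n)) (y n))" unfolding l2_rep_def by blast
    have "summable (\<lambda>n. norm (L (x n) (y n)))"
    proof (rule summable_comparison_test')
      show "summable (\<lambda>n. C * ((norm (x n))\<^sup>2 + (norm (y n))\<^sup>2))" by (intro summable_mult summable_add x y)
      fix n
      have "norm (L (x n) (y n)) \<le> C * norm (x n) * norm (y n)"
        by (rule norm_blinfun_bound) (use C Lbd in auto)
      also have "\<dots> \<le> C * ((norm (x n))\<^sup>2 + (norm (y n))\<^sup>2)"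
        unfolding mult.assoc by (intro mult_left_mono mult_norm_le_squares C)
      finally show "norm (norm (L (x n) (y n))) \<le> C * ((norm (x n))\<^sup>2 + (norm (y n))\<^sup>2)" by simp
    qed
    then have s: "summable (\<lambda>n. L (x n) (y n))" by (rule summable_norm_cancel)
    have "(\<Sum>n. L (x n) (y n)) \<in> predual"
      by (rule predual_limit[OF _ summable_LIMSEQ[OF s] sequentially_bot]) (intro predual_sum Lpre)
    moreover have "g (\<Phi> A) = blinfun_apply (\<Sum>n. L (x n) (y n)) A" for A
      unfolding g \<Phi> by (rule bounded_linear.suminf[OF blinfun.bounded_linear_left s, symmetric])
    ultimately show "\<exists>s. l2_rep s (\<lambda>A. g (\<Phi> A))" by (simp add: predual_iff)
  qed
  moreover have "\<Phi> (rmult b \<odot> lmult a) = rmult b \<odot> lmult (\<phi> a)" for a b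
  proof (rule bop_eqI_onb[OF onb_tens[OF is_onb_onb]], clarify)
    fix e f e' f' :: 'a assume o: "e \<in> onb" "f \<in> onb" "e' \<in> onb" "f' \<in> onb"
    let ?A = "rmult b \<odot> lmult a"
    let ?c = "cinner (bop_apply (\<phi> (slice f f' ?A)) e') e"
    \<comment> \<open>Tensors of basis vectors select one block of the double sum as soon as
      \<open>F\<close> contains \<open>f\<close> and \<open>f'\<close>, so the truncated forms are
      eventually constant and their limit is this block.\<close>
    have "ext_form \<phi> F (tens e' f') (tens e f) ?A = ?c" if F: "finite F" "{f, f'} \<subseteq> F" "F \<subseteq> onb" for F
    proof -
      have t: "bop_apply (hs_op (tens u v)) d = (if d = v then u else 0)" if "d \<in> F" "v \<in> onb" for d u v
        using F that by (auto simp: cinner_onb subset_iff)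
      have "ext_form \<phi> F (tens e' f') (tens e f) ?A = (\<Sum>d\<in>F. \<Sum>d'\<in>F. if d' = f' then
          (if d = f then cinner (bop_apply (\<phi> (slice d d' ?A)) e') e else 0) else 0)"
        unfolding ext_form_def by (intro sum.cong refl) (simp add: t o del: tens_apply)
      also have "\<dots> = (\<Sum>d\<in>F. if d = f then cinner (bop_apply (\<phi> (slice d f' ?A)) e') e else 0)"
        using F by (intro sum.cong refl) simp
      also have "\<dots> = ?c" using F by simp
      finally show ?thesis .
    qed
    then have "\<forall>\<^sub>F F in ?\<F>. ext_form \<phi> F (tens e' f') (tens e f) ?A = ?c"
      unfolding eventually_finite_subsets_at_top using o by (intro exI[of _ "{f, f'}"]) simp
    from uniq[OF LA tendsto_eventually[OF this]]
    have "cinner (bop_apply (\<Phi> ?A) (tens e' f')) (tens e f) = ?c" unfolding \<Phi> .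
    also have "\<phi> (slice f f' ?A) = slice f f' (rmult b \<odot> lmult (\<phi> a))"
      unfolding slice_rmult_lmult using lin(1) by (simp add: clinear_iff)
    finally show "cinner (bop_apply (\<Phi> ?A) (tens e' f')) (tens e f)
        = cinner (bop_apply (rmult b \<odot> lmult (\<phi> a)) (tens e' f')) (tens e f)"
      unfolding cinner_slice .
  qed
  ultimately show ?thesis using cl by blast
qed

text \<open>The operators \<open>R\<^sub>y L\<^sub>x\<close> include the matrix units \<open>(e \<boxtimes> f) \<boxtimes> (e' \<boxtimes> f')\<close> of \<open>\<B>(H)\<close>.\<close>

lemma normal_functional_eq:
  fixes f g :: "'a::complex_hilbert hs bop \<Rightarrow> complex"
  assumes "\<exists>r. l2_rep r f" "\<exists>r. l2_rep r g"
    and eq: "\<And>x y. f (rmult y \<odot> lmult x) = g (rmult y \<odot> lmult x)"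
  shows "f = g"
proof -
  obtain r F where F: "f = blinfun_apply F" "l2_rep r (blinfun_apply F)" using assms(1) l2_rep_blinfun by blast
  obtain s G where G: "g = blinfun_apply G" "l2_rep s (blinfun_apply G)" using assms(2) l2_rep_blinfun by blast
  note B = onb_tens[OF is_onb_onb[where 'a = 'a]]
  have "F = G"
  proof (rule approximable_eqI[OF B l2_rep_approximable[OF B F(2)] l2_rep_approximable[OF B G(2)]], clarify)
    fix e f e' f' :: 'a
    show "blinfun_apply F (tens e f \<boxtimes> tens e' f') = blinfun_apply G (tens e f \<boxtimes> tens e' f')"
      unfolding rank_one_tens using eq unfolding F(1) G(1) by simp
  qed
  then show ?thesis using F(1) G(1) by simp
qed

lemma normal_ext_unique:
  assumes "clinear \<Phi>" "normal_map \<Phi>" "\<And>x y. \<Phi> (rmult y \<odot> lmult x) = rmult y \<odot> lmult (\<phi> x)"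
    and "clinear \<Psi>" "normal_map \<Psi>" "\<And>x y. \<Psi> (rmult y \<odot> lmult x) = rmult y \<odot> lmult (\<phi> x)"
  shows "\<Phi> = \<Psi>"
proof (intro ext bop_eqI cinner_ext)
  fix A v z
  have "(\<lambda>A. cinner (bop_apply (\<Phi> A) v) z) = (\<lambda>A. cinner (bop_apply (\<Psi> A) v) z)"
  proof (rule normal_functional_eq)
    show "\<exists>r. l2_rep r (\<lambda>A. cinner (bop_apply (\<Phi> A) v) z)"
      using assms(2) l2_rep_vec_functional[of v z] unfolding normal_map_iff[OF assms(1)] by blast
    show "\<exists>r. l2_rep r (\<lambda>A. cinner (bop_apply (\<Psi> A) v) z)"
      using assms(5) l2_rep_vec_functional[of v z] unfolding normal_map_iff[OF assms(4)] by blast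
  qed (simp add: assms(3,6))
  then show "cinner (bop_apply (\<Phi> A) v) z = cinner (bop_apply (\<Psi> A) v) z" by (rule fun_cong)
qed

lemma commutant_ext_eqI:
  assumes "clinear \<Phi>" "normal_map \<Phi>" "\<And>x y. \<Phi> (rmult y \<odot> lmult x) = rmult y \<odot> lmult (\<phi> x)"
  shows "commutant_ext \<phi> = \<Phi>"
  unfolding commutant_ext_def
proof (rule the_equality)
  show "clinear \<Phi> \<and> normal_map \<Phi> \<and> (\<forall>x y. \<Phi> (rmult y \<odot> lmult x) = rmult y \<odot> lmult (\<phi> x))"
    using assms by blast
  show "\<Psi> = \<Phi>" if "clinear \<Psi> \<and> normal_map \<Psi> \<and> (\<forall>x y. \<Psi> (rmult y \<odot> lmult x) = rmult y \<odot> lmult (\<phi> x))" for \<Psi>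
    using that by (intro normal_ext_unique[of \<Psi> \<phi> \<Phi>] assms) auto
qed

text \<open>Both sides depend normally on \<open>A\<close>, so it is enough to compare them at the
  operators \<open>rmult y \<odot> lmult x\<close>, whose slices are multiples of \<open>x\<close>.
  This gives access to the blocks of the extension without returning to its construction.\<close>

lemma commutant_ext_slice:
  assumes \<phi>: "\<phi> \<in> normal_cb"
  shows "slice v' v (commutant_ext \<phi> A) = \<phi> (slice v' v A)"
proof -
  have lin: "clinear \<phi>" "normal_map \<phi>" using \<phi> by (auto simp: normal_cb_def)
  obtain \<Phi> where \<Phi>: "clinear \<Phi>" "normal_map \<Phi>" "\<And>x y. \<Phi> (rmult y \<odot> lmult x) = rmult y \<odot> lmult (\<phi> x)"
    using commutant_ext_exists[OF \<phi>] by blast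
  have "cinner (bop_apply (slice v' v (\<Phi> A)) u) u' = cinner (bop_apply (\<phi> (slice v' v A)) u) u'" for u u'
  proof -
    have "(\<lambda>A. cinner (bop_apply (slice v' v (\<Phi> A)) u) u') = (\<lambda>A. cinner (bop_apply (\<phi> (slice v' v A)) u) u')"
    proof (rule normal_functional_eq)
      show "\<exists>r. l2_rep r (\<lambda>A. cinner (bop_apply (slice v' v (\<Phi> A)) u) u')"
        using \<Phi>(2) l2_rep_vec_functional[of "tens u v" "tens u' v'"]
        unfolding cinner_slice normal_map_iff[OF \<Phi>(1)] by blast
      show "\<exists>r. l2_rep r (\<lambda>A. cinner (bop_apply (\<phi> (slice v' v A)) u) u')" by (rule l2_rep_slice[OF lin])
      show "cinner (bop_apply (slice v' v (\<Phi> (rmult y \<odot> lmult x))) u) u'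
          = cinner (bop_apply (\<phi> (slice v' v (rmult y \<odot> lmult x))) u) u'" for x y
        unfolding \<Phi>(3) slice_rmult_lmult using lin(1) by (simp add: clinear_iff)
    qed
    then show ?thesis by (rule fun_cong)
  qed
  then have "slice v' v (\<Phi> A) = \<phi> (slice v' v A)" by (intro bop_eqI cinner_ext)
  then show ?thesis unfolding commutant_ext_eqI[OF \<Phi>] .
qed

section \<open>Vectors of bounded rank\<close>

lemma ortho_expansion:
  assumes O: "is_ortho O'" "finite O'" and v: "v \<in> cvec.span O'"
  shows "(\<Sum>p\<in>O'. cinner v p *\<^sub>C p) = v"
proof (rule cvec.span_induct[OF v])
  show "cvec.subspace {v. (\<Sum>p\<in>O'. cinner v p *\<^sub>C p) = v}"
  proof (rule cvec.subspaceI; unfold mem_Collect_eq)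
    show "(\<Sum>p\<in>O'. cinner (x + y) p *\<^sub>C p) = x + y"
      if "(\<Sum>p\<in>O'. cinner x p *\<^sub>C p) = x" "(\<Sum>p\<in>O'. cinner y p *\<^sub>C p) = y" for x y
      using that by (simp add: cinner_add_left scaleC_add_left sum.distrib)
    show "(\<Sum>p\<in>O'. cinner (c *\<^sub>C x) p *\<^sub>C p) = c *\<^sub>C x" if "(\<Sum>p\<in>O'. cinner x p *\<^sub>C p) = x" for c x
    proof -
      have "(\<Sum>p\<in>O'. cinner (c *\<^sub>C x) p *\<^sub>C p) = c *\<^sub>C (\<Sum>p\<in>O'. cinner x p *\<^sub>C p)"
        by (simp add: cinner_scaleC_left cvec.scale_sum_right)
      then show ?thesis unfolding that .
    qed
  qed simp
  fix q assume q: "q \<in> O'"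
  have "(\<Sum>p\<in>O'. cinner q p *\<^sub>C p) = (\<Sum>p\<in>O'. if q = p then p else 0)"
    by (intro sum.cong refl) (use O(1) q in \<open>simp add: is_ortho_def\<close>)
  then show "(\<Sum>p\<in>O'. cinner q p *\<^sub>C p) = q" using O(2) q by simp
qed

lemma gram_schmidt:
  fixes S :: "'a::complex_hilbert set"
  assumes "finite S"
  shows "\<exists>O'. is_ortho O' \<and> finite O' \<and> card O' \<le> card S \<and> S \<subseteq> cvec.span O'"
  using assms
proof (induction S)
  case empty
  show ?case by (intro exI[of _ "{}"]) (simp add: is_ortho_def)
next
  case (insert b S)
  from insert.IH obtain O' where O: "is_ortho O'" "finite O'" "card O' \<le> card S" "S \<subseteq> cvec.span O'"
    by (elim exE conjE)
  define s where "s = (\<Sum>p\<in>O'. cinner b p *\<^sub>C p)"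
  have s: "s \<in> cvec.span O'"
    unfolding s_def by (intro cvec.span_sum cvec.span_scale cvec.span_base)
  show ?case
  proof (cases "b = s")
    case True
    then have "insert b S \<subseteq> cvec.span O'" using s O(4) by simp
    then show ?thesis using O insert.hyps by (intro exI[of _ O']) simp
  next
    case False
    define u where "u = complex_of_real (1 / norm (b - s)) *\<^sub>C (b - s)"
    have "norm u = 1" using False by (simp add: u_def norm_scaleC norm_divide)
    then have uu: "cinner u u = 1" by (simp add: cinner_self)
    have up: "cinner u p = 0" if p: "p \<in> O'" for p
    proof -
      have "cinner s p = (\<Sum>q\<in>O'. if q = p then cinner b q else 0)"
        unfolding s_def cinner_sum_left cinner_scaleC_left
        by (intro sum.cong refl) (use O(1) p in \<open>simp add: is_ortho_def\<close>)
      then have "cinner s p = cinner b p" using O(2) p by simp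
      then show ?thesis by (simp add: u_def cinner_scaleC_left cinner_diff_left)
    qed
    have pu: "cinner p u = 0" if "p \<in> O'" for p
      using up[OF that] cinner_commute[of p u] by simp
    have "is_ortho (insert u O')"
      unfolding is_ortho_def
    proof (intro ballI)
      fix e f assume ef: "e \<in> insert u O'" "f \<in> insert u O'"
      have "u \<notin> O'" using up uu by fastforce
      then show "cinner e f = (if e = f then 1 else 0)"
        using ef O(1) uu up pu unfolding is_ortho_def by (cases "e = u"; cases "f = u") auto
    qed
    moreover have "b \<in> cvec.span (insert u O')"
    proof -
      have "b = complex_of_real (norm (b - s)) *\<^sub>C u + s"
        using False by (simp add: u_def scaleC_scaleC flip: of_real_mult)
      moreover have "s \<in> cvec.span (insert u O')" using s cvec.span_mono[of O' "insert u O'"] by blast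
      ultimately show ?thesis by (metis cvec.span_add cvec.span_scale cvec.span_base insertI1)
    qed
    moreover have "S \<subseteq> cvec.span (insert u O')" using O(4) cvec.span_mono[of O' "insert u O'"] by blast
    moreover have "card (insert u O') \<le> card (insert b S)"
      using O(2,3) insert.hyps card_insert_le_m1[of "Suc (card O')" O' u]
      by (simp add: card_insert_if)
    ultimately show ?thesis using O(2) by (intro exI[of _ "insert u O'"]) simp
  qed
qed

text \<open>If the orthonormal vectors u_l span the range, then x is the sum of the u_l \<boxtimes>
  x* u_l.\<close>

lemma op_rank_le_tens:
  assumes r: "op_rank (hs_op x) \<le> enat k"
  shows "\<exists>u v. x = (\<Sum>l<k. tens (u l) (v l))"
proof -
  let ?V = "range (bop_apply (hs_op x))"
  have ex: "\<exists>S. finite S \<and> ?V \<subseteq> cvec.span S" and dim: "cvec.dim ?V \<le> k"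
    using r unfolding op_rank_def by (auto split: if_splits)
  from ex obtain S where S: "finite S" "?V \<subseteq> cvec.span S" by (elim exE conjE)
  obtain B where B: "B \<subseteq> ?V" "cvec.independent B" "?V \<subseteq> cvec.span B" "card B = cvec.dim ?V"
    using cvec.basis_exists[of ?V] .
  have "finite B" using cvec.independent_span_bound[OF S(1) B(2)] B(1) S(2) by simp
  from gram_schmidt[OF this] obtain O' where O: "is_ortho O'" "finite O'" "card O' \<le> card B" "B \<subseteq> cvec.span O'"
    by (elim exE conjE)
  have V: "?V \<subseteq> cvec.span O'"
    using B(3) cvec.span_minimal[OF O(4) cvec.subspace_span] by simp
  define n where "n = card O'"
  have nk: "n \<le> k" using O(3) B(4) dim by (simp add: n_def)
  obtain e where e: "bij_betw e {..<n} O'"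
    using ex_bij_betw_nat_finite[OF O(2)] by (auto simp: atLeast0LessThan n_def)
  have inj: "inj_on e {..<n}" and im: "e ` {..<n} = O'" using e by (simp_all add: bij_betw_def)
  \<comment> \<open>Zero vectors fill up the sum to exactly \<open>k\<close> terms, the size of the
    matrices in \<open>k_positive\<close>.\<close>
  define u where "u l = (if l < n then e l else 0)" for l
  define v where "v l = bop_apply (adj (hs_op x)) (u l)" for l
  have "x = (\<Sum>l<k. tens (u l) (v l))"
  proof (rule hs_eqI)
    fix z
    have "bop_apply (hs_op (\<Sum>l<k. tens (u l) (v l))) z = (\<Sum>l<k. cinner (bop_apply (hs_op x) z) (u l) *\<^sub>C u l)"
      by (simp add: hs_op_sum bop_sum_left v_def cinner_adj)
    also have "\<dots> = (\<Sum>l<n. cinner (bop_apply (hs_op x) z) (u l) *\<^sub>C u l)"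
      by (rule sum.mono_neutral_right) (use nk in \<open>auto simp: u_def\<close>)
    also have "\<dots> = (\<Sum>l<n. cinner (bop_apply (hs_op x) z) (e l) *\<^sub>C e l)"
      by (intro sum.cong refl) (simp add: u_def)
    also have "\<dots> = (\<Sum>p\<in>O'. cinner (bop_apply (hs_op x) z) p *\<^sub>C p)"
      unfolding im[symmetric] by (simp add: sum.reindex[OF inj])
    also have "\<dots> = bop_apply (hs_op x) z" by (rule ortho_expansion[OF O(1,2)]) (use V in auto)
    finally show "bop_apply (hs_op x) z = bop_apply (hs_op (\<Sum>l<k. tens (u l) (v l))) z" ..
  qed
  then show ?thesis by (intro exI)
qed

lemma op_rank_tens_le: "op_rank (hs_op (\<Sum>l<k. tens (u l) (v l))) \<le> enat k"
proof -
  let ?V = "range (bop_apply (hs_op (\<Sum>l<k. tens (u l) (v l))))"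
  have V: "?V \<subseteq> cvec.span (u ` {..<k})"
  proof clarify
    fix z
    show "bop_apply (hs_op (\<Sum>l<k. tens (u l) (v l))) z \<in> cvec.span (u ` {..<k})"
      unfolding hs_op_sum bop_sum_left tens_apply
      by (intro cvec.span_sum cvec.span_scale cvec.span_base imageI)
  qed
  have "cvec.dim ?V \<le> card (u ` {..<k})" by (rule cvec.dim_le_card[OF V]) simp
  also have "\<dots> \<le> k" using card_image_le[of "{..<k}" u] by simp
  finally have "cvec.dim ?V \<le> k" .
  moreover have "\<exists>S. finite S \<and> ?V \<subseteq> cvec.span S" using V by (intro exI[of _ "u ` {..<k}"]) simp
  ultimately show ?thesis unfolding op_rank_def by simp
qed

section \<open>Block positivity of Choi operators\<close>

lemma mult_cnj_nonneg: "0 \<le> z * cnj z" for z :: complex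
  by (simp add: less_eq_complex_def complex_mult_cnj)

lemma mat_positive_rank_one: "mat_positive k (\<lambda>i j. w i \<boxtimes> w j)"
  unfolding mat_positive_def
proof
  fix v :: "nat \<Rightarrow> 'a"
  let ?S = "\<Sum>j<k. cinner (v j) (w j)"
  have "(\<Sum>i<k. cinner (\<Sum>j<k. bop_apply (w i \<boxtimes> w j) (v j)) (v i)) = (\<Sum>i<k. ?S * cinner (w i) (v i))"
    by (intro sum.cong refl) (simp add: rank_one_apply cinner_sum_left cinner_scaleC_left sum_distrib_right)
  also have "\<dots> = ?S * cnj ?S"
    unfolding cnj_sum sum_distrib_left[symmetric] by (metis cinner_commute)
  finally have eq: "(\<Sum>i<k. cinner (\<Sum>j<k. bop_apply (w i \<boxtimes> w j) (v j)) (v i)) = ?S * cnj ?S" .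
  show "0 \<le> (\<Sum>i<k. cinner (\<Sum>j<k. bop_apply (w i \<boxtimes> w j) (v j)) (v i))"
    unfolding eq by (rule mult_cnj_nonneg)
qed

lemma choi_block_positive:
  assumes \<phi>: "\<phi> \<in> normal_cb_pos k" and x: "op_rank (hs_op x) \<le> enat k"
  shows "0 \<le> cinner (bop_apply (choi x0 \<phi>) x) x"
proof -
  have cb: "\<phi> \<in> normal_cb" and kp: "k_positive k \<phi>" using \<phi> by (simp_all add: normal_cb_pos_def)
  from op_rank_le_tens[OF x] obtain u v where xs: "x = (\<Sum>l<k. tens (u l) (v l))" by (elim exE)
  define w where "w l = bop_apply (hs_op x0) (v l)" for l
  have sl: "slice (v l) (v m) (choi x0 \<phi>) = \<phi> (w l \<boxtimes> w m)" for l m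
    unfolding choi_def commutant_ext_slice[OF cb] slice_rank_one w_def ..
  have "cinner (bop_apply (choi x0 \<phi>) x) x
      = (\<Sum>l<k. cinner (\<Sum>m<k. bop_apply (choi x0 \<phi>) (tens (u m) (v m))) (tens (u l) (v l)))"
    unfolding xs bop_sum_right cinner_sum_right ..
  also have "\<dots> = (\<Sum>l<k. cinner (\<Sum>m<k. bop_apply (\<phi> (w l \<boxtimes> w m)) (u m)) (u l))"
    unfolding cinner_sum_left cinner_slice[symmetric] sl ..
  finally have eq: "cinner (bop_apply (choi x0 \<phi>) x) x = \<dots>" .
  have "mat_positive k (\<lambda>l m. \<phi> (w l \<boxtimes> w m))"
    using kp mat_positive_rank_one[of k w] unfolding k_positive_def by (elim allE[of _ "\<lambda>l m. w l \<boxtimes> w m"]) simp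
  then show ?thesis unfolding eq mat_positive_def by (elim allE)
qed

section \<open>Nonnegativity on the Schmidt cone\<close>

lemma closed_nonneg_functionals: "closed {\<rho> :: 'a::complex_hilbert bop \<Rightarrow>\<^sub>L complex. 0 \<le> blinfun_apply \<rho> C}"
proof -
  have c: "continuous_on UNIV (\<lambda>\<rho> :: 'a bop \<Rightarrow>\<^sub>L complex. blinfun_apply \<rho> C)"
    by (rule linear_continuous_on[OF blinfun.bounded_linear_left])
  have "closed ({\<rho> :: 'a bop \<Rightarrow>\<^sub>L complex. 0 \<le> Re (blinfun_apply \<rho> C)} \<inter> {\<rho>. 0 = Im (blinfun_apply \<rho> C)})"
    by (intro closed_Int closed_Collect_le closed_Collect_eq continuous_on_Re continuous_on_Im c continuous_on_const)
  moreover have "{\<rho> :: 'a bop \<Rightarrow>\<^sub>L complex. 0 \<le> Re (blinfun_apply \<rho> C)} \<inter> {\<rho>. 0 = Im (blinfun_apply \<rho> C)}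
      = {\<rho>. 0 \<le> blinfun_apply \<rho> C}" by (auto simp: less_eq_complex_def)
  ultimately show ?thesis by simp
qed

text \<open>The functionals that are nonnegative at a fixed operator form a closed convex cone, so
  the generators decide.\<close>

lemma schmidt_cone_nonneg:
  fixes \<rho> :: "'a::complex_hilbert hs bop \<Rightarrow>\<^sub>L complex"
  assumes \<rho>: "\<rho> \<in> schmidt_cone k"
    and C: "\<And>x. op_rank (hs_op x) \<le> enat k \<Longrightarrow> 0 \<le> cinner (bop_apply C x) x"
  shows "0 \<le> blinfun_apply \<rho> C"
proof -
  let ?P = "{\<rho> :: 'a hs bop \<Rightarrow>\<^sub>L complex. 0 \<le> blinfun_apply \<rho> C}"
  have "convex_cone hull {vec_functional x x |x. op_rank (hs_op x) \<le> enat k} \<subseteq> ?P"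
  proof (rule hull_minimal)
    show "{vec_functional x x |x. op_rank (hs_op x) \<le> enat k} \<subseteq> ?P" using C by auto
    show "convex_cone ?P"
      unfolding convex_cone_iff
      by (auto simp: plus_blinfun.rep_eq scaleR_blinfun.rep_eq intro: scaleR_nonneg_nonneg)
  qed
  from closure_minimal[OF this closed_nonneg_functionals] show ?thesis
    using \<rho> unfolding schmidt_cone_def by blast
qed

section \<open>Positive semidefinite matrices\<close>

text \<open>Cholesky decomposition: the row and column of the pivot \<open>g\<close> are split off
  as a rank one matrix, and the remaining Schur complement is again positive semidefinite.\<close>

lemma psd_decomposition:
  fixes G :: "'i \<Rightarrow> 'i \<Rightarrow> complex"
  assumes "finite I" and "\<And>z. 0 \<le> (\<Sum>a\<in>I. \<Sum>b\<in>I. G a b * z b * cnj (z a))"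
  shows "\<exists>D :: 'i \<Rightarrow> 'i \<Rightarrow> complex. \<forall>a\<in>I. \<forall>b\<in>I. G a b = (\<Sum>r\<in>I. D r a * cnj (D r b))"
  using assms
proof (induction I arbitrary: G)
  case empty
  show ?case by simp
next
  case (insert n I)
  define q where "q z = (\<Sum>a\<in>I. \<Sum>b\<in>I. G a b * z b * cnj (z a))" for z
  define s where "s z = (\<Sum>b\<in>I. G n b * z b)" for z
  define s' where "s' z = (\<Sum>a\<in>I. G a n * cnj (z a))" for z
  define g where "g = G n n"
  have pos: "0 \<le> g * w * cnj w + s z * cnj w + s' z * w + q z" for z w
  proof -
    let ?z = "z(n := w)"
    have z: "?z a = z a" if "a \<in> I" for a using that insert.hyps(2) by auto
    have "(\<Sum>a\<in>insert n I. \<Sum>b\<in>insert n I. G a b * ?z b * cnj (?z a))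
        = g * w * cnj w + (\<Sum>b\<in>I. G n b * ?z b * cnj w) + ((\<Sum>a\<in>I. G a n * w * cnj (?z a))
          + (\<Sum>a\<in>I. \<Sum>b\<in>I. G a b * ?z b * cnj (?z a)))"
      using insert.hyps by (simp add: g_def sum.distrib)
    also have "(\<Sum>b\<in>I. G n b * ?z b * cnj w) = s z * cnj w"
      unfolding s_def sum_distrib_right by (intro sum.cong refl) (simp only: z)
    also have "(\<Sum>a\<in>I. G a n * w * cnj (?z a)) = s' z * w"
      unfolding s'_def sum_distrib_right
      by (intro sum.cong refl) (simp add: z mult_ac del: fun_upd_apply)
    also have "(\<Sum>a\<in>I. \<Sum>b\<in>I. G a b * ?z b * cnj (?z a)) = q z"
      unfolding q_def by (intro sum.cong refl) (simp only: z)
    finally show ?thesis using insert.prems[of ?z] by (simp add: add.assoc)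
  qed
  have g: "0 \<le> g" using pos[of 1 "\<lambda>_. 0"] by (simp add: s_def s'_def q_def)
  define g' where "g' = Re g"
  have g': "g = complex_of_real g'" "0 \<le> g'"
    using g by (simp_all add: g'_def less_eq_complex_def complex_eq_iff)
  have qz: "0 \<le> q z" for z using pos[of 0 z] by simp
  \<comment> \<open>Nonnegative complex numbers are real. The value 1 for \<open>w\<close> compares
    imaginary parts and the value \<i> compares real parts; the matrix is hermitian for this
    reason.\<close>
  have s': "s' z = cnj (s z)" for z
  proof (rule complex_eqI)
    have "Im q0 = 0" if "0 \<le> q0" for q0 using that by (simp add: less_eq_complex_def)
    then have I0: "Im (q z) = 0" using qz by blast
    show "Im (s' z) = Im (cnj (s z))"
      using pos[of 1 z] I0 by (simp add: less_eq_complex_def g'(1))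
    show "Re (s' z) = Re (cnj (s z))"
      using pos[of \<i> z] I0 by (simp add: less_eq_complex_def g'(1))
  qed
  have G: "G a n = cnj (G n a)" if "a \<in> I" for a
  proof -
    let ?z = "\<lambda>b. if b = a then 1 else (0::complex)"
    have "s ?z = G n a" "s' ?z = G a n"
      unfolding s_def s'_def using that insert.hyps(1) by (simp_all add: if_distrib cong: if_cong)
    then show ?thesis using s'[of ?z] by simp
  qed
  \<comment> \<open>For a zero pivot, division by zero makes \<open>d\<close> vanish, in accordance
    with \<open>g0\<close>.\<close>
  define d where "d a = G a n / complex_of_real (sqrt g')" for a
  \<comment> \<open>The value - s z / g of \<open>w\<close> completes the square. For a zero pivot
    the quotient is 0 and the claim is the positivity of the form on \<open>I\<close>.\<close>
  have key: "0 \<le> q z - s z * cnj (s z) / g" for z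
  proof (cases "g' = 0")
    case True
    then show ?thesis using qz[of z] g'(1) by simp
  next
    case False
    have eq: "g * (- s z / g) * cnj (- s z / g) + s z * cnj (- s z / g) + s' z * (- s z / g) + q z
        = q z - s z * cnj (s z) / g"
      using False unfolding s' g'(1) by (simp add: field_simps)
    show ?thesis using pos[of "- s z / g" z] unfolding eq .
  qed
  \<comment> \<open>With a zero pivot and a nonzero entry in its row, the form would be a
    nonconstant affine function of \<open>t\<close> along the chosen line and would take negative
    values.\<close>
  have g0: "G n b = 0" if "g' = 0" "b \<in> I" for b
  proof (rule ccontr)
    assume nz: "G n b \<noteq> 0"
    let ?z = "\<lambda>c. if c = b then 1 else (0::complex)"
    have sz: "s ?z = G n b" unfolding s_def using that(2) insert.hyps(1) by (simp add: if_distrib cong: if_cong)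
    define c where "c = (cmod (G n b))\<^sup>2"
    have c: "0 < c" using nz by (simp add: c_def)
    have "0 \<le> Re (q ?z) - 2 * t * c" for t :: real
    proof -
      have "s ?z * cnj (- of_real t * s ?z) + s' ?z * (- of_real t * s ?z) = complex_of_real (- 2 * t * c)"
        unfolding s' sz c_def by (simp add: complex_norm_square mult_ac del: of_real_power)
      then have "0 \<le> complex_of_real (- 2 * t * c) + q ?z"
        using pos[of "- of_real t * s ?z" ?z] that(1) g'(1) by simp
      then show ?thesis by (simp add: less_eq_complex_def)
    qed
    from this[of "(Re (q ?z) + 1) / (2 * c)"] show False using c by simp
  qed
  have dd: "d a * cnj (d b) = cnj (G n a) * G n b / g" if "a \<in> I" "b \<in> I" for a b
  proof -
    have "complex_of_real (sqrt g') * complex_of_real (sqrt g') = g" using g' by (simp flip: of_real_mult)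
    then show ?thesis unfolding d_def using that by (simp add: G)
  qed
  have "0 \<le> (\<Sum>a\<in>I. \<Sum>b\<in>I. (G a b - d a * cnj (d b)) * z b * cnj (z a))" for z
  proof -
    have "(\<Sum>a\<in>I. \<Sum>b\<in>I. d a * cnj (d b) * z b * cnj (z a)) = s z * cnj (s z) / g"
      unfolding s_def cnj_sum sum_product sum_divide_distrib
      by (subst sum.swap, intro sum.cong refl) (simp add: dd)
    moreover have "(\<Sum>a\<in>I. \<Sum>b\<in>I. (G a b - d a * cnj (d b)) * z b * cnj (z a))
        = q z - (\<Sum>a\<in>I. \<Sum>b\<in>I. d a * cnj (d b) * z b * cnj (z a))"
      by (simp add: q_def left_diff_distrib sum_subtractf)
    ultimately show ?thesis using key by simp
  qed
  from insert.IH[OF this] obtain D :: "'i \<Rightarrow> 'i \<Rightarrow> complex"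
    where D: "\<And>a b. a \<in> I \<Longrightarrow> b \<in> I \<Longrightarrow> G a b - d a * cnj (d b) = (\<Sum>r\<in>I. D r a * cnj (D r b))" by blast
  \<comment> \<open>Vectors with index in \<open>I\<close> get the entry 0 at \<open>n\<close>, so
    the row and column of the pivot come from \<open>d\<close> alone.\<close>
  define D' where "D' r a = (if r = n then d a else if a = n then 0 else D r a)" for r a
  have "G a b = (\<Sum>r\<in>insert n I. D' r a * cnj (D' r b))" if ab: "a \<in> insert n I" "b \<in> insert n I" for a b
  proof -
    have "(\<Sum>r\<in>insert n I. D' r a * cnj (D' r b)) = d a * cnj (d b) + (\<Sum>r\<in>I. D' r a * cnj (D' r b))"
      using insert.hyps by (simp add: D'_def)
    also have "(\<Sum>r\<in>I. D' r a * cnj (D' r b)) = (if a = n \<or> b = n then 0 else (\<Sum>r\<in>I. D r a * cnj (D r b)))"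
      using insert.hyps by (auto simp: D'_def intro!: sum.neutral sum.cong)
    also have "d a * cnj (d b) + \<dots> = G a b"
    proof (cases "a = n \<or> b = n")
      case False
      then have "a \<in> I" "b \<in> I" using ab by auto
      from D[OF this] show ?thesis using False by (simp add: algebra_simps)
    next
      case True
      have sq: "complex_of_real (sqrt g') * complex_of_real (sqrt g') = g" using g' by (simp flip: of_real_mult)
      have dn: "d n = complex_of_real (sqrt g')"
      proof (cases "g' = 0")
        case False
        then show ?thesis unfolding d_def g_def[symmetric] sq[symmetric] using g' by simp
      qed (simp add: d_def)
      have dc: "d c * d n = G c n" if "c \<in> insert n I" for c
      proof (cases "g' = 0")
        case True
        then show ?thesis using that g0[OF True, of c] G[of c] g'(1) by (auto simp: d_def g_def)
      next
        case False
        then show ?thesis unfolding dn unfolding d_def[of c] using g' by simp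
      qed
      have Gn: "G n c = cnj (G c n)" if "c \<in> insert n I" for c
        using that G[of c] g'(1) by (auto simp: g_def)
      have cdn: "cnj (d n) = d n" unfolding dn by simp
      show ?thesis
      proof (cases "b = n")
        case True
        then show ?thesis using dc[OF ab(1)] by (simp add: cdn)
      next
        case False
        then have a: "a = n" using \<open>a = n \<or> b = n\<close> by simp
        have "d n * cnj (d b) = cnj (d b * d n)" by (simp add: cdn mult.commute)
        then show ?thesis unfolding a using dc[OF ab(2)] Gn[OF ab(2)] by simp
      qed
    qed
    finally show ?thesis ..
  qed
  then show ?case by (intro exI[of _ D'] ballI)
qed

section \<open>Elementary maps\<close>

definition elem_map :: "'i set \<Rightarrow> ('i \<Rightarrow> 'a::complex_hilbert bop) \<Rightarrow> ('i \<Rightarrow> 'a bop) \<Rightarrow> 'a bop \<Rightarrow> 'a bop" where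
  "elem_map R W V a = (\<Sum>r\<in>R. W r \<odot> a \<odot> V r)"

lemma elem_map_apply: "bop_apply (elem_map R W V a) u = (\<Sum>r\<in>R. bop_apply (W r) (bop_apply a (bop_apply (V r) u)))"
  by (simp add: elem_map_def bop_sum_left)

lemma clinear_elem_map: "clinear (elem_map R W V)"
  unfolding clinear_iff
  by (intro conjI allI bop_eqI)
    (simp_all add: elem_map_apply bop_add_right sum.distrib bop_scaleC_right cvec.scale_sum_right)

lemma normal_elem_map:
  fixes W :: "'i \<Rightarrow> 'b::complex_hilbert bop"
  shows "normal_map (elem_map R W V)"
  unfolding normal_map_iff[OF clinear_elem_map]
proof (intro allI impI)
  fix g :: "'b bop \<Rightarrow> complex" and t assume "l2_rep t g"
  then have cl: "clinear g" by (rule l2_rep_clinear)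
  from \<open>l2_rep t g\<close> obtain x y where x: "summable (\<lambda>n. (norm (x n))\<^sup>2)" and y: "summable (\<lambda>n. (norm (y n))\<^sup>2)"
    and g: "\<And>A. g A = (\<Sum>n. cinner (bop_apply A (x n)) (y n))" unfolding l2_rep_def by blast
  have s: "summable (\<lambda>n. (norm (bop_apply T (z n)))\<^sup>2)" if z: "summable (\<lambda>n. (norm (z n))\<^sup>2)" for T :: "'b bop" and z
  proof (rule summable_comparison_test')
    show "summable (\<lambda>n. (norm T)\<^sup>2 * (norm (z n))\<^sup>2)" by (rule summable_mult[OF z])
    show "norm ((norm (bop_apply T (z n)))\<^sup>2) \<le> (norm T)\<^sup>2 * (norm (z n))\<^sup>2" for n
      using power_mono[OF norm_bop_apply[of T "z n"], of 2] by (simp add: power_mult_distrib)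
  qed
  have "\<exists>t. l2_rep t (\<lambda>A. g (W r \<odot> A \<odot> V r))" for r
    by (rule l2_repI[OF s[OF x, of "V r"] s[OF y, of "adj (W r)"]]) (simp add: g cinner_adj)
  then have "\<exists>t. l2_rep t (\<lambda>A. \<Sum>r\<in>R. g (W r \<odot> A \<odot> V r))" by (rule l2_rep_sum)
  then show "\<exists>t. l2_rep t (\<lambda>A. g (elem_map R W V A))"
    unfolding elem_map_def clinear_functional_sum[OF cl] .
qed

lemma L2_set_sum_le: "L2_set (\<lambda>i. \<Sum>r\<in>R. h r i) A \<le> (\<Sum>r\<in>R. L2_set (h r) A)"
proof (induction R rule: infinite_finite_induct)
  case (insert r R)
  have "L2_set (\<lambda>i. \<Sum>r\<in>insert r R. h r i) A = L2_set (\<lambda>i. h r i + (\<Sum>r\<in>R. h r i)) A"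
    using insert.hyps by simp
  also have "\<dots> \<le> L2_set (h r) A + L2_set (\<lambda>i. \<Sum>r\<in>R. h r i) A" by (rule L2_set_triangle_ineq)
  finally show ?case using insert by simp
qed (simp_all add: L2_set_def)

lemma completely_bounded_elem_map:
  fixes W :: "'i \<Rightarrow> 'b::complex_hilbert bop"
  shows "completely_bounded (elem_map R W V)"
  unfolding completely_bounded_def
proof (intro exI allI)
  fix n :: nat and X :: "nat \<Rightarrow> nat \<Rightarrow> 'b bop"
  show "mat_norm n (\<lambda>i j. elem_map R W V (X i j)) \<le> (\<Sum>r\<in>R. norm (W r) * norm (V r)) * mat_norm n X"
  proof (rule mat_norm_least)
    fix v :: "nat \<Rightarrow> 'b" assume v: "(\<Sum>j<n. (norm (v j))\<^sup>2) \<le> 1"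
    let ?u = "\<lambda>r i. \<Sum>j<n. bop_apply (X i j) (bop_apply (V r) (v j))"
    have "(\<Sum>j<n. bop_apply (elem_map R W V (X i j)) (v j)) = (\<Sum>r\<in>R. bop_apply (W r) (?u r i))" for i
      unfolding elem_map_apply bop_sum_right by (rule sum.swap)
    then have "sqrt (\<Sum>i<n. (norm (\<Sum>j<n. bop_apply (elem_map R W V (X i j)) (v j)))\<^sup>2)
        = L2_set (\<lambda>i. norm (\<Sum>r\<in>R. bop_apply (W r) (?u r i))) {..<n}"
      by (simp add: L2_set_def)
    also have "\<dots> \<le> L2_set (\<lambda>i. \<Sum>r\<in>R. norm (W r) * norm (?u r i)) {..<n}"
      by (intro L2_set_mono sum_norm_le norm_bop_apply) simp
    also have "\<dots> \<le> (\<Sum>r\<in>R. L2_set (\<lambda>i. norm (W r) * norm (?u r i)) {..<n})" by (rule L2_set_sum_le)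
    also have "\<dots> \<le> (\<Sum>r\<in>R. norm (W r) * norm (V r) * mat_norm n X)"
    proof (rule sum_mono)
      fix r
      have "sqrt (\<Sum>j<n. (norm (bop_apply (V r) (v j)))\<^sup>2) \<le> norm (V r)"
      proof (rule real_le_lsqrt)
        have "(\<Sum>j<n. (norm (bop_apply (V r) (v j)))\<^sup>2) \<le> (\<Sum>j<n. (norm (V r))\<^sup>2 * (norm (v j))\<^sup>2)"
          unfolding power_mult_distrib[symmetric] by (intro sum_mono power_mono norm_bop_apply) simp
        also have "\<dots> \<le> (norm (V r))\<^sup>2 * 1" unfolding sum_distrib_left[symmetric] by (intro mult_left_mono v) simp
        finally show "(\<Sum>j<n. (norm (bop_apply (V r) (v j)))\<^sup>2) \<le> (norm (V r))\<^sup>2" by simp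
      qed simp
      then have "mat_norm n X * sqrt (\<Sum>j<n. (norm (bop_apply (V r) (v j)))\<^sup>2) \<le> mat_norm n X * norm (V r)"
        by (intro mult_left_mono mat_norm_nonneg)
      with mat_norm_bound[where n = n and X = X and v = "\<lambda>j. bop_apply (V r) (v j)"]
      have "L2_set (\<lambda>i. norm (?u r i)) {..<n} \<le> mat_norm n X * norm (V r)"
        unfolding L2_set_def by linarith
      then have "norm (W r) * L2_set (\<lambda>i. norm (?u r i)) {..<n} \<le> norm (W r) * (mat_norm n X * norm (V r))"
        by (intro mult_left_mono) simp_all
      then show "L2_set (\<lambda>i. norm (W r) * norm (?u r i)) {..<n} \<le> norm (W r) * norm (V r) * mat_norm n X"
        by (simp add: L2_set_right_distrib mult_ac)
    qed
    finally show "sqrt (\<Sum>i<n. (norm (\<Sum>j<n. bop_apply (elem_map R W V (X i j)) (v j)))\<^sup>2)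
        \<le> (\<Sum>r\<in>R. norm (W r) * norm (V r)) * mat_norm n X" by (simp add: sum_distrib_right)
  qed
qed

text \<open>Left multiplications commute with right multiplications, so the same expression with
  \<open>lmult\<close> is a normal map with the defining property of the extension.\<close>

lemma commutant_ext_elem_map:
  fixes W :: "'i \<Rightarrow> 'b::complex_hilbert bop"
  shows "commutant_ext (elem_map R W V) = elem_map R (\<lambda>r. lmult (W r)) (\<lambda>r. lmult (V r))"
proof (rule commutant_ext_eqI[OF clinear_elem_map normal_elem_map])
  fix x y :: "'b bop"
  show "elem_map R (\<lambda>r. lmult (W r)) (\<lambda>r. lmult (V r)) (rmult y \<odot> lmult x) = rmult y \<odot> lmult (elem_map R W V x)"
    by (intro bop_eqI hs_eqI)
      (simp add: elem_map_apply hs_op_sum bop_sum_left lmult_hs.rep_eq rmult_hs.rep_eq)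
qed

section \<open>Choi operators of elementary maps\<close>

lemma lmult_rank_one: "lmult_hs (u \<boxtimes> v) z = tens u (bop_apply (adj (hs_op z)) v)"
  by transfer (rule rank_one_comp)

text \<open>For rank one coefficients each summand of the Choi operator has rank one and acts
  between elementary tensors. The vector \<open>x0\<close> enters only through its adjoint applied
  to the free vectors \<open>f r\<close> and \<open>f' r\<close>, which is what the final
  approximation adjusts.\<close>

lemma choi_elem_map:
  "choi x0 (elem_map R (\<lambda>r. c r *\<^sub>C (p r \<boxtimes> f r)) (\<lambda>r. f' r \<boxtimes> q r))
    = (\<Sum>r\<in>R. c r *\<^sub>C (tens (p r) (bop_apply (adj (hs_op x0)) (f r)) \<boxtimes> tens (q r) (bop_apply (adj (hs_op x0)) (f' r))))"
proof (intro bop_eqI hs_eqI)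
  fix z v
  have "cinner (lmult_hs (f' r \<boxtimes> q r) z) x0 = cinner z (tens (q r) (bop_apply (adj (hs_op x0)) (f' r)))" for r
    unfolding lmult_rank_one cinner_tens_left cinner_tens_right by (metis cinner_adj cinner_adj')
  then show "bop_apply (hs_op (bop_apply (choi x0 (elem_map R (\<lambda>r. c r *\<^sub>C (p r \<boxtimes> f r)) (\<lambda>r. f' r \<boxtimes> q r))) z)) v
      = bop_apply (hs_op (bop_apply (\<Sum>r\<in>R. c r *\<^sub>C (tens (p r) (bop_apply (adj (hs_op x0)) (f r))
          \<boxtimes> tens (q r) (bop_apply (adj (hs_op x0)) (f' r)))) z)) v"
    by (simp add: choi_def commutant_ext_elem_map elem_map_apply hs_op_sum bop_sum_left rank_one_apply
        lmult_hs.rep_eq bop_scaleC_right cinner_scaleC_left scaleC_scaleC cinner_adj mult_ac)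
qed

section \<open>k-positivity from nonnegativity at vectors of small rank\<close>

lemma sum_Times: "(\<Sum>a\<in>A \<times> B. h a) = (\<Sum>x\<in>A. \<Sum>y\<in>B. h (x, y))"
  by (simp add: sum.cartesian_product)

lemma sum_rotate: "(\<Sum>l\<in>L. \<Sum>m\<in>M. \<Sum>s\<in>S. h l m s) = (\<Sum>s\<in>S. \<Sum>l\<in>L. \<Sum>m\<in>M. h l m s)"
proof -
  have "(\<Sum>m\<in>M. \<Sum>s\<in>S. h l m s) = (\<Sum>s\<in>S. \<Sum>m\<in>M. h l m s)" for l by (rule sum.swap)
  then show ?thesis by (simp only: sum.swap[of _ S L])
qed

text \<open>
  For positive \<open>X\<close> the numbers \<open>(X\<^sub>l\<^sub>m f\<^sub>j | f\<^sub>i)\<close> form a positive semidefinite matrix with rows \<open>(l, i)\<close>; its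
  decomposition into rank one matrices turns the quadratic form of \<open>\<phi>\<close> into values of the quadratic form
  of \<open>A\<close> at vectors of rank at most \<open>k\<close>.
\<close>

lemma k_positive_elem_map:
  fixes c :: "('a::complex_hilbert \<times> 'a) \<times> ('a \<times> 'a) \<Rightarrow> complex" and f :: "'a \<Rightarrow> 'a"
  assumes G: "finite G" "G \<subseteq> onb"
  defines "A \<equiv> \<Sum>s\<in>(G \<times> G) \<times> (G \<times> G). c s *\<^sub>C (tens (fst (fst s)) (snd (fst s)) \<boxtimes> tens (fst (snd s)) (snd (snd s)))"
  assumes pos: "\<And>x. op_rank (hs_op x) \<le> enat k \<Longrightarrow> 0 \<le> cinner (bop_apply A x) x"
  shows "k_positive k (elem_map ((G \<times> G) \<times> (G \<times> G)) (\<lambda>s. c s *\<^sub>C (fst (fst s) \<boxtimes> f (snd (fst s))))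
      (\<lambda>s. f (snd (snd s)) \<boxtimes> fst (snd s)))"
  unfolding k_positive_def
proof (intro allI impI)
  let ?R = "(G \<times> G) \<times> (G \<times> G)"
  let ?p = "\<lambda>s :: ('a \<times> 'a) \<times> ('a \<times> 'a). fst (fst s)" and ?i = "\<lambda>s :: ('a \<times> 'a) \<times> ('a \<times> 'a). snd (fst s)"
  let ?q = "\<lambda>s :: ('a \<times> 'a) \<times> ('a \<times> 'a). fst (snd s)" and ?j = "\<lambda>s :: ('a \<times> 'a) \<times> ('a \<times> 'a). snd (snd s)"
  let ?\<phi> = "elem_map ?R (\<lambda>s. c s *\<^sub>C (?p s \<boxtimes> f (?i s))) (\<lambda>s. f (?j s) \<boxtimes> ?q s)"
  fix X :: "nat \<Rightarrow> nat \<Rightarrow> 'a bop" assume X: "mat_positive k X"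
  define I where "I = {..<k} \<times> G"
  define M where "M a b = cinner (bop_apply (X (fst a) (fst b)) (f (snd b))) (f (snd a))" for a b :: "nat \<times> 'a"
  have I: "finite I" using G by (simp add: I_def)
  have "0 \<le> (\<Sum>a\<in>I. \<Sum>b\<in>I. M a b * z b * cnj (z a))" for z
  proof -
    \<comment> \<open>The coefficients are pushed forward along \<open>f\<close>, which turns the
      form of \<open>M\<close> at \<open>z\<close> into the form of \<open>X\<close> at
      \<open>v\<close>.\<close>
    define v where "v m = (\<Sum>j\<in>G. z (m, j) *\<^sub>C f j)" for m
    have "(\<Sum>a\<in>I. \<Sum>b\<in>I. M a b * z b * cnj (z a))
        = (\<Sum>l<k. \<Sum>i\<in>G. \<Sum>m<k. \<Sum>j\<in>G. cinner (bop_apply (X l m) (f j)) (f i) * z (m, j) * cnj (z (l, i)))"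
      unfolding I_def M_def sum_Times fst_conv snd_conv ..
    also have "\<dots> = (\<Sum>l<k. cinner (\<Sum>m<k. bop_apply (X l m) (v m)) (v l))"
    proof (intro sum.cong refl)
      fix l
      have "cinner (\<Sum>m<k. bop_apply (X l m) (v m)) (v l)
          = (\<Sum>i\<in>G. cnj (z (l, i)) * (\<Sum>m<k. \<Sum>j\<in>G. z (m, j) * cinner (bop_apply (X l m) (f j)) (f i)))"
        by (simp add: v_def[of l] v_def[abs_def] cinner_sum_right cinner_scaleC_right cinner_sum_left bop_sum_right bop_scaleC_right
            cinner_scaleC_left)
      then show "(\<Sum>i\<in>G. \<Sum>m<k. \<Sum>j\<in>G. cinner (bop_apply (X l m) (f j)) (f i) * z (m, j) * cnj (z (l, i)))
          = cinner (\<Sum>m<k. bop_apply (X l m) (v m)) (v l)"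
        by (simp add: sum_distrib_left mult_ac)
    qed
    finally have eq: "(\<Sum>a\<in>I. \<Sum>b\<in>I. M a b * z b * cnj (z a)) = \<dots>" .
    show ?thesis unfolding eq using X unfolding mat_positive_def by (elim allE)
  qed
  from psd_decomposition[OF I this] obtain D :: "nat \<times> 'a \<Rightarrow> nat \<times> 'a \<Rightarrow> complex"
    where "\<forall>a\<in>I. \<forall>b\<in>I. M a b = (\<Sum>r\<in>I. D r a * cnj (D r b))" ..
  then have D: "cinner (bop_apply (X l m) (f j)) (f i) = (\<Sum>r\<in>I. D r (l, i) * cnj (D r (m, j)))"
    if "l < k" "m < k" "i \<in> G" "j \<in> G" for l m i j
    using that by (auto simp: I_def M_def)
  show "mat_positive k (\<lambda>i j. ?\<phi> (X i j))"
    unfolding mat_positive_def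
  proof
    fix u :: "nat \<Rightarrow> 'a"
    \<comment> \<open>The test vectors \<open>u m\<close> and one rank one summand of
      \<open>M\<close> are combined into a vector of H. It has \<open>k\<close> elementary summands,
      hence rank at most \<open>k\<close>, and its coefficients reproduce the factors of that
      summand.\<close>
    define y where "y r = (\<Sum>m<k. tens (u m) (\<Sum>j\<in>G. D r (m, j) *\<^sub>C j))" for r
    have yt: "cinner (y r) (tens q j) = (\<Sum>m<k. cinner (u m) q * cnj (D r (m, j)))" if j: "j \<in> G" for r q j
    proof -
      have "cinner j (\<Sum>j'\<in>G. D r (m, j') *\<^sub>C j') = cnj (D r (m, j))" for m
      proof -
        have "cinner j (\<Sum>j'\<in>G. D r (m, j') *\<^sub>C j') = (\<Sum>j'\<in>G. if j = j' then cnj (D r (m, j')) else 0)"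
          unfolding cinner_sum_right cinner_scaleC_right
          using G j by (intro sum.cong refl) (auto simp: cinner_onb subset_iff)
        then show ?thesis using G(1) j by simp
      qed
      then show ?thesis
        unfolding y_def cinner_sum_left by (simp add: cinner_tens_right cinner_scaleC_left mult.commute)
    qed
    have ty: "cinner (tens p i) (y r) = (\<Sum>l<k. cinner p (u l) * D r (l, i))" if "i \<in> G" for r p i
    proof -
      have "cinner (tens p i) (y r) = cnj (cinner (y r) (tens p i))" by (rule cinner_commute)
      then show ?thesis unfolding yt[OF that] cnj_sum by (simp add: cinner_commute[of p])
    qed
    let ?T = "\<lambda>l m s r. c s * (cinner (u m) (?q s) * cinner (?p s) (u l) * (D r (l, ?i s) * cnj (D r (m, ?j s))))"
    have "(\<Sum>l<k. cinner (\<Sum>m<k. bop_apply (?\<phi> (X l m)) (u m)) (u l))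
        = (\<Sum>l<k. \<Sum>m<k. \<Sum>s\<in>?R. c s * (cinner (u m) (?q s) * cinner (?p s) (u l) *
            cinner (bop_apply (X l m) (f (?j s))) (f (?i s))))"
      by (simp add: elem_map_apply cinner_sum_left rank_one_apply bop_scaleC_right cinner_scaleC_left mult_ac)
    also have "\<dots> = (\<Sum>l<k. \<Sum>m<k. \<Sum>s\<in>?R. \<Sum>r\<in>I. ?T l m s r)"
      unfolding sum_distrib_left[symmetric] by (intro sum.cong refl) (simp add: D mem_Times_iff)
    also have "\<dots> = (\<Sum>s\<in>?R. \<Sum>l<k. \<Sum>m<k. \<Sum>r\<in>I. ?T l m s r)" by (rule sum_rotate)
    also have "\<dots> = (\<Sum>s\<in>?R. \<Sum>r\<in>I. \<Sum>l<k. \<Sum>m<k. ?T l m s r)" by (intro sum.cong refl) (rule sum_rotate)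
    also have "\<dots> = (\<Sum>r\<in>I. \<Sum>s\<in>?R. \<Sum>l<k. \<Sum>m<k. ?T l m s r)" by (rule sum.swap)
    also have "\<dots> = (\<Sum>r\<in>I. cinner (bop_apply A (y r)) (y r))"
    proof (intro sum.cong refl)
      fix r
      have "cinner (bop_apply A (y r)) (y r)
          = (\<Sum>s\<in>?R. c s * (cinner (tens (?p s) (?i s)) (y r) * cinner (y r) (tens (?q s) (?j s))))"
        by (simp add: A_def bop_sum_left cinner_sum_left rank_one_apply cinner_scaleC_left mult_ac)
      also have "\<dots> = (\<Sum>s\<in>?R. \<Sum>l<k. \<Sum>m<k. ?T l m s r)"
      proof (intro sum.cong refl)
        fix s assume s: "s \<in> ?R"
        then have i: "?i s \<in> G" and j: "?j s \<in> G" by (auto simp: mem_Times_iff)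
        show "c s * (cinner (tens (?p s) (?i s)) (y r) * cinner (y r) (tens (?q s) (?j s))) = (\<Sum>l<k. \<Sum>m<k. ?T l m s r)"
          unfolding ty[OF i] yt[OF j] sum_product unfolding sum_distrib_left
          by (intro sum.cong refl) (simp add: mult_ac)
      qed
      finally show "(\<Sum>s\<in>?R. \<Sum>l<k. \<Sum>m<k. ?T l m s r) = cinner (bop_apply A (y r)) (y r)" ..
    qed
    finally have eq: "(\<Sum>l<k. cinner (\<Sum>m<k. bop_apply (?\<phi> (X l m)) (u m)) (u l)) = \<dots>" .
    show "0 \<le> (\<Sum>l<k. cinner (\<Sum>m<k. bop_apply (?\<phi> (X l m)) (u m)) (u l))"
      unfolding eq y_def by (intro sum_nonneg pos op_rank_tens_le)
  qed
qed

section \<open>Separation from the cone of Schmidt number at most \<open>k\<close>\<close>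

lemma inj_tens_onb: "inj_on (\<lambda>(e, f). tens e f) (onb \<times> onb)"
proof (rule inj_onI, clarify)
  fix e f e' f' :: 'a assume o: "e \<in> onb" "f \<in> onb" "e' \<in> onb" "f' \<in> onb" and eq: "tens e f = tens e' f'"
  have "cinner (tens e f) (tens e' f') = 1"
    unfolding eq[symmetric] by (simp add: cinner_tens_right cinner_scaleC_left cinner_onb o)
  then show "e = e' \<and> f = f'"
    using o by (simp add: cinner_tens_right cinner_scaleC_left cinner_onb split: if_splits)
qed

definition tens_set :: "'a::complex_hilbert set \<Rightarrow> 'a hs set" where
  "tens_set G = (\<lambda>(e, f). tens e f) ` (G \<times> G)"

lemma sum_tens_set:
  assumes "G \<subseteq> onb"
  shows "(\<Sum>t\<in>tens_set G. h t) = (\<Sum>s\<in>G \<times> G. h (tens (fst s) (snd s)))"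
proof -
  have "inj_on (\<lambda>(e, f). tens e f) (G \<times> G)" using inj_on_subset[OF inj_tens_onb, of "G \<times> G"] assms by auto
  then show ?thesis unfolding tens_set_def by (simp add: sum.reindex case_prod_unfold)
qed

lemma tens_set_ortho:
  assumes "finite G" "G \<subseteq> onb"
  shows "is_ortho (tens_set G)" "finite (tens_set G)"
proof -
  have o: "is_ortho {tens e f |e f. e \<in> onb \<and> f \<in> (onb :: 'a set)}"
    using onb_tens[OF is_onb_onb[where 'a = 'a]] by (simp add: is_onb_def)
  have sub: "tens_set G \<subseteq> {tens e f |e f. e \<in> onb \<and> f \<in> onb}"
    using assms(2) by (auto simp: tens_set_def)
  show "is_ortho (tens_set G)"
    unfolding is_ortho_def by (intro ballI o[unfolded is_ortho_def, rule_format] subsetD[OF sub])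
  show "finite (tens_set G)" using assms(1) by (simp add: tens_set_def)
qed

lemma ortho_proj_tens:
  assumes "G \<subseteq> onb"
  shows "bop_apply (ortho_proj (tens_set G)) (tens u v) = tens (bop_apply (ortho_proj G) u) (bop_apply (ortho_proj G) v)"
proof -
  have "cinner (tens u v) (tens e f) *\<^sub>C tens e f = tens (cinner u e *\<^sub>C e) (cinner v f *\<^sub>C f)" for e f
    by (simp add: cinner_tens_right cinner_scaleC_left tens_scaleC_left tens_scaleC_right scaleC_scaleC
        cinner_commute[of f v] mult.commute)
  then have "bop_apply (ortho_proj (tens_set G)) (tens u v) = (\<Sum>e\<in>G. \<Sum>f\<in>G. tens (cinner u e *\<^sub>C e) (cinner v f *\<^sub>C f))"
    unfolding ortho_proj_apply sum_tens_set[OF assms] sum_Times fst_conv snd_conv by simp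
  also have "\<dots> = tens (bop_apply (ortho_proj G) u) (bop_apply (ortho_proj G) v)"
    unfolding ortho_proj_apply tens_sum_left unfolding tens_sum_right ..
  finally show ?thesis .
qed

text \<open>Over a product set the projection acts on each factor of an elementary tensor
  separately, so it keeps the number of summands.\<close>

lemma op_rank_ortho_proj:
  assumes "G \<subseteq> onb" "op_rank (hs_op x) \<le> enat k"
  shows "op_rank (hs_op (bop_apply (ortho_proj (tens_set G)) x)) \<le> enat k"
proof -
  from op_rank_le_tens[OF assms(2)] obtain u v where x: "x = (\<Sum>l<k. tens (u l) (v l))" by (elim exE)
  show ?thesis unfolding x bop_sum_right ortho_proj_tens[OF assms(1)] by (rule op_rank_tens_le)
qed

section \<open>Cones of functionals and cones of Hilbert-Schmidt vectors\<close>

lemma convex_cone_closure: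
  fixes S :: "'a::real_normed_vector set"
  assumes S: "convex_cone S"
  shows "convex_cone (closure S)"
proof -
  have "c *\<^sub>R x \<in> closure S" if "0 \<le> c" "x \<in> closure S" for c x
  proof -
    have "(\<lambda>x. c *\<^sub>R x) ` S \<subseteq> closure S"
      using convex_cone_scaleR[OF S that(1)] closure_subset by auto
    from bounded_linear_image_closure_subset[OF bounded_linear_scaleR_right this closed_closure] that(2)
    show ?thesis by auto
  qed
  then show ?thesis using S by (simp add: convex_cone_def conic_def convex_closure)
qed

lemma closed_schmidt_cone: "closed (schmidt_cone k)"
  and convex_cone_schmidt_cone: "convex_cone (schmidt_cone k)"
  unfolding schmidt_cone_def by (rule closed_closure, rule convex_cone_closure[OF convex_cone_convex_cone_hull])

lemma vec_functional_in_schmidt_cone: "op_rank (hs_op x) \<le> enat k \<Longrightarrow> vec_functional x x \<in> schmidt_cone k"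
  unfolding schmidt_cone_def by (rule subsetD[OF closure_subset], rule hull_inc, rule CollectI, rule exI[of _ x]) simp

definition hs_cone :: "nat \<Rightarrow> 'a::complex_hilbert hs hs set" where
  "hs_cone k = closure (convex_cone hull {tens x x |x. op_rank (hs_op x) \<le> enat k})"

text \<open>The map is continuous and linear over the reals, and it sends the generator
  \<open>tens x x\<close> to the vector functional at the projected vector, whose rank is not
  larger. A compression outside the Schmidt cone therefore has its density outside
  \<open>hs_cone\<close>, where separation by a nearest point is possible.\<close>

lemma hs_functional_hs_cone:
  assumes G: "finite G" "G \<subseteq> onb" and s: "s \<in> hs_cone k"
  shows "hs_functional (tens_set G) s \<in> schmidt_cone k"
proof -
  let ?T = "hs_functional (tens_set G)"
  interpret T: bounded_linear ?T by (rule bounded_linear_hs_functional)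
  note cc = convex_cone_schmidt_cone[of k]
  have "convex_cone hull {tens x x |x. op_rank (hs_op x) \<le> enat k} \<subseteq> ?T -` schmidt_cone k"
  proof (rule hull_minimal)
    show "{tens x x |x. op_rank (hs_op x) \<le> enat k} \<subseteq> ?T -` schmidt_cone k"
      by (clarify, unfold vimage_eq hs_functional_tens)
        (intro vec_functional_in_schmidt_cone op_rank_ortho_proj G(2))
    show "convex_cone (?T -` schmidt_cone k)"
      unfolding convex_cone_iff
      by (intro conjI ballI allI impI; unfold vimage_eq)
        (simp_all add: T.zero T.add T.scaleR convex_cone_contains_0[OF cc] convex_cone_add[OF cc] convex_cone_scaleR[OF cc])
  qed
  then have "?T ` (convex_cone hull {tens x x |x. op_rank (hs_op x) \<le> enat k}) \<subseteq> schmidt_cone k" by auto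
  from bounded_linear_image_closure_subset[OF T.bounded_linear_axioms this closed_schmidt_cone] s
  show ?thesis unfolding hs_cone_def by auto
qed

lemma schmidt_cone_if_compress:
  assumes \<rho>: "\<rho> \<in> predual" and c: "\<And>G. finite G \<Longrightarrow> G \<subseteq> onb \<Longrightarrow> compress (tens_set G) \<rho> \<in> schmidt_cone k"
  shows "\<rho> \<in> schmidt_cone k"
proof -
  let ?B = "(\<lambda>(e, f). tens e f) ` (onb \<times> onb)"
  have B: "?B = {tens e f |e f. e \<in> onb \<and> f \<in> onb}" by auto
  have "\<rho> \<in> approximable ?B"
    unfolding B using \<rho> unfolding predual_eq_approximable[OF onb_tens[OF is_onb_onb]] .
  then have lim: "((\<lambda>F. compress F \<rho>) \<longlongrightarrow> \<rho>) (finite_subsets_at_top ?B)" by (simp add: approximable_def)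
  have "\<rho> \<in> closure (schmidt_cone k)"
    unfolding closure_approachable
  proof (intro allI impI)
    fix e :: real assume "0 < e"
    with lim have "\<forall>\<^sub>F F in finite_subsets_at_top ?B. dist (compress F \<rho>) \<rho> < e" by (rule tendstoD)
    then obtain F0 where F0: "finite F0" "F0 \<subseteq> ?B"
      and F: "\<forall>F. finite F \<and> F0 \<subseteq> F \<and> F \<subseteq> ?B \<longrightarrow> dist (compress F \<rho>) \<rho> < e"
      unfolding eventually_finite_subsets_at_top by (elim exE conjE)
    from finite_subset_image[OF F0] obtain P where P: "P \<subseteq> onb \<times> onb" "finite P" "F0 = (\<lambda>(e, f). tens e f) ` P"
      by (elim exE conjE)
    \<comment> \<open>All left and right factors of the tensors in \<open>F0\<close>: the product
      sets are cofinal among the finite subsets of the basis.\<close>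
    define G where "G = fst ` P \<union> snd ` P"
    have G: "finite G" "G \<subseteq> onb" using P(1,2) by (auto simp: G_def)
    have "P \<subseteq> G \<times> G" by (force simp: G_def)
    then have "F0 \<subseteq> tens_set G" unfolding P(3) tens_set_def by (rule image_mono)
    moreover have "tens_set G \<subseteq> ?B" unfolding tens_set_def using G(2) by (intro image_mono) auto
    ultimately have "dist (compress (tens_set G) \<rho>) \<rho> < e"
      by (intro F[rule_format] conjI tens_set_ortho(2)[OF G])
    then show "\<exists>y\<in>schmidt_cone k. dist y \<rho> < e" using c[OF G] by (rule rev_bexI[rotated])
  qed
  then show ?thesis unfolding closure_closed[OF closed_schmidt_cone] .
qed

text \<open>An operator with real quadratic form is dominated by its norm times the identity, and so
  is a difference of two positive operators.\<close>

lemma positive_functional_self_adjoint: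
  assumes cl: "clinear (blinfun_apply \<rho>)" and p: "positive_functional \<rho>"
    and S: "\<And>v. Im (cinner (bop_apply S v) v) = 0"
  shows "Im (blinfun_apply \<rho> S) = 0"
proof -
  have "bop_apply (Bop (\<lambda>x :: 'a. x)) = (\<lambda>x. x)" by (rule Bop_inverse) (simp add: clinear_iff)
  then obtain J :: "'a bop" where J: "\<And>v. bop_apply J v = v" by metis
  let ?n = "complex_of_real (norm S)"
  have bd: "\<bar>Re (cinner (bop_apply S v) v)\<bar> \<le> norm S * (norm v)\<^sup>2" for v
  proof -
    have "\<bar>Re (cinner (bop_apply S v) v)\<bar> \<le> norm (bop_apply S v) * norm v"
      by (rule order_trans[OF abs_Re_le_cmod cmod_cinner_le])
    also have "\<dots> \<le> norm S * norm v * norm v" by (intro mult_right_mono norm_bop_apply) simp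
    finally show ?thesis by (simp add: power2_eq_square mult.assoc)
  qed
  have "positive_op (?n *\<^sub>C J)" "positive_op (?n *\<^sub>C J - S)"
    unfolding positive_op_def using bd S
    by (auto simp: J cinner_scaleC_left cinner_diff_left cinner_self less_eq_complex_def abs_le_iff simp flip: of_real_mult of_real_power)
  then have "0 \<le> blinfun_apply \<rho> (?n *\<^sub>C J)" "0 \<le> blinfun_apply \<rho> (?n *\<^sub>C J - S)"
    using p by (simp_all add: positive_functional_def)
  then show ?thesis by (simp add: blinfun.diff_right less_eq_complex_def)
qed

lemma positive_functional_adj:
  assumes cl: "clinear (blinfun_apply \<rho>)" and p: "positive_functional \<rho>"
  shows "Re (blinfun_apply \<rho> (adj M)) = Re (blinfun_apply \<rho> M)"
proof -
  have a: "cinner (bop_apply (adj M) v) v = cnj (cinner (bop_apply M v) v)" for v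
    by (metis cinner_adj' cinner_commute)
  have "Im (blinfun_apply \<rho> (\<i> *\<^sub>C (M - adj M))) = 0"
    by (rule positive_functional_self_adjoint[OF cl p]) (simp add: cinner_scaleC_left cinner_diff_left a)
  moreover have "blinfun_apply \<rho> (\<i> *\<^sub>C (M - adj M)) = \<i> * (blinfun_apply \<rho> M - blinfun_apply \<rho> (adj M))"
    using cl by (simp add: clinear_functional_iff blinfun.diff_right)
  ultimately show ?thesis by simp
qed

lemma cinner_ortho_proj_left: "cinner (bop_apply (ortho_proj F) u) v = cinner u (bop_apply (ortho_proj F) v)"
proof -
  have "cinner p v = cnj (cinner v p)" for p by (rule cinner_commute)
  then show ?thesis
    by (simp add: ortho_proj_apply cinner_sum_left cinner_sum_right cinner_scaleC_left cinner_scaleC_right mult.commute)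
qed

lemma adj_cut: "adj (cut F M) = cut F (adj M)"
  by (rule adj_eqI) (simp only: cut_def bop_comp_apply cinner_ortho_proj_left cinner_adj[of M])

lemma cut_scaleC_add: "cut F (c *\<^sub>C (M + N)) = c *\<^sub>C (cut F M + cut F N)"
  by (rule bop_eqI) (simp add: cut_def bop_add_right bop_scaleC_right)

lemma schmidt_cone_separation:
  assumes \<rho>: "\<rho> \<in> predual" "positive_functional \<rho>" and n: "\<rho> \<notin> schmidt_cone k"
  shows "\<exists>G A. finite G \<and> G \<subseteq> onb \<and> Re (blinfun_apply \<rho> (cut (tens_set G) A)) < 0 \<and>
    (\<forall>x. op_rank (hs_op x) \<le> enat k \<longrightarrow> 0 \<le> cinner (bop_apply (cut (tens_set G) A) x) x)"
proof -
  have cl: "clinear (blinfun_apply \<rho>)" using \<rho>(1) by (simp add: predual_def)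
  from n obtain G where G: "finite G" "G \<subseteq> onb" and nG: "compress (tens_set G) \<rho> \<notin> schmidt_cone k"
    using schmidt_cone_if_compress[OF \<rho>(1)] by blast
  let ?F = "tens_set G"
  note F = tens_set_ortho[OF G]
  have "hs_density ?F \<rho> \<notin> hs_cone k"
    using hs_functional_hs_cone[OF G, of "hs_density ?F \<rho>" k] nG hs_functional_density[OF F] by auto
  from separation_closed_cone[OF _ _ this] obtain b where b: "\<forall>s\<in>hs_cone k. inner b s \<le> 0" "0 < inner b (hs_density ?F \<rho>)"
    unfolding hs_cone_def using convex_cone_closure[OF convex_cone_convex_cone_hull] by blast
  \<comment> \<open>Separation controls only real parts, while nonnegativity of a complex number
    includes being real; hence the hermitian part. The sign turns the upper bound 0 on the cone into
    a lower bound.\<close>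
  define A where "A = (- 1 / 2) *\<^sub>C (hs_op b + adj (hs_op b))"
  have "Re (blinfun_apply \<rho> (cut ?F A)) < 0"
  proof -
    have "blinfun_apply \<rho> (cut ?F A)
        = (- 1 / 2) * (blinfun_apply \<rho> (cut ?F (hs_op b)) + blinfun_apply \<rho> (adj (cut ?F (hs_op b))))"
      unfolding A_def cut_scaleC_add adj_cut using cl by (simp only: clinear_functional_iff)
    then have "Re (blinfun_apply \<rho> (cut ?F A)) = - Re (blinfun_apply \<rho> (cut ?F (hs_op b)))"
      using positive_functional_adj[OF cl \<rho>(2), of "cut ?F (hs_op b)"] by simp
    then show ?thesis using b(2) by (simp flip: Re_cinner add: cinner_hs_density[OF cl])
  qed
  moreover have "0 \<le> cinner (bop_apply (cut ?F A) x) x" if x: "op_rank (hs_op x) \<le> enat k" for x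
  proof -
    let ?y = "bop_apply (ortho_proj ?F) x"
    let ?z = "cinner (bop_apply (hs_op b) ?y) ?y"
    have "tens ?y ?y \<in> hs_cone k"
      unfolding hs_cone_def using op_rank_ortho_proj[OF G(2) x]
      by (intro subsetD[OF closure_subset] hull_inc CollectI exI[of _ ?y] conjI refl)
    then have "inner b (tens ?y ?y) \<le> 0" using b(1) by blast
    then have z: "Re ?z \<le> 0" by (simp flip: Re_cinner add: cinner_tens_right)
    have "cinner (bop_apply (adj (hs_op b)) ?y) ?y = cnj ?z" by (metis cinner_adj' cinner_commute)
    then have "cinner (bop_apply (cut ?F A) x) x = (- 1 / 2) * (?z + cnj ?z)"
      by (simp only: cut_def bop_comp_apply cinner_ortho_proj_left A_def bop_apply_simps
          cinner_scaleC_left cinner_add_left)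
    then show ?thesis using z by (simp add: less_eq_complex_def)
  qed
  ultimately show ?thesis using G by (intro exI[of _ G] exI[of _ A] conjI allI impI)
qed

section \<open>The duality theorem\<close>

text \<open>A vector \<open>b\<close> obstructing density is annihilated by \<open>x0\<close>, hence
  by every product a x0, and by cyclicity and continuity by every Hilbert-Schmidt operator. The
  operator \<open>tens b b\<close> then forces \<open>b\<close> to be 0.\<close>

lemma cyclic_dense_range_adj:
  assumes "cyclic_vec x0"
  shows "closure (range (bop_apply (adj (hs_op x0)))) = UNIV"
proof (rule ccontr)
  let ?V = "range (bop_apply (adj (hs_op x0)))"
  assume "closure ?V \<noteq> UNIV"
  then obtain z where z: "z \<notin> closure ?V" by blast
  have "convex_cone ?V"
    unfolding convex_cone_iff
  proof (intro conjI ballI allI impI)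
    show "0 \<in> ?V" by (rule range_eqI[of _ _ 0]) simp
    fix x assume "x \<in> ?V"
    then obtain v where x: "x = bop_apply (adj (hs_op x0)) v" by blast
    show "c *\<^sub>R x \<in> ?V" for c
      unfolding x scaleR_scaleC by (rule range_eqI[of _ _ "complex_of_real c *\<^sub>C v"]) (simp add: bop_scaleC_right)
    fix y assume "y \<in> ?V"
    then obtain w where y: "y = bop_apply (adj (hs_op x0)) w" by blast
    show "x + y \<in> ?V" unfolding x y by (rule range_eqI[of _ _ "v + w"]) (simp add: bop_add_right)
  qed
  from separation_closed_cone[OF closed_closure convex_cone_closure[OF this] z]
  obtain b where b: "\<forall>s\<in>closure ?V. inner b s \<le> 0" "0 < inner b z" by (elim exE conjE)
  \<comment> \<open>Separation gives one real inequality for each vector in the range. At this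
    vector it bounds the squared norm of x0 b by 0.\<close>
  have "bop_apply (adj (hs_op x0)) (bop_apply (hs_op x0) b) \<in> closure ?V"
    by (rule subsetD[OF closure_subset rangeI])
  with b(1) have "inner b (bop_apply (adj (hs_op x0)) (bop_apply (hs_op x0) b)) \<le> 0" by (rule bspec)
  moreover have "cinner b (bop_apply (adj (hs_op x0)) (bop_apply (hs_op x0) b))
      = cinner (bop_apply (hs_op x0) b) (bop_apply (hs_op x0) b)" by (rule cinner_adj[symmetric])
  ultimately have "(norm (bop_apply (hs_op x0) b))\<^sup>2 \<le> 0" by (simp flip: Re_cinner add: cinner_self)
  then have x0b: "bop_apply (hs_op x0) b = 0" by simp
  have bl: "bounded_linear (\<lambda>x. bop_apply (hs_op x) b)"
  proof (rule bounded_linear_intro)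
    show "norm (bop_apply (hs_op x) b) \<le> norm x * norm b" for x
      by (rule order_trans[OF norm_bop_apply mult_right_mono[OF norm_hs_op_le]]) simp
  qed simp_all
  have "(\<lambda>x. bop_apply (hs_op x) b) ` closure (range (\<lambda>a. bop_apply (lmult a) x0)) \<subseteq> {0}"
    by (rule bounded_linear_image_closure_subset[OF bl _ closed_singleton]) (auto simp: lmult_hs.rep_eq x0b)
  moreover have "tens b b \<in> closure (range (\<lambda>a. bop_apply (lmult a) x0))"
    using assms by (simp add: cyclic_vec_def)
  ultimately have "bop_apply (hs_op (tens b b)) b = 0" by blast
  then have "complex_of_real ((norm b)\<^sup>2) *\<^sub>C b = 0" by (simp add: cinner_self)
  then have "b = 0" by auto
  then show False using b(2) by simp
qed

lemma bounded_bilinear_rank_one: "bounded_bilinear (rank_one :: 'a::complex_hilbert \<Rightarrow> 'a \<Rightarrow> _)"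
proof
  fix a a' b b' :: 'a and r :: real
  show "(a + a') \<boxtimes> b = a \<boxtimes> b + a' \<boxtimes> b" "a \<boxtimes> (b + b') = a \<boxtimes> b + a \<boxtimes> b'"
    by (rule bop_eqI; simp add: rank_one_apply scaleC_add_right cinner_add_right scaleC_add_left)+
  show "(r *\<^sub>R a) \<boxtimes> b = r *\<^sub>R (a \<boxtimes> b)" "a \<boxtimes> (r *\<^sub>R b) = r *\<^sub>R (a \<boxtimes> b)"
    by (rule bop_eqI; simp add: rank_one_apply scaleR_scaleC scaleC_scaleC cinner_scaleC_right mult.commute)+
  have "norm (x \<boxtimes> y) \<le> norm x * norm y * 1" for x y :: 'a
  proof (rule norm_bop_bound)
    fix v
    show "norm (bop_apply (x \<boxtimes> y) v) \<le> norm x * norm y * 1 * norm v"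
      using mult_right_mono[OF cmod_cinner_le[of v y], of "norm x"]
      by (simp add: rank_one_apply norm_scaleC mult_ac)
  qed simp
  then show "\<exists>K. \<forall>a b :: 'a. norm (a \<boxtimes> b) \<le> norm a * norm b * K" by (intro exI[of _ 1] allI)
qed

lemma tendsto_tens:
  assumes "(g \<longlongrightarrow> v) \<F>"
  shows "((\<lambda>n. tens u (g n)) \<longlongrightarrow> tens u v) \<F>"
proof -
  have "bounded_linear (tens u)"
    by (rule bounded_linear_intro[of _ "norm u"])
      (simp_all add: tens_add_right scaleR_scaleC tens_scaleC_right norm_tens mult.commute)
  from bounded_linear.tendsto[OF this assms] show ?thesis .
qed

theorem theorem5p3:
  fixes x0 :: "'k::complex_hilbert hs"
    and k :: nat
    and \<rho> :: "'k hs bop \<Rightarrow>\<^sub>L complex"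
  assumes "separable_space (euclidean :: 'k topology)"
    and "\<not> (\<exists>S :: 'k set. finite S \<and> cvec.span S = UNIV)"
    and "norm x0 = 1" and "cyclic_vec x0" and "separating_vec x0"
    and "k \<ge> 1"
    and "\<rho> \<in> predual" and "positive_functional \<rho>"
  shows "\<rho> \<in> schmidt_cone k \<longleftrightarrow>
    (\<forall>\<phi> \<in> normal_cb_pos k. 0 \<le> blinfun_apply \<rho> (choi x0 \<phi>))"
proof
  assume \<rho>: "\<rho> \<in> schmidt_cone k"
  show "\<forall>\<phi> \<in> normal_cb_pos k. 0 \<le> blinfun_apply \<rho> (choi x0 \<phi>)"
    by (intro ballI schmidt_cone_nonneg[OF \<rho>] choi_block_positive)
next
  assume *: "\<forall>\<phi> \<in> normal_cb_pos k. 0 \<le> blinfun_apply \<rho> (choi x0 \<phi>)"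
  have cl: "clinear (blinfun_apply \<rho>)" using assms(7) by (simp add: predual_def)
  show "\<rho> \<in> schmidt_cone k"
  proof (rule ccontr)
    assume "\<rho> \<notin> schmidt_cone k"
    from schmidt_cone_separation[OF assms(7,8) this] obtain G A where G: "finite G" "G \<subseteq> onb"
      and neg: "Re (blinfun_apply \<rho> (cut (tens_set G) A)) < 0"
      and pos: "\<forall>x. op_rank (hs_op x) \<le> enat k \<longrightarrow> 0 \<le> cinner (bop_apply (cut (tens_set G) A) x) x"
      by (elim exE conjE)
    let ?R = "(G \<times> G) \<times> (G \<times> G)"
    let ?p = "\<lambda>s :: ('k \<times> 'k) \<times> ('k \<times> 'k). fst (fst s)" and ?i = "\<lambda>s :: ('k \<times> 'k) \<times> ('k \<times> 'k). snd (fst s)"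
    let ?q = "\<lambda>s :: ('k \<times> 'k) \<times> ('k \<times> 'k). fst (snd s)" and ?j = "\<lambda>s :: ('k \<times> 'k) \<times> ('k \<times> 'k). snd (snd s)"
    define c where "c s = cinner (bop_apply A (tens (?q s) (?j s))) (tens (?p s) (?i s))" for s
    have A: "cut (tens_set G) A = (\<Sum>s\<in>?R. c s *\<^sub>C (tens (?p s) (?i s) \<boxtimes> tens (?q s) (?j s)))"
      unfolding cut_eq sum_tens_set[OF G(2)] sum_Times fst_conv snd_conv c_def ..
    have "\<exists>h. (\<lambda>n. bop_apply (adj (hs_op x0)) (h n)) \<longlonglongrightarrow> i" for i
    proof -
      have "i \<in> closure (range (bop_apply (adj (hs_op x0))))" using cyclic_dense_range_adj[OF assms(4)] by simp
      then obtain g where g: "\<forall>n. g n \<in> range (bop_apply (adj (hs_op x0)))" "g \<longlonglongrightarrow> i"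
        unfolding closure_sequential by (elim exE conjE)
      from g(1) have "\<forall>n. \<exists>v. g n = bop_apply (adj (hs_op x0)) v" by blast
      from choice[OF this] obtain h where "\<forall>n. g n = bop_apply (adj (hs_op x0)) (h n)" ..
      then have "g = (\<lambda>n. bop_apply (adj (hs_op x0)) (h n))" by (intro ext) (elim allE)
      then show ?thesis using g(2) by (intro exI[of _ h]) simp
    qed
    then have "\<forall>i. \<exists>h. (\<lambda>n. bop_apply (adj (hs_op x0)) (h n)) \<longlonglongrightarrow> i" by (rule allI)
    from choice[OF this] obtain f where "\<forall>i. (\<lambda>n. bop_apply (adj (hs_op x0)) (f i n)) \<longlonglongrightarrow> i" ..
    then have f: "(\<lambda>n. bop_apply (adj (hs_op x0)) (f i n)) \<longlonglongrightarrow> i" for i by (elim allE)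
    \<comment> \<open>The vectors \<open>f i n\<close> replace preimages of the basis vectors
      \<open>i\<close> under the adjoint of \<open>x0\<close>. With exact preimages the Choi
      operator would be the compressed \<open>A\<close> itself; here it converges to it in norm,
      since \<open>?R\<close> is finite and each summand depends continuously on the images.\<close>
    define \<phi> where "\<phi> n = elem_map ?R (\<lambda>s. c s *\<^sub>C (?p s \<boxtimes> f (?i s) n)) (\<lambda>s. f (?j s) n \<boxtimes> ?q s)" for n
    have "\<phi> n \<in> normal_cb_pos k" for n
    proof -
      have "k_positive k (\<phi> n)"
        unfolding \<phi>_def by (rule k_positive_elem_map[OF G, where c = c and f = "\<lambda>i. f i n"]) (use pos A in simp)
      then show ?thesis
        using clinear_elem_map normal_elem_map completely_bounded_elem_map
        unfolding normal_cb_pos_def normal_cb_def \<phi>_def by blast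
    qed
    then have "0 \<le> Re (blinfun_apply \<rho> (choi x0 (\<phi> n)))" for n
      using * by (simp add: less_eq_complex_def)
    moreover have "(\<lambda>n. choi x0 (\<phi> n)) \<longlonglongrightarrow> cut (tens_set G) A"
      unfolding \<phi>_def choi_elem_map A
    proof (rule tendsto_sum)
      fix s
      have bl: "bounded_linear (\<lambda>X :: 'k hs bop. c s *\<^sub>C X)"
      proof (rule bounded_linear_intro)
        show "norm (c s *\<^sub>C X) \<le> norm X * cmod (c s)" for X :: "'k hs bop"
        proof (rule norm_bop_bound)
          show "norm (bop_apply (c s *\<^sub>C X) v) \<le> norm X * cmod (c s) * norm v" for v
            using mult_left_mono[OF norm_bop_apply[of X v], of "cmod (c s)"] by (simp add: norm_scaleC mult_ac)
        qed simp
      qed (simp_all add: scaleC_add_right scaleR_scaleC scaleC_scaleC mult.commute)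
      show "(\<lambda>n. c s *\<^sub>C (tens (?p s) (bop_apply (adj (hs_op x0)) (f (?i s) n))
          \<boxtimes> tens (?q s) (bop_apply (adj (hs_op x0)) (f (?j s) n))))
        \<longlonglongrightarrow> c s *\<^sub>C (tens (?p s) (?i s) \<boxtimes> tens (?q s) (?j s))"
        by (intro bounded_linear.tendsto[OF bl] bounded_bilinear.tendsto[OF bounded_bilinear_rank_one] tendsto_tens f)
    qed
    then have "(\<lambda>n. Re (blinfun_apply \<rho> (choi x0 (\<phi> n)))) \<longlonglongrightarrow> Re (blinfun_apply \<rho> (cut (tens_set G) A))"
      by (intro tendsto_intros)
    ultimately have "0 \<le> Re (blinfun_apply \<rho> (cut (tens_set G) A))" by (intro LIMSEQ_le_const) auto
    then show False using neg by simp
  qed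
qed

end
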